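(* Let $V$ be a 2-dimensional complex vector space and let $0\le\theta\le\pi$. Let $R=R(\theta):V^{\otimes 3}\to V^{\otimes 3}$ be the $(2,3,1)$ generalized Yang-Baxter operator of type III, i.e. the operator represented on the lexicographically ordered basis of $V^{\otimes 3}$ by $$R(\theta)=\frac{1}{\sqrt{2}}\begin{pmatrix}1&0&1&0\\ 0&1&0&e^{i\theta}\\ -1&0&1&0\\ 0&-e^{-i\theta}&0&1\end{pmatrix}\oplus\frac{1}{\sqrt{2}}\begin{pmatrix}1&0&-e^{i\theta}&0\\ 0&1&0&-e^{2i\theta}\\ e^{-i\theta}&0&1&0\\ 0&e^{-2i\theta}&0&1\end{pmatrix}.$$ Let $\mu=\mathrm{Id}_V$, $\alpha=1$, $\beta=\sqrt{2}$. Then $S=(R,\mu,\alpha,\beta)$ is an enhanced generalized Yang-Baxter operator (with $k=3$, $m=1$) whose associated oriented link invariant $T_S$ satisfies $$T_S(L_+)+T_S(L_-)=\sqrt{2}\,T_S(L_0)$$ for every triple $(L_-,L_0,L_+)$, and $T_S(G_n)=(\sqrt{2})^{-n}2^{n+1}$ for all $n\ge 1$, where $G_n$ is the trivial $n$-component link.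
   Context: $V$ is a finite-dimensional complex vector space of dimension $d$; $I_m$ denotes the identity of $V^{\otimes m}$. $B_n$ is the braid group with generators $\sigma_1,\dots,\sigma_{n-1}$ (positive crossings) and relations $\sigma_i\sigma_j=\sigma_j\sigma_i$ for $|i-j|\ge 2$, $\sigma_i\sigma_{i+1}\sigma_i=\sigma_{i+1}\sigma_i\sigma_{i+1}$. Operator trace. For a basis $v_1,\dots,v_d$ of $V$ and $f\in\mathrm{End}(V^{\otimes k})$ write $f(v_{i_1}\otimes\cdots\otimes v_{i_k})=\sum f^{j_1,\dots,j_k}_{i_1,\dots,i_k}v_{j_1}\otimes\cdots\otimes v_{j_k}$. For $m<k$, $\mathrm{Sp}_{k,m}:\mathrm{End}(V^{\otimes k})\to\mathrm{End}(V^{\otimes (k-m)})$ is the partial trace over the last $m$ tensor factors: $\mathrm{Sp}_{k,m}(f)(v_{i_1}\otimes\cdots\otimes v_{i_{k-m}})=\sum_{j_1,\dots,j_{k-m},l_1,\dots,l_m}f^{j_1,\dots,j_{k-m},l_1,\dots,l_m}_{i_1,\dots,i_{k-m},l_1,\dots,l_m}v_{j_1}\otimes\cdots\otimes v_{j_{k-m}}$ (independent of the basis). Generalized Yang-Baxter operator (gYB-operator) of type $(d,k,m)$: an isomorphism $R:V^{\otimes k}\to V^{\otimes k}$, $\dim V=d$, with $(R\otimes I_m)(I_m\otimes R)(R\otimes I_m)=(I_m\otimes R)(R\otimes I_m)(I_m\otimes R)$ and $(R\otimes I_m^{\otimes(j-2)})(I_m^{\otimes(j-2)}\otimes R)=(I_m^{\otimes(j-2)}\otimes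 R)(R\otimes I_m^{\otimes(j-2)})$ for all $j\ge 4$. It gives a representation $\rho^R_n:B_n\to\mathrm{End}(V^{\otimes k+m(n-2)})$, $\sigma_i\mapsto I_m^{\otimes(i-1)}\otimes R\otimes I_m^{\otimes(n-i-1)}$, with image $\mathrm{im}(\rho^R_n)$. It is known (R. S. Chen) that the displayed $R(\theta)$ is a unitary gYB-operator of type $(2,3,1)$. Perpendicular subspace: for $A\subset\mathrm{End}(W)$, $A^\perp=\{g\in\mathrm{End}(W):\mathrm{tr}(f^*\circ g)=0\text{ for all }f\in A\}$, where $f^*$ is the hermitian conjugate of $f$ (conjugate transpose in the tensor basis induced by the fixed basis of $V$). Enhanced generalized Yang-Baxter operator (EgYB-operator): fix positive integers $m<k$. It is a collection $S=(R,\mu,\alpha,\beta)$ of a gYB-operator $R:V^{\otimes k}\to V^{\otimes k}$ of type $(d,k,m)$, a linear map $\mu:V\to V$, and invertible $\alpha,\beta\in\mathbb{C}$ such that, for all $n\geq 1$: (i) $\mu^{\otimes k}$ commutes with $R$; (ii) $\mu^{\otimes m(n-1)}\otimes(\mathrm{Sp}_{k,m}(R\circ\mu^{\otimes k})-\alpha\beta\mu^{\otimes (k-m)})\in\mathrm{im}(\rho^R_n)^\perp$ and $\mu^{\otimes m(n-1)}\otimes(\mathrm{Sp}_{k,m}(R^{-1}\circ\mu^{\otimes k})-\alpha^{-1}\beta\mu^{\otimes (k-m)})\in\mathrm{im}(\rho^R_n)^\perp$. The invariant $T_S$: let $w:B_n\to\mathbb{Z}$ be the homomorphism with $w(\sigma_i)=1$.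 For $\xi\in B_n$, $T_S(\xi)=\alpha^{-w(\xi)}\beta^{-n}\,\mathrm{tr}\big(\rho^R_n(\xi)\circ\mu^{\otimes k+m(n-2)}\big)$. For an oriented link $L$, $T_S(L)=T_S(\xi)$ where $\xi$ is any braid whose closure is isotopic to $L$ (well defined, by invariance under Markov moves and Markov's theorem). A triple $(L_-,L_0,L_+)$ consists of oriented links with diagrams identical outside a disk, inside which $L_0$ has two parallel (uncrossed) strands and $L_+$, $L_-$ have one positive, respectively one negative, crossing. Equivalently, there is a braid $\xi\in B_n$ such that $L_0,L_+,L_-$ are the closures of $\xi$, $\sigma_1\xi$, $\sigma_1^{-1}\xi$. *)

theory Defs
  imports
    Complex_Main
    "HOL-Algebra.Group"
    "Jordan_Normal_Form.Gauss_Jordan_Elimination"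
    "Jordan_Normal_Form.Schur_Decomposition"
begin

section \<open>Operators on tensor powers\<close>

text \<open>
  A basis of the \<open>d\<close>-dimensional space \<open>V\<close> is fixed.  An endomorphism of the \<open>k\<close>-th tensor
  power of \<open>V\<close> is its \<open>d ^ k\<close> by \<open>d ^ k\<close> matrix in the lexicographically ordered tensor basis;
  column \<open>i\<close> holds the image of basis vector \<open>i\<close>.  In this ordering the tensor product of
  operators is the Kronecker product, and the basis vector with indices \<open>(a, b)\<close>, where \<open>a\<close>
  numbers the first factors and \<open>b\<close> the last \<open>m\<close> factors, has number \<open>a * d ^ m + b\<close>.
\<close>

definition tensor_mat :: "complex mat \<Rightarrow> complex mat \<Rightarrow> complex mat"
    (infixl "\<otimes>\<^sub>m" 75) where
  "A \<otimes>\<^sub>m B =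
     mat (dim_row A * dim_row B) (dim_col A * dim_col B)
       (\<lambda>(i, j). A $$ (i div dim_row B, j div dim_col B)
               * B $$ (i mod dim_row B, j mod dim_col B))"

primrec tensor_pow :: "complex mat \<Rightarrow> nat \<Rightarrow> complex mat" where
  "tensor_pow A 0 = 1\<^sub>m 1"
| "tensor_pow A (Suc n) = A \<otimes>\<^sub>m tensor_pow A n"

definition tensor_id :: "nat \<Rightarrow> nat \<Rightarrow> complex mat" where
  "tensor_id d m = 1\<^sub>m (d ^ m)"

definition mat_trace :: "complex mat \<Rightarrow> complex" where
  "mat_trace A = (\<Sum>i<dim_row A. A $$ (i, i))"

definition Sp :: "nat \<Rightarrow> nat \<Rightarrow> nat \<Rightarrow> complex mat \<Rightarrow> complex mat" where
  "Sp d k m f =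
     mat (d ^ (k - m)) (d ^ (k - m))
       (\<lambda>(j, i). \<Sum>l<d ^ m. f $$ (j * d ^ m + l, i * d ^ m + l))"

definition perp :: "nat \<Rightarrow> complex mat set \<Rightarrow> complex mat set" where
  "perp N A = {g \<in> carrier_mat N N. \<forall>f\<in>A. mat_trace (mat_adjoint f * g) = 0}"

text \<open>The inverse of an invertible matrix.\<close>

definition mat_inv :: "complex mat \<Rightarrow> complex mat" where
  "mat_inv A = the (mat_inverse A)"


section \<open>Braid groups\<close>

text \<open>The letter \<open>(i, True)\<close> stands for \<open>\<sigma>\<^sub>i\<close> and \<open>(i, False)\<close> for its inverse.\<close>

type_synonym braid_word = "(nat \<times> bool) list"

definition braid_words :: "nat \<Rightarrow> braid_word set" where
  "braid_words n = lists ({1..<n} \<times> UNIV)"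

inductive braid_relation :: "braid_word \<Rightarrow> braid_word \<Rightarrow> bool" where
  cancel: "braid_relation [(i, s), (i, \<not> s)] []"
| far: "i + 2 \<le> j \<Longrightarrow> braid_relation [(i, True), (j, True)] [(j, True), (i, True)]"
| braid: "braid_relation [(i, True), (i + 1, True), (i, True)]
                         [(i + 1, True), (i, True), (i + 1, True)]"

definition braid_step :: "nat \<Rightarrow> braid_word \<Rightarrow> braid_word \<Rightarrow> bool" where
  "braid_step n w w' \<longleftrightarrow> w \<in> braid_words n \<and> w' \<in> braid_words n \<and>
     (\<exists>u v x y. braid_relation x y \<and> w = u @ x @ v \<and> w' = u @ y @ v)"

definition braid_equiv :: "nat \<Rightarrow> (braid_word \<times> braid_word) set" where
  "braid_equiv n = {(w, w'). w \<in> braid_words n \<and> w' \<in> braid_words n \<and> equivclp (braid_step n) w w'}"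

definition braid_group :: "nat \<Rightarrow> braid_word set monoid" where
  "braid_group n =
     \<lparr> carrier = braid_words n // braid_equiv n,
       monoid.mult = (\<lambda>X Y. \<Union>x\<in>X. \<Union>y\<in>Y. braid_equiv n `` {x @ y}),
       one = braid_equiv n `` {[]} \<rparr>"

definition braid_gen :: "nat \<Rightarrow> nat \<Rightarrow> braid_word set" where
  "braid_gen n i = braid_equiv n `` {[(i, True)]}"

text \<open>The value of a function of braid words that is constant on an equivalence class.\<close>

definition on_class :: "(braid_word \<Rightarrow> 'a) \<Rightarrow> braid_word set \<Rightarrow> 'a" where
  "on_class f X = (THE y. \<forall>x\<in>X. f x = y)"

definition exponent_sum :: "braid_word set \<Rightarrow> int" where
  "exponent_sum = on_class (\<lambda>w. \<Sum>(i, s)\<leftarrow>w. if s then 1 else - 1)"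


section \<open>Generalized Yang-Baxter operators\<close>

definition gYB_operator :: "nat \<Rightarrow> nat \<Rightarrow> nat \<Rightarrow> complex mat \<Rightarrow> bool" where
  "gYB_operator d k m R \<longleftrightarrow>
     R \<in> carrier_mat (d ^ k) (d ^ k) \<and> invertible_mat R \<and>
     (R \<otimes>\<^sub>m tensor_id d m) * (tensor_id d m \<otimes>\<^sub>m R) * (R \<otimes>\<^sub>m tensor_id d m) =
     (tensor_id d m \<otimes>\<^sub>m R) * (R \<otimes>\<^sub>m tensor_id d m) * (tensor_id d m \<otimes>\<^sub>m R) \<and>
     (\<forall>j\<ge>4.
        (R \<otimes>\<^sub>m tensor_id d (m * (j - 2))) * (tensor_id d (m * (j - 2)) \<otimes>\<^sub>m R) =
        (tensor_id d (m * (j - 2)) \<otimes>\<^sub>m R) * (R \<otimes>\<^sub>m tensor_id d (m * (j - 2))))"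

text \<open>
  The number \<open>k + m (n - 2)\<close> of tensor factors, written so that truncated subtraction does no
  harm for \<open>n = 1\<close> when \<open>m < k\<close>.
\<close>

definition factors :: "nat \<Rightarrow> nat \<Rightarrow> nat \<Rightarrow> nat" where
  "factors k m n = k + m * n - 2 * m"

fun rho_letter :: "nat \<Rightarrow> nat \<Rightarrow> complex mat \<Rightarrow> nat \<Rightarrow> nat \<times> bool \<Rightarrow> complex mat" where
  "rho_letter d m R n (i, s) =
     tensor_id d (m * (i - 1)) \<otimes>\<^sub>m (if s then R else mat_inv R) \<otimes>\<^sub>m tensor_id d (m * (n - i - 1))"

definition rho_word :: "nat \<Rightarrow> nat \<Rightarrow> nat \<Rightarrow> complex mat \<Rightarrow> nat \<Rightarrow> braid_word \<Rightarrow> complex mat" where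
  "rho_word d k m R n w =
     foldr (\<lambda>l M. rho_letter d m R n l * M) w (tensor_id d (factors k m n))"

definition rho :: "nat \<Rightarrow> nat \<Rightarrow> nat \<Rightarrow> complex mat \<Rightarrow> nat \<Rightarrow> braid_word set \<Rightarrow> complex mat" where
  "rho d k m R n = on_class (rho_word d k m R n)"

definition im_rho :: "nat \<Rightarrow> nat \<Rightarrow> nat \<Rightarrow> complex mat \<Rightarrow> nat \<Rightarrow> complex mat set" where
  "im_rho d k m R n = rho d k m R n ` carrier (braid_group n)"

type_synonym enhanced_operator = "complex mat \<times> complex mat \<times> complex \<times> complex"

fun EgYB_operator :: "nat \<Rightarrow> nat \<Rightarrow> nat \<Rightarrow> enhanced_operator \<Rightarrow> bool" where
  "EgYB_operator d k m (R, \<mu>, \<alpha>, \<beta>) \<longleftrightarrow>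
     0 < m \<and> m < k \<and> gYB_operator d k m R \<and> \<mu> \<in> carrier_mat d d \<and> \<alpha> \<noteq> 0 \<and> \<beta> \<noteq> 0 \<and>
     tensor_pow \<mu> k * R = R * tensor_pow \<mu> k \<and>
     (\<forall>n\<ge>1.
        tensor_pow \<mu> (m * (n - 1)) \<otimes>\<^sub>m
          (Sp d k m (R * tensor_pow \<mu> k) - (\<alpha> * \<beta>) \<cdot>\<^sub>m tensor_pow \<mu> (k - m))
        \<in> perp (d ^ factors k m n) (im_rho d k m R n) \<and>
        tensor_pow \<mu> (m * (n - 1)) \<otimes>\<^sub>m
          (Sp d k m (mat_inv R * tensor_pow \<mu> k) - (inverse \<alpha> * \<beta>) \<cdot>\<^sub>m tensor_pow \<mu> (k - m))
        \<in> perp (d ^ factors k m n) (im_rho d k m R n))"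

fun T_braid :: "nat \<Rightarrow> nat \<Rightarrow> nat \<Rightarrow> enhanced_operator \<Rightarrow> nat \<Rightarrow> braid_word set \<Rightarrow> complex" where
  "T_braid d k m (R, \<mu>, \<alpha>, \<beta>) n \<xi> =
     \<alpha> powi (- exponent_sum \<xi>) * \<beta> powi (- int n) *
     mat_trace (rho d k m R n \<xi> * tensor_pow \<mu> (factors k m n))"


section \<open>Oriented links\<close>

text \<open>
  Oriented link diagrams in the plane, cut by horizontal lines into layers that each contain one
  maximum, one minimum or one crossing.  A diagram lists its layers from bottom to top.  The
  layer \<open>(i, x)\<close> has the piece \<open>x\<close> with \<open>i\<close> vertical strands to its left.  Along each
  cutting line a list of orientations is kept, \<open>True\<close> meaning upwards.

  \<open>Cup b\<close> is a minimum whose left end has orientation \<open>b\<close>, \<open>Cap\<close> is a maximum.  \<open>Cross p\<close>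
  is a crossing in which the strand from the lower left to the upper right is the upper one if
  and only if \<open>p\<close> holds; if both strands are directed upwards, \<open>Cross True\<close> is a positive and
  \<open>Cross False\<close> a negative crossing.
\<close>

datatype piece = Cup bool | Cap | Cross bool

type_synonym diagram = "(nat \<times> piece) list"

fun layer :: "nat \<times> piece \<Rightarrow> bool list \<Rightarrow> bool list option" where
  "layer (i, Cup b) s =
     (if i \<le> length s then Some (take i s @ [b, \<not> b] @ drop i s) else None)"
| "layer (i, Cap) s =
     (if i + 1 < length s \<and> s ! i \<noteq> s ! (i + 1) then Some (take i s @ drop (i + 2) s) else None)"
| "layer (i, Cross p) s =
     (if i + 1 < length s then Some (take i s @ [s ! (i + 1), s ! i] @ drop (i + 2) s) else None)"

primrec layers :: "diagram \<Rightarrow> bool list \<Rightarrow> bool list option" where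
  "layers [] s = Some s"
| "layers (l # D) s = Option.bind (layer l s) (layers D)"

definition oriented_link :: "diagram \<Rightarrow> bool" where
  "oriented_link D \<longleftrightarrow> layers D [] = Some []"

fun ins :: "piece \<Rightarrow> nat" where
  "ins (Cup b) = 0" | "ins Cap = 2" | "ins (Cross p) = 2"

fun outs :: "piece \<Rightarrow> nat" where
  "outs (Cup b) = 2" | "outs Cap = 0" | "outs (Cross p) = 2"

text \<open>
  Two diagrams present isotopic links if and only if they are related by the Turaev moves for
  sliced diagrams: planar isotopy (\<open>exchange\<close> of distant pieces, \<open>zigzag\<close>), sliding a strand
  past an extremum (\<open>slide\<close>, which also turns crossings around) and the three Reidemeister moves.
  The versions of the third move with crossings of both kinds follow from \<open>R3\<close> and \<open>R2\<close>.
\<close>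

inductive isotopy_move :: "diagram \<Rightarrow> diagram \<Rightarrow> bool" where
  exchange: "i + outs x \<le> j \<Longrightarrow> isotopy_move [(i, x), (j, y)] [(j + ins x - outs x, y), (i, x)]"
| zigzag_l: "isotopy_move [(i, Cup b), (i + 1, Cap)] []"
| zigzag_r: "isotopy_move [(i + 1, Cup b), (i, Cap)] []"
| slide_cup: "isotopy_move [(i, Cup b), (i + 1, Cross p)] [(i + 1, Cup b), (i, Cross (\<not> p))]"
| slide_cap: "isotopy_move [(i + 1, Cross p), (i, Cap)] [(i, Cross (\<not> p)), (i + 1, Cap)]"
| R1_r: "isotopy_move [(i + 1, Cup b), (i, Cross p), (i + 1, Cap)] []"
| R1_l: "isotopy_move [(i, Cup b), (i + 1, Cross p), (i, Cap)] []"
| R2: "isotopy_move [(i, Cross p), (i, Cross (\<not> p))] []"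
| R3: "isotopy_move [(i, Cross p), (i + 1, Cross p), (i, Cross p)]
                    [(i + 1, Cross p), (i, Cross p), (i + 1, Cross p)]"

definition isotopy_step :: "diagram \<Rightarrow> diagram \<Rightarrow> bool" where
  "isotopy_step D D' \<longleftrightarrow> oriented_link D \<and> oriented_link D' \<and>
     (\<exists>u v x y. isotopy_move x y \<and> D = u @ x @ v \<and> D' = u @ y @ v)"

definition isotopic :: "diagram \<Rightarrow> diagram \<Rightarrow> bool" where
  "isotopic D D' \<longleftrightarrow> oriented_link D \<and> oriented_link D' \<and> equivclp isotopy_step D D'"

text \<open>
  The closure of a braid: the \<open>n\<close> strands are directed upwards, the first letter of the word is
  at the bottom, and the ends are joined by \<open>n\<close> parallel strands on the right.
\<close>

definition word_closure :: "nat \<Rightarrow> braid_word \<Rightarrow> diagram" where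
  "word_closure n w =
     map (\<lambda>i. (i, Cup True)) [0..<n] @
     map (\<lambda>(i, s). (i - 1, Cross s)) w @
     map (\<lambda>i. (i, Cap)) (rev [0..<n])"

definition closure_isotopic :: "nat \<Rightarrow> braid_word set \<Rightarrow> diagram \<Rightarrow> bool" where
  "closure_isotopic n \<xi> L \<longleftrightarrow> (\<exists>w\<in>\<xi>. isotopic (word_closure n w) L)"

definition T_link :: "nat \<Rightarrow> nat \<Rightarrow> nat \<Rightarrow> enhanced_operator \<Rightarrow> diagram \<Rightarrow> complex" where
  "T_link d k m S L =
     (THE t. \<exists>n\<ge>1. \<exists>\<xi>\<in>carrier (braid_group n). closure_isotopic n \<xi> L \<and> t = T_braid d k m S n \<xi>)"

definition skein_triple :: "diagram \<Rightarrow> diagram \<Rightarrow> diagram \<Rightarrow> bool" where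
  "skein_triple Lminus Lzero Lplus \<longleftrightarrow>
     (\<exists>n\<ge>2. \<exists>\<xi>\<in>carrier (braid_group n).
        closure_isotopic n \<xi> Lzero \<and>
        closure_isotopic n (braid_gen n 1 \<otimes>\<^bsub>braid_group n\<^esub> \<xi>) Lplus \<and>
        closure_isotopic n (inv\<^bsub>braid_group n\<^esub> (braid_gen n 1) \<otimes>\<^bsub>braid_group n\<^esub> \<xi>) Lminus)"

text \<open>The trivial link with \<open>n\<close> components: \<open>n\<close> unnested circles without crossings.\<close>

definition trivial_link :: "nat \<Rightarrow> diagram" where
  "trivial_link n = concat (replicate n [(0, Cup True), (0, Cap)])"


section \<open>The operator of type III\<close>

definition R_III :: "real \<Rightarrow> complex mat" where
  "R_III \<theta> = (let e = (\<lambda>t. exp (\<i> * complex_of_real t)) in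
     complex_of_real (1 / sqrt 2) \<cdot>\<^sub>m diag_block_mat
       [mat_of_rows_list 4
          [[1, 0, 1, 0],
           [0, 1, 0, e \<theta>],
           [- 1, 0, 1, 0],
           [0, - e (- \<theta>), 0, 1]],
        mat_of_rows_list 4
          [[1, 0, - e \<theta>, 0],
           [0, 1, 0, - e (2 * \<theta>)],
           [e (- \<theta>), 0, 1, 0],
           [0, e (- 2 * \<theta>), 0, 1]]])"

end

theory Submission
  imports Defs
begin

text \<open>
  The operator is \<open>R = (1 + Y) / sqrt 2\<close>, where \<open>Y\<close> flips the middle one of three bits up to a
  phase and \<open>Y\<^sup>2 = - 1\<close>.  The copies of \<open>Y\<close> at neighbouring positions anticommute and those further
  apart commute, which together with \<open>Y\<^sup>2 = - 1\<close> gives the braid relations (\<open>flip_mat_anticommute\<close>,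
  \<open>flip_mat_far\<close>, \<open>anticommuting_units_braid\<close>).  The braid group on \<open>n\<close> strands acts on \<open>n + 1\<close> bits
  without ever flipping the last one, while the partial traces of \<open>R\<close> and its inverse differ from
  \<open>sqrt 2\<close> by operators that always flip the last bit.  The products required by the
  enhancement therefore have zero diagonal (\<open>EgYB_eighth_turn_flip_mat\<close>).

  The main point is that isotopic closures have equal values.  To see this, the value of a braid is
  identified with the value at its closure of a function that is defined on all link diagrams,
  namely twice the Jones polynomial at a primitive fourth root of unity, normalized to be \<open>1\<close> at
  the empty link and with the sign for which every circle contributes \<open>sqrt 2\<close>.  That function is the Kauffman bracket, computed slice by slice as a vertex model and
  corrected by the writhe; it is invariant because each move is (\<open>isotopy_move_invariant\<close>,
  \<open>jones_value_isotopic\<close>).  The parameter \<open>A\<close> of the bracket is chosen with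
  \<open>A ^ 2 + A ^ (-2) = - sqrt 2\<close>, which turns the skein relation of the bracket into
  \<open>\<sigma> + inverse \<sigma> = sqrt 2\<close>, the relation satisfied by \<open>R\<close>.

  The identification is the uniqueness of the Markov trace on Hecke algebras.  Both the normalized
  trace of the representation and the value of the closure satisfy the skein relation and the
  braid relations, do not change under stabilization and are multiplied by \<open>sqrt 2\<close> when a strand is added
  (\<open>skein_trace_normalized_trace\<close>, \<open>skein_trace_jones_value\<close>).  Such a family is determined by its
  value at the trivial braid on one strand (\<open>skein_trace_unique\<close>), because every word in the
  generators reduces to words that contain the last generator at most once
  (\<open>hecke_functional_zero\<close>).

  The skein relation and the values at trivial links can then be read off from braids, once the
  nested circles that close a trivial braid are pulled apart (\<open>isotopic_trivial_link\<close>).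
\<close>

section \<open>Functionals on Hecke algebras\<close>

text \<open>
  These are the linear functionals on the Hecke algebra with generators \<open>T\<^sub>1, \<dots>, T\<^sub>m\<close> and
  quadratic relation \<open>T\<^sub>i\<^sup>2 = z T\<^sub>i + y\<close>, given by their values on words: the letter \<open>i\<close> stands
  for \<open>T\<^sub>i\<close>.
\<close>

definition hecke_functional :: "'a::comm_ring_1 \<Rightarrow> 'a \<Rightarrow> nat \<Rightarrow> (nat list \<Rightarrow> 'a) \<Rightarrow> bool" where
  "hecke_functional y z m K \<longleftrightarrow>
     (\<forall>u\<in>lists {1..m}. \<forall>v\<in>lists {1..m}. \<forall>i\<in>{1..m}.
        K (u @ [i, i] @ v) = z * K (u @ [i] @ v) + y * K (u @ v) \<and>
        (\<forall>j\<in>{1..m}. i + 2 \<le> j \<longrightarrow> K (u @ [i, j] @ v) = K (u @ [j, i] @ v)) \<and>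
        (i + 1 \<le> m \<longrightarrow> K (u @ [i, i + 1, i] @ v) = K (u @ [i + 1, i, i + 1] @ v)))"

lemma hecke_functionalD:
  assumes "hecke_functional y z m K" "u \<in> lists {1..m}" "v \<in> lists {1..m}" "i \<in> {1..m}"
  shows "K (u @ [i, i] @ v) = z * K (u @ [i] @ v) + y * K (u @ v)"
    and "\<lbrakk>j \<in> {1..m}; i + 2 \<le> j\<rbrakk> \<Longrightarrow> K (u @ [i, j] @ v) = K (u @ [j, i] @ v)"
    and "i + 1 \<le> m \<Longrightarrow> K (u @ [i, i + 1, i] @ v) = K (u @ [i + 1, i, i + 1] @ v)"
  using assms unfolding hecke_functional_def by blast+

lemma hecke_functionalI:
  assumes "\<And>u v i. \<lbrakk>u \<in> lists {1..m}; v \<in> lists {1..m}; i \<in> {1..m}\<rbrakk>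
             \<Longrightarrow> K (u @ [i, i] @ v) = z * K (u @ [i] @ v) + y * K (u @ v)"
    and "\<And>u v i j. \<lbrakk>u \<in> lists {1..m}; v \<in> lists {1..m}; i \<in> {1..m}; j \<in> {1..m}; i + 2 \<le> j\<rbrakk>
             \<Longrightarrow> K (u @ [i, j] @ v) = K (u @ [j, i] @ v)"
    and "\<And>u v i. \<lbrakk>u \<in> lists {1..m}; v \<in> lists {1..m}; i \<in> {1..m}; i + 1 \<le> m\<rbrakk>
             \<Longrightarrow> K (u @ [i, i + 1, i] @ v) = K (u @ [i + 1, i, i + 1] @ v)"
  shows "hecke_functional y z m K"
  using assms unfolding hecke_functional_def by blast

lemma lists_atLeastAtMost_mono: "\<lbrakk>w \<in> lists {1..m}; m \<le> m'\<rbrakk> \<Longrightarrow> w \<in> lists {1..m'}" for m m' :: nat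
  by (erule rev_subsetD[OF _ lists_mono]) auto

text \<open>
  This makes the reduction of words below applicable to subwords.
\<close>

lemma hecke_functional_context:
  assumes "hecke_functional y z m K" "m' \<le> m" "a \<in> lists {1..m}" "d \<in> lists {1..m}"
  shows "hecke_functional y z m' (\<lambda>w. K (a @ w @ d))"
proof -
  have inner: "a @ u \<in> lists {1..m}" "u @ d \<in> lists {1..m}" if "u \<in> lists {1..m'}" for u
    using lists_atLeastAtMost_mono[OF that \<open>m' \<le> m\<close>] assms(3,4) by simp_all
  have index: "i \<in> {1..m}" if "i \<in> {1..m'}" for i
    using that \<open>m' \<le> m\<close> by simp
  show ?thesis
  proof (rule hecke_functionalI)
    fix u v i assume uvi: "u \<in> lists {1..m'}" "v \<in> lists {1..m'}" "i \<in> {1..m'}"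
    note D = hecke_functionalD[OF assms(1) inner(1)[OF uvi(1)] inner(2)[OF uvi(2)] index[OF uvi(3)]]
    show "K (a @ (u @ [i, i] @ v) @ d) = z * K (a @ (u @ [i] @ v) @ d) + y * K (a @ (u @ v) @ d)"
      using D(1) by simp
    show "K (a @ (u @ [i, i + 1, i] @ v) @ d) = K (a @ (u @ [i + 1, i, i + 1] @ v) @ d)"
      if "i + 1 \<le> m'"
      using D(3) that \<open>m' \<le> m\<close> by simp
    show "K (a @ (u @ [i, j] @ v) @ d) = K (a @ (u @ [j, i] @ v) @ d)"
      if "j \<in> {1..m'}" "i + 2 \<le> j" for j
      using D(2)[of j] index that by simp
  qed
qed

lemma lists_count_zero:
  assumes "w \<in> lists {1..Suc m}" "count_list w (Suc m) = 0"
  shows "w \<in> lists {1..m}"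
proof (intro in_listsI ballI)
  fix x assume "x \<in> set w"
  hence "x \<in> {1..Suc m}" "x \<noteq> Suc m"
    using assms by (auto simp: count_list_0_iff)
  thus "x \<in> {1..m}" by auto
qed

text \<open>
  All letters of \<open>b\<close> are at distance at least \<open>2\<close> from \<open>m\<close>, which passes them one by one.
\<close>

lemma hecke_functional_commute:
  assumes K: "hecke_functional y z m K" and "1 \<le> m"
    and b: "b \<in> lists {1..m - 2}" and u: "u \<in> lists {1..m}" and v: "v \<in> lists {1..m}"
  shows "K (u @ [m] @ b @ v) = K (u @ b @ [m] @ v)"
  using b u
proof (induction b arbitrary: u rule: list.induct)
  case (Cons i b)
  have m: "m \<in> {1..m}" using \<open>1 \<le> m\<close> by simp
  have "b \<in> lists {1..m - 2}" using Cons.prems by simp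
  hence b: "b \<in> lists {1..m}" by (rule lists_atLeastAtMost_mono) simp
  have "i \<in> {1..m - 2}" using Cons.prems by simp
  hence i: "i \<in> {1..m}" "i + 2 \<le> m" by auto
  have "K (u @ [i, m] @ (b @ v)) = K (u @ [m, i] @ (b @ v))"
    using hecke_functionalD(2)[OF K _ _ i(1) m i(2), of u "b @ v"] b v Cons.prems by simp
  moreover have "K ((u @ [i]) @ [m] @ b @ v) = K ((u @ [i]) @ b @ [m] @ v)"
    using Cons.IH[of "u @ [i]"] Cons.prems i by simp
  ultimately show ?case by simp
qed simp

lemma count_list_split:
  assumes "0 < count_list w x"
  obtains a b where "w = a @ [x] @ b" "count_list a x = 0"
proof -
  have "x \<in> set w" using assms by (metis count_notin less_irrefl)
  then obtain a b where "w = a @ x # b" "x \<notin> set a" by (meson split_list_first)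
  thus ?thesis using that[of a b] by (simp add: count_list_0_iff)
qed

text \<open>
  Words with at most one letter \<open>m\<close> span the Hecke algebra.  Between two consecutive letters \<open>m\<close>
  stands a word \<open>b\<close> in smaller letters, and by induction on \<open>m\<close>, applied to the functional in the
  variable \<open>b\<close>, this word may be assumed to contain \<open>m - 1\<close> at most once.  If it does not occur, the
  two letters \<open>m\<close> become adjacent and the quadratic relation removes at least one of them; if it occurs
  once, they become adjacent to it on both sides and the braid relation removes one of them.
\<close>

lemma hecke_functional_zero:
  assumes "hecke_functional y z m K"
    and "\<And>w. \<lbrakk>w \<in> lists {1..m}; count_list w m \<le> 1\<rbrakk> \<Longrightarrow> K w = 0"
    and "w \<in> lists {1..m}"
  shows "K w = 0"
  using assms
proof (induction m arbitrary: K w)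
  case 0
  thus ?case by (simp add: count_notin)
next
  case (Suc m)
  let ?M = "Suc m"
  note K = Suc.prems(1)
  have M: "?M \<in> {1..?M}" by simp
  show ?case
    using Suc.prems(3)
  proof (induction "count_list w ?M" arbitrary: w rule: less_induct)
    case (less w)
    show ?case
    proof (cases "count_list w ?M \<le> 1")
      case True thus ?thesis using Suc.prems(2) less.prems by blast
    next
      case False
      then obtain a w' where w: "w = a @ [?M] @ w'" "count_list a ?M = 0"
        using count_list_split[of w ?M] by auto
      hence "0 < count_list w' ?M" using False by auto
      then obtain b d where w': "w' = b @ [?M] @ d" "count_list b ?M = 0"
        using count_list_split[of w' ?M] by blast
      have a: "a \<in> lists {1..?M}" and bM: "b \<in> lists {1..?M}" and d: "d \<in> lists {1..?M}"
        using less.prems w w' by auto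
      have b: "b \<in> lists {1..m}" using lists_count_zero[OF bM w'(2)] .
      have cnt: "count_list w ?M = 2 + count_list d ?M" using w w' by simp
      let ?K = "\<lambda>x. K ((a @ [?M]) @ x @ ([?M] @ d))"
      have K': "hecke_functional y z m ?K"
        by (rule hecke_functional_context[OF K]) (use a d in auto)
      \<comment> \<open>the functional in the word between the two letters; induction on \<open>m\<close> leaves these cases\<close>
      have "?K x = 0" if x: "x \<in> lists {1..m}" "count_list x m \<le> 1" for x
      proof (cases "count_list x m = 0")
        case True
        have x': "x \<in> lists {1..?M - 2}"
        proof (cases m)
          case 0 thus ?thesis using x by simp
        next
          case (Suc k) thus ?thesis using lists_count_zero[of x k] x True by simp
        qed
        have xM: "x \<in> lists {1..?M}" using x(1) by (auto simp: in_lists_conv_set)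
        have x0: "count_list x ?M = 0" using x(1) by (auto simp: count_list_0_iff in_lists_conv_set)
        have "?K x = K (a @ x @ [?M] @ ([?M] @ d))"
          using hecke_functional_commute[OF K _ x' a, of "[?M] @ d"] d M by simp
        also have "\<dots> = z * K ((a @ x) @ [?M] @ d) + y * K ((a @ x) @ d)"
          using hecke_functionalD(1)[OF K _ d M, of "a @ x"] a xM by simp
        also have "K ((a @ x) @ [?M] @ d) = 0"
          by (rule less.hyps) (use a xM d cnt w(2) x0 in auto)
        also have "K ((a @ x) @ d) = 0"
          by (rule less.hyps) (use a xM d cnt w(2) x0 in auto)
        finally show ?thesis by simp
      next
        case False
        then obtain b1 b2 where x12: "x = b1 @ [m] @ b2" "count_list b1 m = 0"
          using count_list_split[of x m] by blast
        hence c2: "count_list b2 m = 0" using x(2) by simp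
        have m1: "1 \<le> m" using x x12 by auto
        then obtain k where k: "m = Suc k" by (cases m) auto
        have b12: "b1 \<in> lists {1..?M - 2}" "b2 \<in> lists {1..?M - 2}"
          using lists_count_zero[of b1 k] lists_count_zero[of b2 k] x x12 c2 k by auto
        hence bM: "b1 \<in> lists {1..?M}" "b2 \<in> lists {1..?M}"
          by (simp_all only: lists_atLeastAtMost_mono[of _ "?M - 2" ?M] diff_le_self)
        have b0: "count_list b1 ?M = 0" "count_list b2 ?M = 0"
          using b12 by (auto simp: count_list_0_iff in_lists_conv_set)
        have mM: "m \<in> {1..?M}" using m1 by simp
        have "?K x = K (a @ [?M] @ b1 @ ([m] @ b2 @ [?M] @ d))" using x12 by simp
        also have "\<dots> = K (a @ b1 @ [?M] @ ([m] @ b2 @ [?M] @ d))"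
          by (rule hecke_functional_commute[OF K _ b12(1) a]) (use mM bM d in auto)
        also have "\<dots> = K ((a @ b1 @ [?M, m]) @ b2 @ [?M] @ d)" by simp
        also have "\<dots> = K ((a @ b1 @ [?M, m]) @ [?M] @ b2 @ d)"
          by (rule hecke_functional_commute[OF K _ b12(2), symmetric]) (use mM bM a d in auto)
        also have "\<dots> = K ((a @ b1) @ [m + 1, m, m + 1] @ (b2 @ d))" by simp
        also have "\<dots> = K ((a @ b1) @ [m, m + 1, m] @ (b2 @ d))"
          using hecke_functionalD(3)[OF K _ _ mM, of "a @ b1" "b2 @ d"] a bM d by simp
        also have "\<dots> = 0"
          by (rule less.hyps) (use a bM d cnt w(2) b0 mM in auto)
        finally show ?thesis .
      qed
      hence "?K b = 0" using Suc.IH[OF K' _ b] by blast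
      thus ?thesis using w w' by simp
    qed
  qed
qed

text \<open>
  By the preceding lemma only words with at most one letter \<open>n\<close> matter for \<open>H (Suc n)\<close>, and on
  these the two rules express it by \<open>H n\<close>.
\<close>

lemma markov_trace_zero:
  fixes H :: "nat \<Rightarrow> nat list \<Rightarrow> 'a::comm_ring_1"
  assumes hecke: "\<And>n. 1 \<le> n \<Longrightarrow> hecke_functional y z (n - 1) (H n)"
    and add: "\<And>n u. \<lbrakk>1 \<le> n; u \<in> lists {1..<n}\<rbrakk> \<Longrightarrow> H (Suc n) u = q * H n u"
    and stab: "\<And>n u v. \<lbrakk>1 \<le> n; u \<in> lists {1..<n}; v \<in> lists {1..<n}\<rbrakk>
                 \<Longrightarrow> H (Suc n) (u @ [n] @ v) = p * H n (u @ v)"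
    and init: "H 1 [] = 0"
    and "1 \<le> n" "w \<in> lists {1..<n}"
  shows "H n w = 0"
  using \<open>1 \<le> n\<close> \<open>w \<in> lists {1..<n}\<close>
proof (induction n arbitrary: w rule: dec_induct)
  case base
  thus ?case using init by simp
next
  case (step n)
  have iv: "{1..<k} = {1..k - 1}" for k :: nat by auto
  have lst: "{1..<Suc n} = {1..n}" by auto
  have K: "hecke_functional y z n (H (Suc n))" using hecke[of "Suc n"] by simp
  show ?case
  proof (rule hecke_functional_zero[OF K])
    show "w \<in> lists {1..n}" using step.prems unfolding lst .
    fix x assume x: "x \<in> lists {1..n}" "count_list x n \<le> 1"
    obtain k where k: "n = Suc k" using \<open>1 \<le> n\<close> by (cases n) auto
    show "H (Suc n) x = 0"
    proof (cases "count_list x n = 0")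
      case True
      hence "x \<in> lists {1..<n}" using lists_count_zero[of x k] x unfolding iv k by simp
      thus ?thesis using add[OF \<open>1 \<le> n\<close>] step.IH by simp
    next
      case False
      then obtain u v where uv: "x = u @ [n] @ v" "count_list u n = 0"
        using count_list_split[of x n] by blast
      hence "count_list v n = 0" using x by simp
      hence uv': "u \<in> lists {1..<n}" "v \<in> lists {1..<n}"
        using lists_count_zero[of u k] lists_count_zero[of v k] x uv unfolding iv k by auto
      thus ?thesis using stab[OF \<open>1 \<le> n\<close>, of u v] step.IH[of "u @ v"] uv(1) by simp
    qed
  qed
qed

section \<open>Uniqueness of skein traces of braids\<close>

text \<open>
  The properties of a Markov trace on the tower of Hecke algebras that determine it.  The
  parameter \<open>z\<close> belongs to the skein relation, \<open>p\<close> to stabilization and \<open>q\<close> to an additional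
  strand.
\<close>

definition skein_trace :: "complex \<Rightarrow> complex \<Rightarrow> complex \<Rightarrow> (nat \<Rightarrow> braid_word \<Rightarrow> complex) \<Rightarrow> bool" where
  "skein_trace z p q F \<longleftrightarrow> (\<forall>n\<ge>1.
     (\<forall>u\<in>braid_words n. \<forall>v\<in>braid_words n.
        (\<forall>i\<in>{1..<n}. F n (u @ [(i, True)] @ v) + F n (u @ [(i, False)] @ v) = z * F n (u @ v)) \<and>
        (\<forall>x\<in>braid_words n. \<forall>y\<in>braid_words n. braid_relation x y \<longrightarrow> F n (u @ x @ v) = F n (u @ y @ v)) \<and>
        F (Suc n) (u @ [(n, True)] @ v) = p * F n (u @ v)) \<and>
     (\<forall>u\<in>braid_words n. F (Suc n) u = q * F n u))"

lemma skein_traceD: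
  assumes "skein_trace z p q F" "1 \<le> n" "u \<in> braid_words n" "v \<in> braid_words n"
  shows "i \<in> {1..<n} \<Longrightarrow> F n (u @ [(i, True)] @ v) + F n (u @ [(i, False)] @ v) = z * F n (u @ v)"
    and "\<lbrakk>braid_relation x y; x \<in> braid_words n; y \<in> braid_words n\<rbrakk> \<Longrightarrow> F n (u @ x @ v) = F n (u @ y @ v)"
    and "F (Suc n) (u @ [(n, True)] @ v) = p * F n (u @ v)"
    and "F (Suc n) u = q * F n u"
  using assms unfolding skein_trace_def by blast+

lemma skein_traceI:
  assumes "\<And>n u v i. \<lbrakk>1 \<le> n; u \<in> braid_words n; v \<in> braid_words n; i \<in> {1..<n}\<rbrakk>
      \<Longrightarrow> F n (u @ [(i, True)] @ v) + F n (u @ [(i, False)] @ v) = z * F n (u @ v)"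
    and "\<And>n u v x y. \<lbrakk>1 \<le> n; u \<in> braid_words n; v \<in> braid_words n; x \<in> braid_words n; y \<in> braid_words n;
      braid_relation x y\<rbrakk> \<Longrightarrow> F n (u @ x @ v) = F n (u @ y @ v)"
    and "\<And>n u v. \<lbrakk>1 \<le> n; u \<in> braid_words n; v \<in> braid_words n\<rbrakk>
      \<Longrightarrow> F (Suc n) (u @ [(n, True)] @ v) = p * F n (u @ v)"
    and "\<And>n u. \<lbrakk>1 \<le> n; u \<in> braid_words n\<rbrakk> \<Longrightarrow> F (Suc n) u = q * F n u"
  shows "skein_trace z p q F"
  using assms unfolding skein_trace_def by blast

lemma skein_trace_diff:
  assumes F: "skein_trace z p q F" and G: "skein_trace z p q G"
  shows "skein_trace z p q (\<lambda>n w. F n w - G n w)"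
proof (rule skein_traceI)
  fix n u v i assume *: "1 \<le> n" "u \<in> braid_words n" "v \<in> braid_words n"
  note 1 = skein_traceD[OF F *] and 2 = skein_traceD[OF G *]
  show "F n (u @ [(i, True)] @ v) - G n (u @ [(i, True)] @ v) +
       (F n (u @ [(i, False)] @ v) - G n (u @ [(i, False)] @ v)) = z * (F n (u @ v) - G n (u @ v))"
    if "i \<in> {1..<n}"
    using 1(1)[OF that] 2(1)[OF that] by (simp add: algebra_simps)
  show "F n (u @ x @ v) - G n (u @ x @ v) = F n (u @ y @ v) - G n (u @ y @ v)"
    if "x \<in> braid_words n" "y \<in> braid_words n" "braid_relation x y" for x y
    using 1(2)[OF that(3,1,2)] 2(2)[OF that(3,1,2)] by simp
  show "F (Suc n) (u @ [(n, True)] @ v) - G (Suc n) (u @ [(n, True)] @ v) = p * (F n (u @ v) - G n (u @ v))"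
    unfolding 1(3) 2(3) by (simp add: algebra_simps)
next
  fix n u assume *: "1 \<le> n" "u \<in> braid_words n"
  show "F (Suc n) u - G (Suc n) u = q * (F n u - G n u)"
    unfolding skein_traceD(4)[OF F * *(2)] skein_traceD(4)[OF G * *(2)] by (simp add: algebra_simps)
qed

abbreviation positive :: "nat list \<Rightarrow> braid_word" where
  "positive \<equiv> map (\<lambda>i. (i, True))"

lemma positive_in_braid_words: "u \<in> lists {1..<n} \<Longrightarrow> positive u \<in> braid_words n"
  by (simp add: braid_words_def in_lists_conv_set image_subset_iff)

text \<open>
  The quadratic relation is the skein relation at a letter that is followed by itself, since the
  negative letter cancels.
\<close>

lemma hecke_functional_skein_trace:
  assumes F: "skein_trace z p q F" and n: "1 \<le> n"
  shows "hecke_functional (- 1) z (n - 1) (\<lambda>u. F n (positive u))"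
proof (rule hecke_functionalI)
  have eq: "{1..n - 1} = {1..<n}" using n by auto
  fix u v i assume "u \<in> lists {1..n - 1}" "v \<in> lists {1..n - 1}" and i: "i \<in> {1..n - 1}"
  hence u: "positive u \<in> braid_words n" and v: "positive v \<in> braid_words n" and i': "i \<in> {1..<n}"
    unfolding eq by (simp_all add: positive_in_braid_words)
  note D = skein_traceD[OF F n u v]
  have iv: "(i, True) # positive v \<in> braid_words n" "[(i, False), (i, \<not> False)] \<in> braid_words n" "[] \<in> braid_words n"
    using v i' by (simp_all add: braid_words_def)
  show "F n (positive (u @ [i, i] @ v)) = z * F n (positive (u @ [i] @ v)) + - 1 * F n (positive (u @ v))"
    using skein_traceD(1)[OF F n u iv(1) i'] D(2)[OF braid_relation.cancel[of i False] iv(2,3)]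
    by (simp add: algebra_simps)
  show "F n (positive (u @ [i, j] @ v)) = F n (positive (u @ [j, i] @ v))"
    if "j \<in> {1..n - 1}" "i + 2 \<le> j" for j
    using D(2)[OF braid_relation.far[OF that(2)]] i' that(1) unfolding eq by (simp add: braid_words_def)
  show "F n (positive (u @ [i, i + 1, i] @ v)) = F n (positive (u @ [i + 1, i, i + 1] @ v))"
    if "i + 1 \<le> n - 1"
    using D(2)[OF braid_relation.braid[of i]] i' that by (simp add: braid_words_def)
qed

text \<open>
  The difference of the two families vanishes on positive words by \<open>markov_trace_zero\<close>, and the
  skein relation replaces negative letters by positive ones, starting from the left.
\<close>

lemma skein_trace_unique:
  assumes F: "skein_trace z p q F" and G: "skein_trace z p q G" and init: "F 1 [] = G 1 []"
    and n: "1 \<le> n" and w: "w \<in> braid_words n"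
  shows "F n w = G n w"
proof -
  define H where "H n w = F n w - G n w" for n w
  have H: "skein_trace z p q H" unfolding H_def by (rule skein_trace_diff[OF F G])
  have pos: "H n (positive u) = 0" if "u \<in> lists {1..<n}" for u
  proof (rule markov_trace_zero[where H = "\<lambda>n u. H n (positive u)" and y = "- 1" and z = z and p = p and q = q])
    fix n :: nat and u v assume "1 \<le> n" and u: "u \<in> lists {1..<n}" and v: "v \<in> lists {1..<n}"
    note D = skein_traceD[OF H \<open>1 \<le> n\<close> positive_in_braid_words[OF u] positive_in_braid_words[OF v]]
    show "H (Suc n) (positive (u @ [n] @ v)) = p * H n (positive (u @ v))" using D(3) by simp
  next
    fix n :: nat and u assume "1 \<le> n" and u: "u \<in> lists {1..<n}"
    show "H (Suc n) (positive u) = q * H n (positive u)"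
      by (rule skein_traceD(4)[OF H \<open>1 \<le> n\<close> positive_in_braid_words[OF u] positive_in_braid_words[OF u]])
  next
    show "1 \<le> m \<Longrightarrow> hecke_functional (- 1) z (m - 1) (\<lambda>u. H m (positive u))" for m
      by (rule hecke_functional_skein_trace[OF H])
  qed (use that n init in \<open>simp_all add: H_def\<close>)
  have "H n (positive u @ w) = 0" if "u \<in> lists {1..<n}" for u
    using w that
  proof (induction w arbitrary: u rule: list.induct)
    case Nil
    thus ?case using pos by simp
  next
    case (Cons l w)
    obtain i s where l: "l = (i, s)" by (cases l)
    have i: "i \<in> {1..<n}" and w: "w \<in> braid_words n" using Cons.prems(1) l by (auto simp: braid_words_def)
    have T: "H n (positive u @ (i, True) # w) = 0"
      using Cons.IH[OF w, of "u @ [i]"] Cons.prems(2) i by simp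
    moreover have "H n (positive u @ (i, False) # w) = z * H n (positive u @ w) - H n (positive u @ (i, True) # w)"
      using skein_traceD(1)[OF H n positive_in_braid_words[OF Cons.prems(2)] w i] by (simp add: algebra_simps)
    ultimately show ?case using Cons.IH[OF w Cons.prems(2)] l by (cases s) simp_all
  qed
  from this[of "[]"] show ?thesis by (simp add: H_def)
qed

section \<open>The Kauffman bracket of sliced diagrams\<close>

text \<open>
  The vertex model of the Kauffman bracket.  The weights of a minimum and a maximum are inverse to
  each other on opposite labels, so that zigzags straighten, and a circle gets the weight
  \<open>- A ^ 2 - A ^ (-2)\<close>.  They are normalized asymmetrically to keep them free of square roots of \<open>- 1\<close>.
\<close>

definition cup_weight :: "complex \<Rightarrow> bool \<Rightarrow> bool \<Rightarrow> complex" where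
  "cup_weight A a b = (if a = b then 0 else if a then - (A ^ 2) else 1)"

definition cap_weight :: "complex \<Rightarrow> bool \<Rightarrow> bool \<Rightarrow> complex" where
  "cap_weight A a b = (if a = b then 0 else if a then 1 else - (inverse A ^ 2))"

lemmas extremum_weight_defs = cup_weight_def cap_weight_def

text \<open>
  The arguments \<open>s\<close> and \<open>t\<close> are the labels of the ends at the bottom and at the top of the piece.
  A crossing is the combination of its two smoothings, two vertical strands and a maximum below a minimum.
\<close>

fun vertex_weight :: "complex \<Rightarrow> piece \<Rightarrow> bool list \<Rightarrow> bool list \<Rightarrow> complex" where
  "vertex_weight A (Cup b) s t = cup_weight A (t ! 0) (t ! 1)"
| "vertex_weight A Cap s t = cap_weight A (s ! 0) (s ! 1)"
| "vertex_weight A (Cross p) s t =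
     (if p then A else inverse A) * of_bool (s = t) +
     (if p then inverse A else A) * cap_weight A (s ! 0) (s ! 1) * cup_weight A (t ! 0) (t ! 1)"

text \<open>
  If \<open>f\<close> gives the partition function of the part of a diagram above a slice, depending on the
  labels along the upper cutting line, then the result is the partition function of the part that includes the
  slice.  The value \<open>0\<close> for a piece that does not fit makes the exchange of distant pieces hold
  for all lists \<open>s\<close>.
\<close>

fun slice_op :: "complex \<Rightarrow> nat \<times> piece \<Rightarrow> (bool list \<Rightarrow> complex) \<Rightarrow> bool list \<Rightarrow> complex" where
  "slice_op A (i, x) f s =
     (if i + ins x \<le> length s
      then \<Sum>t | length t = outs x.
             vertex_weight A x (take (ins x) (drop i s)) t * f (take i s @ t @ drop (i + ins x) s)
      else 0)"

declare slice_op.simps [simp del]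

definition bracket_op :: "complex \<Rightarrow> diagram \<Rightarrow> (bool list \<Rightarrow> complex) \<Rightarrow> bool list \<Rightarrow> complex" where
  "bracket_op A D = foldr (slice_op A) D"

lemma bracket_op_Nil [simp]: "bracket_op A [] f = f"
  and bracket_op_Cons [simp]: "bracket_op A (l # D) f = slice_op A l (bracket_op A D f)"
  and bracket_op_append [simp]: "bracket_op A (D @ D') f = bracket_op A D (bracket_op A D' f)"
  by (simp_all add: bracket_op_def)

lemma slice_op_append:
  assumes "length p = i" "length q = ins x"
  shows "slice_op A (i, x) f (p @ q @ r) = (\<Sum>t | length t = outs x. vertex_weight A x q t * f (p @ t @ r))"
  using assms by (simp add: slice_op.simps)

lemma slice_op_out_of_range: "length s < i + ins x \<Longrightarrow> slice_op A (i, x) f s = 0"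
  by (simp add: slice_op.simps)

lemma split_at:
  assumes "i + k \<le> length s"
  obtains p q r where "s = p @ q @ r" "length p = i" "length q = k"
proof
  show "s = take i s @ take k (drop i s) @ drop k (drop i s)"
    by (simp only: append_take_drop_id)
qed (use assms in auto)

lemma split_at_1:
  assumes "i < length s"
  obtains p a r where "s = p @ [a] @ r" "length p = i"
  using id_take_nth_drop[OF assms] that[of "take i s" "s ! i" "drop (Suc i) s"] assms by simp

lemma split_at_2:
  assumes "i + 1 < length s"
  obtains p a b r where "s = p @ [a, b] @ r" "length p = i"
proof -
  obtain p a r where s: "s = p @ [a] @ r" "length p = i" using split_at_1[of i s] assms by auto
  then obtain b r' where "r = b # r'" using assms by (cases r) auto
  with s that show ?thesis by simp
qed

lemma split_at_3:
  assumes "i + 2 < length s"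
  obtains p a b c r where "s = p @ [a, b, c] @ r" "length p = i"
proof -
  obtain p a b r where s: "s = p @ [a, b] @ r" "length p = i" by (rule split_at_2[of i s]) (use assms in auto)
  then obtain c r' where "r = c # r'" using assms by (cases r) auto
  with s that show ?thesis by simp
qed

lemma sum_bool_pairs:
  "(\<Sum>t::bool list | length t = 2. g t) = g [False, False] + g [False, True] + g [True, False] + g [True, True]"
proof -
  have "{t::bool list. length t = 2} = {[False, False], [False, True], [True, False], [True, True]}"
    by (auto simp: numeral_2_eq_2 length_Suc_conv)
  thus ?thesis by (simp add: add.assoc)
qed

lemma slice_op_Cup:
  "length p = i \<Longrightarrow> slice_op A (i, Cup b) f (p @ r) =
     f (p @ False # True # r) - A ^ 2 * f (p @ True # False # r)"
  using slice_op_append[of p i "[]" "Cup b" A f r]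
  by (simp add: sum_bool_pairs extremum_weight_defs)

lemma slice_op_Cap:
  "length p = i \<Longrightarrow> slice_op A (i, Cap) f (p @ a # b # r) = cap_weight A a b * f (p @ r)"
  using slice_op_append[of p i "[a, b]" Cap A f r] by simp

text \<open>
  The terms of the two smoothings combine into one entry or cancel, because
  \<open>A * inverse A = 1\<close>.
\<close>

lemma slice_op_Cross:
  assumes "A \<noteq> 0" "length p = i"
  shows "slice_op A (i, Cross q) f (p @ a # a # r) = (if q then A else inverse A) * f (p @ a # a # r)"
    and "slice_op A (i, Cross True) f (p @ True # False # r) = inverse A * f (p @ False # True # r)"
    and "slice_op A (i, Cross True) f (p @ False # True # r) =
           (A - inverse A ^ 3) * f (p @ False # True # r) + inverse A * f (p @ True # False # r)"
    and "slice_op A (i, Cross False) f (p @ True # False # r) =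
           (inverse A - A ^ 3) * f (p @ True # False # r) + A * f (p @ False # True # r)"
    and "slice_op A (i, Cross False) f (p @ False # True # r) = A * f (p @ True # False # r)"
proof -
  note * = slice_op_append[OF assms(2), of _ "Cross _" A f r] sum_bool_pairs
  show "slice_op A (i, Cross q) f (p @ a # a # r) = (if q then A else inverse A) * f (p @ a # a # r)"
    using *(1)[of "[a, a]" q] by (cases a) (simp_all add: *(2) extremum_weight_defs)
  show "slice_op A (i, Cross True) f (p @ True # False # r) = inverse A * f (p @ False # True # r)"
    using *(1)[of "[True, False]" True] assms(1)
    by (simp add: *(2) extremum_weight_defs field_simps power2_eq_square)
  show "slice_op A (i, Cross True) f (p @ False # True # r) =
      (A - inverse A ^ 3) * f (p @ False # True # r) + inverse A * f (p @ True # False # r)"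
    using *(1)[of "[False, True]" True] assms(1)
    by (simp add: *(2) extremum_weight_defs field_simps power3_eq_cube power2_eq_square)
  show "slice_op A (i, Cross False) f (p @ True # False # r) =
      (inverse A - A ^ 3) * f (p @ True # False # r) + A * f (p @ False # True # r)"
    using *(1)[of "[True, False]" False] assms(1)
    by (simp add: *(2) extremum_weight_defs field_simps power3_eq_cube power2_eq_square)
  show "slice_op A (i, Cross False) f (p @ False # True # r) = A * f (p @ True # False # r)"
    using *(1)[of "[False, True]" False] assms(1)
    by (simp add: *(2) extremum_weight_defs field_simps power2_eq_square)
qed

lemma slice_op_Suc:
  assumes "length p = i"
  shows "slice_op A (Suc i, Cup b') f (p @ c # r) =
           f (p @ c # False # True # r) - A ^ 2 * f (p @ c # True # False # r)"
    and "slice_op A (Suc i, Cap) f (p @ c # a # b # r) = cap_weight A a b * f (p @ c # r)"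
  using slice_op_Cup[of "p @ [c]" "Suc i"] slice_op_Cap[of "p @ [c]" "Suc i"] assms
  by simp_all

lemma slice_op_Suc_Cross:
  assumes "A \<noteq> 0" "length p = i"
  shows "slice_op A (Suc i, Cross q) f (p @ c # a # a # r) = (if q then A else inverse A) * f (p @ c # a # a # r)"
    and "slice_op A (Suc i, Cross True) f (p @ c # True # False # r) = inverse A * f (p @ c # False # True # r)"
    and "slice_op A (Suc i, Cross True) f (p @ c # False # True # r) =
           (A - inverse A ^ 3) * f (p @ c # False # True # r) + inverse A * f (p @ c # True # False # r)"
    and "slice_op A (Suc i, Cross False) f (p @ c # True # False # r) =
           (inverse A - A ^ 3) * f (p @ c # True # False # r) + A * f (p @ c # False # True # r)"
    and "slice_op A (Suc i, Cross False) f (p @ c # False # True # r) = A * f (p @ c # True # False # r)"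
  using slice_op_Cross[of A "p @ [c]" "Suc i"] assms
  by simp_all

lemmas slice_op_uncond_eqs = slice_op_Cup slice_op_Cap slice_op_Suc
lemmas slice_op_cond_eqs = slice_op_Cross slice_op_Suc_Cross

text \<open>
  The two pieces read and change disjoint parts of the list of labels, so only the order of two
  sums changes.
\<close>

lemma slice_op_exchange:
  assumes "i + outs x \<le> j"
  shows "slice_op A (i, x) (slice_op A (j, y) f) s = slice_op A (j + ins x - outs x, y) (slice_op A (i, x) f) s"
    (is "?L = ?R")
proof (cases "j + ins x - outs x + ins y \<le> length s")
  case True
  define k where "k = j - (i + outs x)"
  have j: "j = i + outs x + k" using assms by (simp add: k_def)
  have "i + (ins x + k + ins y) \<le> length s" using True j by simp
  then obtain p q' r where s: "s = p @ q' @ r" "length p = i" "length q' = ins x + k + ins y"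
    by (rule split_at)
  obtain q m q2 where q': "q' = q @ m @ q2" "length q = ins x" "length m = k"
    using split_at[of "ins x" k q'] s(3) by auto
  hence l2: "length q2 = ins y" using s(3) by simp
  have "?L = (\<Sum>t | length t = outs x. vertex_weight A x q t * slice_op A (j, y) f ((p @ t @ m) @ q2 @ r))"
    using slice_op_append[of p i q x A "slice_op A (j, y) f" "m @ q2 @ r"] s q' by simp
  also have "\<dots> = (\<Sum>t | length t = outs x. \<Sum>t' | length t' = outs y.
      vertex_weight A x q t * (vertex_weight A y q2 t' * f ((p @ t @ m) @ t' @ r)))"
    by (intro sum.cong refl, subst slice_op_append) (use s q' l2 j in \<open>auto simp: sum_distrib_left\<close>)
  also have "\<dots> = (\<Sum>t' | length t' = outs y. \<Sum>t | length t = outs x.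
      vertex_weight A y q2 t' * (vertex_weight A x q t * f (p @ t @ (m @ t' @ r))))"
    by (subst sum.swap) (simp add: mult.left_commute)
  also have "\<dots> = (\<Sum>t' | length t' = outs y. vertex_weight A y q2 t' * slice_op A (i, x) f (p @ q @ (m @ t' @ r)))"
    using s q' by (simp add: slice_op_append sum_distrib_left)
  also have "\<dots> = ?R"
    using slice_op_append[of "p @ q @ m" "j + ins x - outs x" q2 y A "slice_op A (i, x) f" r] s q' l2 j by simp
  finally show ?thesis .
next
  case False
  have "?L = 0"
  proof (cases "i + ins x \<le> length s")
    case True
    show ?thesis
      unfolding slice_op.simps[of A i x] using True False assms
      by (auto intro!: sum.neutral simp: slice_op_out_of_range)
  qed (simp add: slice_op_out_of_range)
  thus ?thesis using False by (simp add: slice_op_out_of_range)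
qed

lemma bracket_zigzag:
  assumes "A \<noteq> 0" "i < length s"
  shows "bracket_op A [(i, Cup b), (i + 1, Cap)] f s = f s"
    and "bracket_op A [(i + 1, Cup b), (i, Cap)] f s = f s"
proof -
  obtain p a r where s: "s = p @ [a] @ r" "length p = i"
    by (rule split_at_1[OF assms(2)])
  note eqs = slice_op_uncond_eqs[OF s(2)] slice_op_cond_eqs[OF assms(1) s(2)]
  show "bracket_op A [(i, Cup b), (i + 1, Cap)] f s = f s"
    "bracket_op A [(i + 1, Cup b), (i, Cap)] f s = f s"
    unfolding s(1) using assms(1) by (cases a; simp add: eqs extremum_weight_defs; simp add: field_simps power3_eq_cube power2_eq_square)+
qed

lemma bracket_slide_cup:
  assumes "A \<noteq> 0" "i < length s"
  shows "bracket_op A [(i, Cup b), (i + 1, Cross q)] f s = bracket_op A [(i + 1, Cup b), (i, Cross (\<not> q))] f s"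
proof -
  obtain p a r where s: "s = p @ [a] @ r" "length p = i"
    by (rule split_at_1[OF assms(2)])
  note eqs = slice_op_uncond_eqs[OF s(2)] slice_op_cond_eqs[OF assms(1) s(2)]
  show ?thesis
    unfolding s(1) using assms(1) by (cases a; cases q; simp add: eqs extremum_weight_defs; simp add: field_simps power3_eq_cube power2_eq_square)
qed

lemma bracket_slide_cap:
  assumes "A \<noteq> 0" "i + 2 < length s"
  shows "bracket_op A [(i + 1, Cross q), (i, Cap)] f s = bracket_op A [(i, Cross (\<not> q)), (i + 1, Cap)] f s"
proof -
  obtain p a b c r where s: "s = p @ [a, b, c] @ r" "length p = i"
    by (rule split_at_3[OF assms(2)])
  note eqs = slice_op_uncond_eqs[OF s(2)] slice_op_cond_eqs[OF assms(1) s(2)]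
  show ?thesis
    unfolding s(1) using assms(1) by (cases a; cases b; cases c; cases q; simp add: eqs extremum_weight_defs; simp add: field_simps power3_eq_cube power2_eq_square)
qed

text \<open>
  The factor of a curl is what the writhe has to compensate.
\<close>

lemma bracket_R1:
  assumes "A \<noteq> 0" "i < length s"
  shows "bracket_op A [(i + 1, Cup b), (i, Cross q), (i + 1, Cap)] f s = - (A powi (if q then 3 else - 3)) * f s"
    and "bracket_op A [(i, Cup b), (i + 1, Cross q), (i, Cap)] f s = - (A powi (if q then 3 else - 3)) * f s"
proof -
  obtain p a r where s: "s = p @ [a] @ r" "length p = i"
    by (rule split_at_1[OF assms(2)])
  note eqs = slice_op_uncond_eqs[OF s(2)] slice_op_cond_eqs[OF assms(1) s(2)]
  show "bracket_op A [(i + 1, Cup b), (i, Cross q), (i + 1, Cap)] f s = - (A powi (if q then 3 else - 3)) * f s"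
    "bracket_op A [(i, Cup b), (i + 1, Cross q), (i, Cap)] f s = - (A powi (if q then 3 else - 3)) * f s"
    unfolding s(1) using assms(1)
    by (cases a; cases q; simp add: eqs extremum_weight_defs; simp add: field_simps power_int_def power3_eq_cube power2_eq_square)+
qed

lemma bracket_R2:
  assumes "A \<noteq> 0" "i + 1 < length s"
  shows "bracket_op A [(i, Cross q), (i, Cross (\<not> q))] f s = f s"
proof -
  obtain p a b r where s: "s = p @ [a, b] @ r" "length p = i"
    by (rule split_at_2[OF assms(2)])
  note eqs = slice_op_uncond_eqs[OF s(2)] slice_op_cond_eqs[OF assms(1) s(2)]
  show ?thesis
    unfolding s(1) using assms(1) by (cases a; cases b; cases q; simp add: eqs extremum_weight_defs; simp add: field_simps power3_eq_cube power2_eq_square)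
qed

lemma bracket_R3:
  assumes "A \<noteq> 0" "i + 2 < length s"
  shows "bracket_op A [(i, Cross q), (i + 1, Cross q), (i, Cross q)] f s
    = bracket_op A [(i + 1, Cross q), (i, Cross q), (i + 1, Cross q)] f s"
proof -
  obtain p a b c r where s: "s = p @ [a, b, c] @ r" "length p = i"
    by (rule split_at_3[OF assms(2)])
  \<comment> \<open>\<open>C\<close> and \<open>D\<close> are the diagonal coefficients of the positive and the negative crossing\<close>
  define B C D where "B = inverse A" and "C = A - B ^ 3" and "D = B - A ^ 3"
  have key: "U * (V * (U * X + W * Y)) + W * (U * (W * X) + W * (V * Z))
      = V * (U * (V * X) + W * (U * Y + W * Z))"
    if "U = V - W ^ 3" "V * W = 1" for U V W X Y Z :: complex
  proof -
    have "V * U = V ^ 2 - (V * W) * W ^ 2"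
      unfolding that(1) by (simp add: algebra_simps eval_nat_numeral)
    hence "U * X * (V * U + W ^ 2 - V ^ 2) = 0" by (simp add: that(2))
    thus ?thesis by (simp add: algebra_simps power2_eq_square)
  qed
  have AB: "A * B = 1" "B * A = 1" using assms(1) by (simp_all add: B_def)
  note eqs = slice_op_Cross[OF assms(1) s(2), folded B_def, folded C_def D_def]
    slice_op_Suc_Cross[OF assms(1) s(2), folded B_def, folded C_def D_def]
  show ?thesis
    unfolding s(1)
    by (cases q; cases a; cases b; cases c;
        simp add: eqs key[OF C_def AB(1)] key[OF D_def AB(2)]; simp add: algebra_simps)
qed

section \<open>Writhe and invariance under isotopy\<close>

lemma layer_eqs:
  assumes "length p = i"
  shows "layer (i, Cup b) (p @ r) = Some (p @ b # (\<not> b) # r)"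
    and "layer (i, Cap) (p @ a # a' # r) = (if a \<noteq> a' then Some (p @ r) else None)"
    and "layer (i, Cross q) (p @ a # a' # r) = Some (p @ a' # a # r)"
  using assms by (auto simp: nth_append)

lemma layer_Suc_eqs:
  assumes "length p = i"
  shows "layer (Suc i, Cup b) (p @ c # r) = Some (p @ c # b # (\<not> b) # r)"
    and "layer (Suc i, Cap) (p @ c # a # a' # r) = (if a \<noteq> a' then Some (p @ c # r) else None)"
    and "layer (Suc i, Cross q) (p @ c # a # a' # r) = Some (p @ c # a' # a # r)"
  using assms layer_eqs[of "p @ [c]" "Suc i"] by simp_all

text \<open>
  This reduces the exchange of distant pieces, for orientations as well as for crossing signs, to
  one computation for all pairs of pieces.
\<close>

lemma layer_append:
  assumes "length p = i" "length q = ins x"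
  shows "layer (i, x) (p @ q @ r) = map_option (\<lambda>t. p @ t @ r) (layer (0, x) q)"
proof (cases x)
  case (Cup b) thus ?thesis using assms by simp
next
  case Cap
  then obtain a b where "q = [a, b]" using assms by (auto simp: numeral_2_eq_2 length_Suc_conv)
  thus ?thesis using Cap assms layer_eqs(2)[of p i a b r] by (simp del: layer.simps) simp
next
  case (Cross s)
  then obtain a b where "q = [a, b]" using assms by (auto simp: numeral_2_eq_2 length_Suc_conv)
  thus ?thesis using Cross assms layer_eqs(3)[of p i s a b r] by (simp del: layer.simps) simp
qed

lemma layer_Some_length:
  assumes "layer (i, x) ori = Some ori'"
  shows "i + ins x \<le> length ori" "length ori' + ins x = length ori + outs x"
  using assms by (cases x; auto split: if_splits)+

lemma layers_append: "layers (D @ D') ori = Option.bind (layers D ori) (layers D')"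
  by (induction D arbitrary: ori) (auto split: bind_split)

text \<open>
  Reversing one of the two strands changes the sign, and reversing both does not.
\<close>

fun crossing_sign :: "nat \<times> piece \<Rightarrow> bool list \<Rightarrow> int" where
  "crossing_sign (i, Cross q) ori = (if (ori ! i = ori ! (i + 1)) = q then 1 else - 1)"
| "crossing_sign (i, _) ori = 0"

primrec writhe :: "diagram \<Rightarrow> bool list \<Rightarrow> int" where
  "writhe [] ori = 0"
| "writhe (l # D) ori =
     crossing_sign l ori + (case layer l ori of None \<Rightarrow> 0 | Some ori' \<Rightarrow> writhe D ori')"

lemma writhe_append:
  "layers D ori = Some ori' \<Longrightarrow> writhe (D @ D') ori = writhe D ori + writhe D' ori'"
  by (induction D arbitrary: ori) (auto split: bind_splits option.splits)

lemma crossing_sign_eqs: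
  assumes "length p = i"
  shows "crossing_sign (i, Cross q) (p @ a # a' # r) = (if (a = a') = q then 1 else - 1)"
    and "crossing_sign (Suc i, Cross q) (p @ c # a # a' # r) = (if (a = a') = q then 1 else - 1)"
  using assms by (auto simp: nth_append)

lemma crossing_sign_append:
  assumes "length p = i" "length q = ins x"
  shows "crossing_sign (i, x) (p @ q @ r) = crossing_sign (0, x) q"
  using assms by (cases x) (auto simp: nth_append)

lemma slice_op_cong:
  assumes "\<And>t. length t + ins x = length s + outs x \<Longrightarrow> f t = g t"
  shows "slice_op A (i, x) f s = slice_op A (i, x) g s"
  unfolding slice_op.simps by (intro if_cong sum.cong refl arg_cong2[where f = "(*)"] assms) auto

text \<open>
  A part of a diagram can be replaced by one with the same operator on lists of the length that
  actually occurs at its place; the moves hold only there.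
\<close>

lemma bracket_op_cong:
  assumes "layers D ori = Some ori'" "\<And>t. length t = length ori' \<Longrightarrow> f t = g t" "length s = length ori"
  shows "bracket_op A D f s = bracket_op A D g s"
  using assms(1,3)
proof (induction D arbitrary: ori s)
  case (Cons l D)
  obtain i x where l: "l = (i, x)" by (cases l)
  from Cons.prems obtain ori1 where 1: "layer l ori = Some ori1" "layers D ori1 = Some ori'"
    by (auto simp: bind_eq_Some_conv)
  show ?case
    unfolding bracket_op_Cons l
    by (rule slice_op_cong)
      (use layer_Some_length[of i x ori ori1] 1 l Cons.prems in \<open>auto intro!: Cons.IH\<close>)
qed (use assms(2) in auto)

lemma slice_op_scale: "slice_op A l (\<lambda>s. k * f s) s = k * slice_op A l f s"
  by (cases l) (simp add: slice_op.simps sum_distrib_left mult.left_commute)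

lemma slice_op_add: "slice_op A l (\<lambda>s. f s + g s) s = slice_op A l f s + slice_op A l g s"
  by (cases l) (simp add: slice_op.simps sum.distrib distrib_left)

lemma bracket_op_linear:
  "bracket_op A D (\<lambda>s. k * f s + m * g s) s = k * bracket_op A D f s + m * bracket_op A D g s"
proof (induction D arbitrary: s)
  case (Cons l D)
  have "bracket_op A D (\<lambda>s. k * f s + m * g s) = (\<lambda>s. k * bracket_op A D f s + m * bracket_op A D g s)"
    using Cons.IH by blast
  thus ?case by (simp add: slice_op_add slice_op_scale)
qed simp

lemma bracket_op_scale: "bracket_op A D (\<lambda>s. k * f s) s = k * bracket_op A D f s"
  using bracket_op_linear[of A D k f 0 f s] by simp

text \<open>
  The orientations \<open>ori\<close> along the lower cutting line are needed for the writhe.  With this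
  correction the operators of parts of a diagram still compose
  (\<open>kauffman_weight_append\<close>), so that invariance can be checked locally.
\<close>

definition kauffman_weight :: "complex \<Rightarrow> diagram \<Rightarrow> bool list \<Rightarrow> (bool list \<Rightarrow> complex) \<Rightarrow> bool list \<Rightarrow> complex" where
  "kauffman_weight A D ori f s = (- (A ^ 3)) powi (- writhe D ori) * bracket_op A D f s"

text \<open>
  The Jones polynomial at \<open>t = A ^ (-4)\<close>, normalized to be \<open>1\<close> at the empty diagram.
\<close>

definition jones_value :: "complex \<Rightarrow> diagram \<Rightarrow> complex" where
  "jones_value A D = kauffman_weight A D [] (\<lambda>s. of_bool (s = [])) []"

lemma kauffman_weight_append:
  assumes "A \<noteq> 0" "layers D ori = Some ori'"
  shows "kauffman_weight A (D @ D') ori f s = kauffman_weight A D ori (kauffman_weight A D' ori' f) s"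
proof -
  have *: "(- (A ^ 3)) powi (- (m + n)) = (- (A ^ 3)) powi (- m) * (- (A ^ 3)) powi (- n)" for m n
    using assms(1) by (simp add: power_int_add[symmetric] add.commute)
  have "kauffman_weight A D' ori' f = (\<lambda>s. (- (A ^ 3)) powi (- writhe D' ori') * bracket_op A D' f s)"
    by (simp only: kauffman_weight_def fun_eq_iff simp_thms)
  thus ?thesis
    unfolding kauffman_weight_def[of A D] kauffman_weight_def[of A "D @ D'"]
    by (simp only: bracket_op_scale bracket_op_append writhe_append[OF assms(2)] * mult.assoc)
qed

lemma kauffman_weight_cong:
  assumes "layers D ori = Some ori'" "\<And>t. length t = length ori' \<Longrightarrow> f t = g t" "length s = length ori"
  shows "kauffman_weight A D ori f s = kauffman_weight A D ori g s"
proof -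
  have "bracket_op A D f s = bracket_op A D g s"
    by (rule bracket_op_cong[OF assms(1) _ assms(3)]) (rule assms(2))
  thus ?thesis by (simp add: kauffman_weight_def)
qed

lemma kauffman_weight_eqI:
  "\<lbrakk>writhe D ori = writhe D' ori; bracket_op A D f s = bracket_op A D' f s\<rbrakk>
    \<Longrightarrow> kauffman_weight A D ori f s = kauffman_weight A D' ori f s"
  by (simp add: kauffman_weight_def)

text \<open>
  All four cuts of the two diagrams are described by one decomposition of \<open>ori\<close>, in which the two
  pieces replace the disjoint parts \<open>q\<close> and \<open>q2\<close>.
\<close>

lemma layers_exchange:
  assumes "i + outs x \<le> j" "layers [(i, x), (j, y)] ori = Some ori1"
    "layers [(j + ins x - outs x, y), (i, x)] ori = Some ori2"
  shows "ori1 = ori2" "writhe [(i, x), (j, y)] ori = writhe [(j + ins x - outs x, y), (i, x)] ori"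
proof -
  define k where "k = j - (i + outs x)"
  have j: "j = i + outs x + k" using assms(1) by (simp add: k_def)
  obtain ori' where ori': "layer (j + ins x - outs x, y) ori = Some ori'"
    using assms(3) by (auto simp: bind_eq_Some_conv)
  have "i + (ins x + k + ins y) \<le> length ori" using layer_Some_length(1)[OF ori'] j by simp
  then obtain p q' r where o: "ori = p @ q' @ r" "length p = i" "length q' = ins x + k + ins y"
    by (rule split_at)
  obtain q m q2 where q': "q' = q @ m @ q2" "length q = ins x" "length m = k"
    using split_at[of "ins x" k q'] o(3) by auto
  have l2: "length q2 = ins y" using o(3) q' by simp
  have 1: "layer (i, x) ori = map_option (\<lambda>t. p @ t @ m @ q2 @ r) (layer (0, x) q)"
    using layer_append[of p i q x "m @ q2 @ r"] o q' by simp
  then obtain t where t: "layer (0, x) q = Some t" using assms(2) by (cases "layer (0, x) q") auto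
  have lt: "length t = outs x" using layer_Some_length(2)[OF t] q'(2) by simp
  have 2: "layer (j, y) ((p @ t @ m) @ q2 @ r) = map_option (\<lambda>t'. (p @ t @ m) @ t' @ r) (layer (0, y) q2)"
    by (rule layer_append) (use o(2) lt q'(3) j l2 in auto)
  have 3: "layer (j + ins x - outs x, y) ((p @ q @ m) @ q2 @ r)
      = map_option (\<lambda>t'. (p @ q @ m) @ t' @ r) (layer (0, y) q2)"
    by (rule layer_append) (use o(2) q' j l2 in auto)
  obtain t' where t': "layer (0, y) q2 = Some t'"
    using ori' 3 o(1) q'(1) by (cases "layer (0, y) q2") auto
  have 4: "layer (i, x) (p @ q @ (m @ t' @ r)) = map_option (\<lambda>t. p @ t @ (m @ t' @ r)) (layer (0, x) q)"
    by (rule layer_append) (use o(2) q' in auto)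
  show "ori1 = ori2"
    using assms(2,3) 1 2 3 4 t t' o(1) q'(1) by simp
  have c: "crossing_sign (i, x) ori = crossing_sign (0, x) q"
    "crossing_sign (j, y) ((p @ t @ m) @ q2 @ r) = crossing_sign (0, y) q2"
    "crossing_sign (j + ins x - outs x, y) ((p @ q @ m) @ q2 @ r) = crossing_sign (0, y) q2"
    "crossing_sign (i, x) (p @ q @ (m @ t' @ r)) = crossing_sign (0, x) q"
    using crossing_sign_append[of p i q x "m @ q2 @ r"] crossing_sign_append[of p i q x "m @ t' @ r"]
      crossing_sign_append[of "p @ t @ m" j q2 y r]
      crossing_sign_append[of "p @ q @ m" "j + ins x - outs x" q2 y r] o q' l2 lt j
    by simp_all
  show "writhe [(i, x), (j, y)] ori = writhe [(j + ins x - outs x, y), (i, x)] ori"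
    using 1 2 3 4 c t t' o(1) q'(1) by simp
qed

text \<open>
  For the first Reidemeister move the curl factor cancels against the change of the writhe.  All
  other moves change neither the bracket nor the writhe.
\<close>

lemma isotopy_move_invariant:
  assumes A: "A \<noteq> 0" and move: "isotopy_move x y"
    and x: "layers x ori = Some ori1" and y: "layers y ori = Some ori2" and s: "length s = length ori"
  shows "ori1 = ori2 \<and> kauffman_weight A x ori f s = kauffman_weight A y ori f s"
  using move
proof cases
  case (exchange i x' j y')
  have "bracket_op A x f s = bracket_op A y f s"
    using exchange by (simp add: slice_op_exchange)
  thus ?thesis
    using layers_exchange[of i x' j y' ori ori1 ori2] x y exchange
    by (auto intro!: kauffman_weight_eqI simp del: layers.simps writhe.simps bracket_op_Cons)
next
  case (zigzag_l i b)
  have i: "i < length ori" using x zigzag_l by (auto split: if_splits)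
  then obtain p a r where o: "ori = p @ [a] @ r" "length p = i" by (rule split_at_1)
  note eqs = layer_eqs[OF o(2)] layer_Suc_eqs[OF o(2)] crossing_sign_eqs[OF o(2)]
  have "ori1 = ori2 \<and> writhe x ori = writhe y ori"
    using x y unfolding zigzag_l o(1)
    by (auto simp del: layer.simps crossing_sign.simps(1) simp: eqs split: if_splits)
  thus ?thesis
    using bracket_zigzag(1)[OF A, of i s b f] i s unfolding zigzag_l
    by (auto intro!: kauffman_weight_eqI simp del: bracket_op_Cons writhe.simps)
next
  case (zigzag_r i b)
  have i: "i < length ori" using x zigzag_r by (auto split: if_splits)
  then obtain p a r where o: "ori = p @ [a] @ r" "length p = i" by (rule split_at_1)
  note eqs = layer_eqs[OF o(2)] layer_Suc_eqs[OF o(2)] crossing_sign_eqs[OF o(2)]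
  have "ori1 = ori2 \<and> writhe x ori = writhe y ori"
    using x y unfolding zigzag_r o(1)
    by (auto simp del: layer.simps crossing_sign.simps(1) simp: eqs split: if_splits)
  thus ?thesis
    using bracket_zigzag(2)[OF A, of i s b f] i s unfolding zigzag_r
    by (auto intro!: kauffman_weight_eqI simp del: bracket_op_Cons writhe.simps)
next
  case (slide_cup i b q)
  have i: "i < length ori" using y slide_cup by (auto split: if_splits)
  then obtain p a r where o: "ori = p @ [a] @ r" "length p = i" by (rule split_at_1)
  note eqs = layer_eqs[OF o(2)] layer_Suc_eqs[OF o(2)] crossing_sign_eqs[OF o(2)]
  have "ori1 = ori2 \<and> writhe x ori = writhe y ori"
    using x y unfolding slide_cup o(1)
    by (auto simp del: layer.simps crossing_sign.simps(1) simp: eqs split: if_splits)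
  thus ?thesis
    using bracket_slide_cup[OF A, of i s b q f] i s unfolding slide_cup
    by (auto intro!: kauffman_weight_eqI simp del: bracket_op_Cons writhe.simps)
next
  case (slide_cap i q)
  have i: "i + 2 < length ori" using x slide_cap by (auto split: if_splits)
  then obtain p a b c r where o: "ori = p @ [a, b, c] @ r" "length p = i" by (rule split_at_3)
  note eqs = layer_eqs[OF o(2)] layer_Suc_eqs[OF o(2)] crossing_sign_eqs[OF o(2)]
  have "ori1 = ori2 \<and> writhe x ori = writhe y ori"
    using x y unfolding slide_cap o(1)
    by (auto simp del: layer.simps crossing_sign.simps(1) simp: eqs split: if_splits)
  thus ?thesis
    using bracket_slide_cap[OF A, of i s q f] i s unfolding slide_cap
    by (auto intro!: kauffman_weight_eqI simp del: bracket_op_Cons writhe.simps)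
next
  case (R1_r i b q)
  have i: "i < length ori" using x R1_r by (auto split: if_splits)
  then obtain p a r where o: "ori = p @ [a] @ r" "length p = i" by (rule split_at_1)
  note eqs = layer_eqs[OF o(2)] layer_Suc_eqs[OF o(2)] crossing_sign_eqs[OF o(2)]
  have "ori1 = ori2 \<and> writhe x ori = (if q then 1 else - 1)"
    using x y unfolding R1_r o(1)
    by (auto simp del: layer.simps crossing_sign.simps(1) simp: eqs split: if_splits)
  thus ?thesis
    using bracket_R1(1)[OF A, of i s b q f] A i s unfolding R1_r kauffman_weight_def
    by (auto simp: power_int_minus field_simps simp del: bracket_op_Cons)
next
  case (R1_l i b q)
  have i: "i < length ori" using x R1_l by (auto split: if_splits)
  then obtain p a r where o: "ori = p @ [a] @ r" "length p = i" by (rule split_at_1)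
  note eqs = layer_eqs[OF o(2)] layer_Suc_eqs[OF o(2)] crossing_sign_eqs[OF o(2)]
  have "ori1 = ori2 \<and> writhe x ori = (if q then 1 else - 1)"
    using x y unfolding R1_l o(1)
    by (auto simp del: layer.simps crossing_sign.simps(1) simp: eqs split: if_splits)
  thus ?thesis
    using bracket_R1(2)[OF A, of i s b q f] A i s unfolding R1_l kauffman_weight_def
    by (auto simp: power_int_minus field_simps simp del: bracket_op_Cons)
next
  case (R2 i q)
  have i: "i + 1 < length ori" using x R2 by (auto split: if_splits)
  then obtain p a b r where o: "ori = p @ [a, b] @ r" "length p = i" by (rule split_at_2)
  note eqs = layer_eqs[OF o(2)] layer_Suc_eqs[OF o(2)] crossing_sign_eqs[OF o(2)]
  have "ori1 = ori2 \<and> writhe x ori = writhe y ori"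
    using x y unfolding R2 o(1)
    by (auto simp del: layer.simps crossing_sign.simps(1) simp: eqs split: if_splits)
  thus ?thesis
    using bracket_R2[OF A, of i s q f] i s unfolding R2
    by (auto intro!: kauffman_weight_eqI simp del: bracket_op_Cons writhe.simps)
next
  case (R3 i q)
  have i: "i + 2 < length ori" using x R3 by (auto split: if_splits)
  then obtain p a b c r where o: "ori = p @ [a, b, c] @ r" "length p = i" by (rule split_at_3)
  note eqs = layer_eqs[OF o(2)] layer_Suc_eqs[OF o(2)] crossing_sign_eqs[OF o(2)]
  have "ori1 = ori2 \<and> writhe x ori = writhe y ori"
    using x y unfolding R3 o(1)
    by (auto simp del: layer.simps crossing_sign.simps(1) simp: eqs split: if_splits)
  thus ?thesis
    using bracket_R3[OF A, of i s q f] i s unfolding R3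
    by (auto intro!: kauffman_weight_eqI simp del: bracket_op_Cons writhe.simps)
qed

lemma jones_value_isotopy_step:
  assumes A: "A \<noteq> 0" and "isotopy_step D D'"
  shows "jones_value A D = jones_value A D'"
proof -
  obtain u v x y where D: "D = u @ x @ v" "D' = u @ y @ v" and move: "isotopy_move x y"
    and "layers D [] = Some []" "layers D' [] = Some []"
    using assms(2) by (auto simp: isotopy_step_def oriented_link_def)
  then obtain ori ori1 ori2 where l: "layers u [] = Some ori" "layers x ori = Some ori1" "layers v ori1 = Some []"
      "layers y ori = Some ori2" "layers v ori2 = Some []"
    by (auto simp: layers_append bind_eq_Some_conv)
  let ?f = "\<lambda>s. of_bool (s = [])"
  note inv = isotopy_move_invariant[OF A move l(2,4)]
  have eq: "ori2 = ori1" using inv[of "ori"] by simp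
  have "jones_value A D = kauffman_weight A u [] (kauffman_weight A x ori (kauffman_weight A v ori1 ?f)) []"
    unfolding jones_value_def D kauffman_weight_append[OF A l(1)] kauffman_weight_append[OF A l(2)]
    by (rule kauffman_weight_cong[OF l(1)]) (simp_all add: kauffman_weight_append[OF A l(2)])
  also have "\<dots> = kauffman_weight A u [] (kauffman_weight A y ori (kauffman_weight A v ori1 ?f)) []"
    by (rule kauffman_weight_cong[OF l(1)]) (use inv in auto)
  also have "\<dots> = jones_value A D'"
    unfolding jones_value_def D kauffman_weight_append[OF A l(1)]
    by (rule kauffman_weight_cong[OF l(1)]) (simp_all add: kauffman_weight_append[OF A l(4)] eq)
  finally show ?thesis .
qed

lemma jones_value_isotopic:
  assumes "A \<noteq> 0" "isotopic D D'"
  shows "jones_value A D = jones_value A D'"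
proof -
  have "equivclp isotopy_step D D'" using assms(2) by (simp add: isotopic_def)
  thus ?thesis
    by (induction rule: equivclp_induct) (auto dest: jones_value_isotopy_step[OF assms(1)])
qed

section \<open>The Jones value of closed braids\<close>

text \<open>
  The orientations next to a closed braid: the \<open>n\<close> strands of the braid are on the left and the returning
  strands on the right.
\<close>

abbreviation braid_state :: "nat \<Rightarrow> bool list" where
  "braid_state n \<equiv> replicate n True @ replicate n False"

definition crossings :: "braid_word \<Rightarrow> diagram" where
  "crossings = map (\<lambda>(i, s). (i - 1, Cross s))"

definition cups :: "nat \<Rightarrow> diagram" where "cups n = map (\<lambda>i. (i, Cup True)) [0..<n]"

definition caps :: "nat \<Rightarrow> diagram" where "caps n = map (\<lambda>i. (i, Cap)) (rev [0..<n])"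

lemma word_closure_eq: "word_closure n w = cups n @ crossings w @ caps n"
  by (simp add: word_closure_def cups_def caps_def crossings_def)

lemma cups_Suc: "cups (Suc n) = cups n @ [(n, Cup True)]"
  and caps_Suc: "caps (Suc n) = (n, Cap) # caps n"
  and cups_0: "cups 0 = []" and caps_0: "caps 0 = []"
  by (simp_all add: cups_def caps_def)

lemma crossings_append [simp]: "crossings (u @ v) = crossings u @ crossings v"
  and crossings_Nil [simp]: "crossings [] = []"
  and crossings_Cons [simp]: "crossings ((i, s) # w) = (i - 1, Cross s) # crossings w"
  by (simp_all add: crossings_def)

lemma braid_words_simps [simp]:
  "[] \<in> braid_words n"
  "(i, s) # w \<in> braid_words n \<longleftrightarrow> 1 \<le> i \<and> i < n \<and> w \<in> braid_words n"
  "u @ v \<in> braid_words n \<longleftrightarrow> u \<in> braid_words n \<and> v \<in> braid_words n"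
  by (auto simp: braid_words_def)

lemma layers_cups: "layers (cups n) [] = Some (braid_state n)"
proof (induction n)
  case (Suc n)
  show ?case
    unfolding cups_Suc layers_append Suc.IH
    using layer_eqs(1)[of "replicate n True" n True "replicate n False"]
    by (simp add: replicate_append_same[symmetric])
qed (simp add: cups_0)

lemma layers_caps: "layers (caps n) (braid_state n) = Some []"
proof (induction n)
  case (Suc n)
  have "layer (n, Cap) (braid_state (Suc n)) = Some (braid_state n)"
    using layer_eqs(2)[of "replicate n True" n True False "replicate n False"]
    by (simp add: replicate_append_same[symmetric])
  thus ?case using Suc.IH by (simp add: caps_Suc del: layer.simps)
qed (simp add: caps_0)

lemma braid_state_split:
  assumes "1 \<le> i" "i < n"
  shows "braid_state n = replicate (i - 1) True @ True # True # (replicate (n - i - 1) True @ replicate n False)"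
proof -
  have "n = (i - 1) + Suc (Suc (n - i - 1))" using assms by simp
  hence "replicate n True = replicate (i - 1) True @ replicate (Suc (Suc (n - i - 1))) True"
    by (metis replicate_add)
  thus ?thesis by simp
qed

lemma layer_braid_state:
  assumes "1 \<le> i" "i < n"
  shows "layer (i - 1, Cross s) (braid_state n) = Some (braid_state n)"
    and "crossing_sign (i - 1, Cross s) (braid_state n) = (if s then 1 else - 1)"
  unfolding braid_state_split[OF assms] by (simp_all add: layer_eqs crossing_sign_eqs del: layer.simps crossing_sign.simps)

definition letter_sum :: "braid_word \<Rightarrow> int" where
  "letter_sum w = (\<Sum>(i, s)\<leftarrow>w. if s then 1 else - 1)"

lemma letter_sum_simps [simp]:
  "letter_sum [] = 0" "letter_sum ((i, s) # w) = (if s then 1 else - 1) + letter_sum w"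
  "letter_sum (u @ v) = letter_sum u + letter_sum v"
  by (simp_all add: letter_sum_def)

lemma layers_crossings:
  assumes "w \<in> braid_words n"
  shows "layers (crossings w) (braid_state n) = Some (braid_state n)"
    and "writhe (crossings w) (braid_state n) = letter_sum w"
proof -
  have "layers (crossings w) (braid_state n) = Some (braid_state n) \<and>
      writhe (crossings w) (braid_state n) = letter_sum w"
    using assms
  proof (induction w rule: list.induct)
    case (Cons l w)
    obtain i s where l: "l = (i, s)" by (cases l)
    with Cons layer_braid_state[of i n s] show ?case
      by (simp del: layer.simps crossing_sign.simps)
  qed simp
  thus "layers (crossings w) (braid_state n) = Some (braid_state n)"
    "writhe (crossings w) (braid_state n) = letter_sum w" by simp_all
qed

lemma oriented_link_word_closure: "w \<in> braid_words n \<Longrightarrow> oriented_link (word_closure n w)"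
  by (simp add: oriented_link_def word_closure_eq layers_append layers_cups layers_crossings layers_caps)

lemma writhe_crossingless:
  "(\<And>i q. (i, Cross q) \<notin> set D) \<Longrightarrow> writhe D ori = 0"
proof (induction D arbitrary: ori)
  case (Cons l D)
  obtain i x where "l = (i, x)" by (cases l)
  moreover have "crossing_sign l ori' = 0" for ori'
    using Cons.prems[of i] \<open>l = (i, x)\<close> by (cases x) auto
  moreover have "writhe D ori' = 0" for ori' using Cons by simp
  ultimately show ?case by (simp split: option.split)
qed simp

lemma writhe_word_closure: "w \<in> braid_words n \<Longrightarrow> writhe (word_closure n w) [] = letter_sum w"
proof -
  assume w: "w \<in> braid_words n"
  have "writhe (cups n) ori = 0" "writhe (caps n) ori = 0" for ori
    by (rule writhe_crossingless; auto simp: cups_def caps_def)+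
  thus ?thesis
    using w by (simp add: word_closure_eq writhe_append[OF layers_cups] writhe_append[OF layers_crossings(1)] layers_crossings(2))
qed

lemma jones_value_word_closure:
  "w \<in> braid_words n \<Longrightarrow> jones_value A (word_closure n w) =
     (- (A ^ 3)) powi (- letter_sum w) * bracket_op A (word_closure n w) (\<lambda>s. of_bool (s = [])) []"
  by (simp add: jones_value_def kauffman_weight_def writhe_word_closure)

text \<open>
  In this combination the smoothings by a maximum and a minimum cancel.
\<close>

lemma bracket_skein:
  assumes "A \<noteq> 0" "i + 1 < length s"
  shows "A * bracket_op A [(i, Cross True)] f s - inverse A * bracket_op A [(i, Cross False)] f s
    = (A ^ 2 - inverse A ^ 2) * f s"
proof -
  obtain p a b r where s: "s = p @ [a, b] @ r" "length p = i"
    by (rule split_at_2[OF assms(2)])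
  note eqs = slice_op_Cross[OF assms(1) s(2)]
  show ?thesis
    unfolding s(1) using assms(1)
    by (cases a; cases b; simp add: eqs; simp add: field_simps power3_eq_cube power2_eq_square)
qed

lemma bracket_loop:
  assumes "A \<noteq> 0" "i \<le> length s"
  shows "bracket_op A [(i, Cup b), (i, Cap)] f s = (- (A ^ 2) - inverse A ^ 2) * f s"
proof -
  obtain p r where s: "s = p @ r" "length p = i"
    using assms(2) by (metis append_take_drop_id length_take min.absorb2)
  note eqs = slice_op_Cup[OF s(2)] slice_op_Cap[OF s(2)]
  show ?thesis
    unfolding s(1) using assms(1) by (simp add: eqs extremum_weight_defs algebra_simps)
qed

text \<open>
  The innermost minimum and maximum of a closed braid lie to the right of the strands of \<open>w\<close>, so
  they can be moved to the place where the last generator occurs.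
\<close>

lemma bracket_slide_past_braid:
  assumes "w \<in> braid_words n"
  shows "bracket_op A ((n, y) # crossings w) f = bracket_op A (crossings w @ [(n, y)]) f"
  using assms
proof (induction w rule: list.induct)
  case (Cons l w)
  obtain i s where l: "l = (i, s)" by (cases l)
  hence i: "1 \<le> i" "i < n" and w: "w \<in> braid_words n" using Cons.prems by simp_all
  have "slice_op A (n, y) (slice_op A (i - 1, Cross s) g) = slice_op A (i - 1, Cross s) (slice_op A (n, y) g)" for g
    using slice_op_exchange[of "i - 1" "Cross s" n A y g] i by (auto simp: fun_eq_iff)
  thus ?case using Cons.IH[OF w] l by simp
qed simp

lemma jones_value_skein:
  assumes A: "A \<noteq> 0" and u: "u \<in> braid_words n" and v: "v \<in> braid_words n" and i: "1 \<le> i" "i < n"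
  shows "inverse A ^ 4 * jones_value A (word_closure n (u @ [(i, False)] @ v))
       - A ^ 4 * jones_value A (word_closure n (u @ [(i, True)] @ v))
       = (A ^ 2 - inverse A ^ 2) * jones_value A (word_closure n (u @ v))"
proof -
  let ?D = "cups n @ crossings u" and ?f = "bracket_op A (crossings v @ caps n) (\<lambda>s. of_bool (s = []))"
  let ?e = "(- (A ^ 3)) powi (- (letter_sum u + letter_sum v))"
  have l: "layers ?D [] = Some (braid_state n)"
    using u by (simp add: layers_append layers_cups layers_crossings)
  have "bracket_op A ?D (\<lambda>s. A * bracket_op A [(i - 1, Cross True)] ?f s
          + (- inverse A) * bracket_op A [(i - 1, Cross False)] ?f s) []
      = bracket_op A ?D (\<lambda>s. (A ^ 2 - inverse A ^ 2) * ?f s) []"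
    by (rule bracket_op_cong[OF l])
      (use bracket_skein[OF A, of "i - 1" _ ?f] i in \<open>auto simp del: bracket_op_append bracket_op_Cons\<close>)
  hence eq: "A * bracket_op A ?D (bracket_op A [(i - 1, Cross True)] ?f) []
      - inverse A * bracket_op A ?D (bracket_op A [(i - 1, Cross False)] ?f) []
      = (A ^ 2 - inverse A ^ 2) * bracket_op A ?D ?f []"
    unfolding bracket_op_linear bracket_op_scale by simp
  have words: "u @ [(i, True)] @ v \<in> braid_words n" "u @ [(i, False)] @ v \<in> braid_words n"
    "u @ v \<in> braid_words n"
    using u v i by simp_all
  have T: "jones_value A (word_closure n (u @ [(i, True)] @ v))
      = ?e * (- (inverse A ^ 3)) * bracket_op A ?D (bracket_op A [(i - 1, Cross True)] ?f) []"
    and F: "jones_value A (word_closure n (u @ [(i, False)] @ v))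
      = ?e * (- (A ^ 3)) * bracket_op A ?D (bracket_op A [(i - 1, Cross False)] ?f) []"
    and 0: "jones_value A (word_closure n (u @ v)) = ?e * bracket_op A ?D ?f []"
    unfolding words[THEN jones_value_word_closure]
    using A by (simp_all add: word_closure_eq power_int_diff power_int_add power_int_minus field_simps)
  have "inverse A ^ 4 * (e * (- (A ^ 3)) * x) - A ^ 4 * (e * (- (inverse A ^ 3)) * y)
      = e * (A * y - inverse A * x)" for e x y
    using A by (simp add: field_simps power3_eq_cube power4_eq_xxxx)
  thus ?thesis unfolding T F 0 using eq by (simp only: mult.left_commute)
qed

text \<open>
  The innermost minimum slides up past \<open>u\<close> and the innermost maximum down past \<open>v\<close>.  Together with
  the new crossing they form a curl, whose factor is compensated by the writhe.
\<close>

lemma jones_value_stabilization: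
  assumes A: "A \<noteq> 0" and n: "1 \<le> n" and u: "u \<in> braid_words n" and v: "v \<in> braid_words n"
  shows "jones_value A (word_closure (Suc n) (u @ [(n, True)] @ v)) = jones_value A (word_closure n (u @ v))"
proof -
  let ?f = "\<lambda>s::bool list. of_bool (s = []) :: complex" and ?D = "cups n @ crossings u"
  let ?g = "bracket_op A (crossings v @ caps n) ?f"
  have Suc_words: "braid_words n \<subseteq> braid_words (Suc n)" by (auto simp: braid_words_def in_lists_conv_set)
  have l: "layers ?D [] = Some (braid_state n)"
    using u by (simp add: layers_append layers_cups layers_crossings)
  have "bracket_op A (word_closure (Suc n) (u @ [(n, True)] @ v)) ?f []
      = bracket_op A (cups n @ ((n, Cup True) # crossings u) @ [(n - 1, Cross True)] @ (crossings v @ [(n, Cap)]) @ caps n) ?f []"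
    by (simp add: word_closure_eq cups_Suc caps_Suc)
  also have "\<dots> = bracket_op A (cups n @ (crossings u @ [(n, Cup True)]) @ [(n - 1, Cross True)] @ ((n, Cap) # crossings v) @ caps n) ?f []"
    unfolding bracket_op_append[of A "(n, Cup True) # crossings u"] bracket_op_append[of A "crossings u @ [(n, Cup True)]"]
      bracket_op_append[of A "(n, Cap) # crossings v"] bracket_op_append[of A "crossings v @ [(n, Cap)]"]
      bracket_op_append[of A "cups n"] bracket_op_append[of A "[(n - 1, Cross True)]"]
      bracket_slide_past_braid[OF u] bracket_slide_past_braid[OF v] ..
  also have "\<dots> = bracket_op A ?D (bracket_op A [(n, Cup True), (n - 1, Cross True), (n, Cap)] ?g) []"
    by simp
  also have "\<dots> = bracket_op A ?D (\<lambda>s. - (A ^ 3) * ?g s) []"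
    by (rule bracket_op_cong[OF l])
      (use bracket_R1(1)[OF A, of "n - 1" _ True True ?g] n in \<open>auto simp del: bracket_op_append bracket_op_Cons\<close>)
  also have "\<dots> = - (A ^ 3) * bracket_op A (word_closure n (u @ v)) ?f []"
    unfolding bracket_op_scale by (simp add: word_closure_eq)
  finally show ?thesis
    using u v A Suc_words n
    by (simp add: jones_value_word_closure subset_iff power_int_diff power_int_add power_int_minus field_simps)
qed

text \<open>
  The innermost minimum slides up past \<open>u\<close> and closes to a circle with the innermost maximum.
\<close>

lemma jones_value_extra_strand:
  assumes A: "A \<noteq> 0" and u: "u \<in> braid_words n"
  shows "jones_value A (word_closure (Suc n) u) = (- (A ^ 2) - inverse A ^ 2) * jones_value A (word_closure n u)"
proof -
  let ?f = "\<lambda>s::bool list. of_bool (s = []) :: complex" and ?D = "cups n @ crossings u"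
  let ?g = "bracket_op A (caps n) ?f"
  have Suc_words: "braid_words n \<subseteq> braid_words (Suc n)" by (auto simp: braid_words_def in_lists_conv_set)
  have l: "layers ?D [] = Some (braid_state n)"
    using u by (simp add: layers_append layers_cups layers_crossings)
  have "bracket_op A (word_closure (Suc n) u) ?f []
      = bracket_op A (cups n @ ((n, Cup True) # crossings u) @ [(n, Cap)] @ caps n) ?f []"
    by (simp add: word_closure_eq cups_Suc caps_Suc)
  also have "\<dots> = bracket_op A (cups n @ (crossings u @ [(n, Cup True)]) @ [(n, Cap)] @ caps n) ?f []"
    unfolding bracket_op_append[of A "(n, Cup True) # crossings u"] bracket_op_append[of A "crossings u @ [(n, Cup True)]"]
      bracket_op_append[of A "cups n"] bracket_slide_past_braid[OF u] ..
  also have "\<dots> = bracket_op A ?D (bracket_op A [(n, Cup True), (n, Cap)] ?g) []"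
    by simp
  also have "\<dots> = bracket_op A ?D (\<lambda>s. (- (A ^ 2) - inverse A ^ 2) * ?g s) []"
    by (rule bracket_op_cong[OF l])
      (use bracket_loop[OF A, of n _ True ?g] in \<open>auto simp del: bracket_op_append bracket_op_Cons\<close>)
  also have "\<dots> = (- (A ^ 2) - inverse A ^ 2) * bracket_op A (word_closure n u) ?f []"
    unfolding bracket_op_scale by (simp add: word_closure_eq)
  finally show ?thesis
    using u Suc_words by (simp add: jones_value_word_closure subset_iff)
qed

lemma isotopicI:
  assumes "isotopy_move x y" "oriented_link (u @ x @ v)" "oriented_link (u @ y @ v)"
  shows "isotopic (u @ x @ v) (u @ y @ v)"
proof -
  have "isotopy_step (u @ x @ v) (u @ y @ v)" using assms unfolding isotopy_step_def by blast
  thus ?thesis using assms by (auto simp: isotopic_def intro: r_into_equivclp)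
qed

lemma isotopic_refl: "oriented_link D \<Longrightarrow> isotopic D D"
  and isotopic_sym: "isotopic D D' \<Longrightarrow> isotopic D' D"
  and isotopic_trans: "\<lbrakk>isotopic D D'; isotopic D' D''\<rbrakk> \<Longrightarrow> isotopic D D''"
  unfolding isotopic_def by (auto intro: equivclp_sym equivclp_trans)

lemma jones_value_braid_relation:
  assumes A: "A \<noteq> 0" and xy: "braid_relation x y" and w: "u @ x @ v \<in> braid_words n" "u @ y @ v \<in> braid_words n"
  shows "jones_value A (word_closure n (u @ x @ v)) = jones_value A (word_closure n (u @ y @ v))"
proof -
  have "isotopy_move (crossings x) (crossings y)"
    using xy
  proof cases
    case (cancel i s)
    thus ?thesis using isotopy_move.R2[of "i - 1" s] by simp
  next
    case (far i j)
    thus ?thesis using isotopy_move.exchange[of "i - 1" "Cross True" "j - 1" "Cross True"] w by simp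
  next
    case (braid i)
    thus ?thesis using isotopy_move.R3[of "i - 1" True] w by simp
  qed
  hence "isotopic ((cups n @ crossings u) @ crossings x @ (crossings v @ caps n))
      ((cups n @ crossings u) @ crossings y @ (crossings v @ caps n))"
    by (rule isotopicI) (use oriented_link_word_closure[OF w(1)] oriented_link_word_closure[OF w(2)] in \<open>simp_all add: word_closure_eq\<close>)
  thus ?thesis using jones_value_isotopic[OF A] by (simp add: word_closure_eq)
qed

text \<open>
  The assumptions on \<open>z\<close> imply \<open>A ^ 4 + A ^ (-4) = 0\<close>, so that both crossings have the same
  coefficient in the skein relation of \<open>jones_value\<close>.
\<close>

lemma skein_trace_jones_value:
  assumes A: "A \<noteq> 0" and z: "A ^ 2 + inverse A ^ 2 = - z" "z ^ 2 = 2"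
  shows "skein_trace z 1 z (\<lambda>n w. jones_value A (word_closure n w))"
proof (rule skein_traceI)
  define a b where "a = A ^ 2" and "b = inverse A ^ 2"
  have ab: "a * b = 1" "a + b = - z" using A z(1) by (simp_all add: a_def b_def power_mult_distrib[symmetric])
  have "a ^ 2 + b ^ 2 + 2 * (a * b) = (a + b) ^ 2" by (simp add: power2_eq_square algebra_simps)
  also have "\<dots> = 2" using ab z(2) by simp
  finally have b2: "b ^ 2 = - (a ^ 2)" using ab by (simp add: add_eq_0_iff2)
  have "b ^ 2 * (a - b) = b * (a * b) - b * b ^ 2" by (simp add: power2_eq_square algebra_simps)
  also have "\<dots> = b * (a * b) + a * (a * b)" unfolding b2 by (simp add: power2_eq_square algebra_simps)
  also have "\<dots> = - z" using ab by (simp add: add.commute)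
  finally have bz: "b ^ 2 * (a - b) = - z" .
  fix n u v i assume w: "u \<in> braid_words n" "v \<in> braid_words n" and i: "i \<in> {1..<n}"
  let ?P = "jones_value A (word_closure n (u @ [(i, True)] @ v))"
    and ?N = "jones_value A (word_closure n (u @ [(i, False)] @ v))"
    and ?Z = "jones_value A (word_closure n (u @ v))"
  have "b ^ 2 * ?N - a ^ 2 * ?P = (a - b) * ?Z"
    using jones_value_skein[OF A w, of i] i by (simp add: a_def b_def power_mult[symmetric])
  hence "a ^ 2 * (?P + ?N) = - (a - b) * ?Z" unfolding b2 by (simp add: algebra_simps)
  hence "b ^ 2 * (a ^ 2 * (?P + ?N)) = b ^ 2 * (- (a - b) * ?Z)" by (simp only:)
  also have "\<dots> = - (b ^ 2 * (a - b)) * ?Z" by (simp add: algebra_simps)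
  finally have "b ^ 2 * (a ^ 2 * (?P + ?N)) = - (b ^ 2 * (a - b)) * ?Z" .
  moreover have "b ^ 2 * a ^ 2 = 1" using ab(1) by (simp add: power_mult_distrib[symmetric] mult.commute)
  ultimately show "?P + ?N = z * ?Z" unfolding bz mult.assoc[symmetric] by simp
next
  fix n u v x y
  assume "u \<in> braid_words n" "v \<in> braid_words n" "x \<in> braid_words n" "y \<in> braid_words n" "braid_relation x y"
  thus "jones_value A (word_closure n (u @ x @ v)) = jones_value A (word_closure n (u @ y @ v))"
    by (intro jones_value_braid_relation[OF A]) simp_all
next
  fix n u v assume "1 \<le> n" "u \<in> braid_words n" "v \<in> braid_words n"
  thus "jones_value A (word_closure (Suc n) (u @ [(n, True)] @ v)) = 1 * jones_value A (word_closure n (u @ v))"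
    using jones_value_stabilization[OF A] by simp
next
  fix n u assume "u \<in> braid_words n"
  moreover have "- (A ^ 2) - inverse A ^ 2 = z" using z(1) by (metis add_uminus_conv_diff minus_add_distrib minus_minus)
  ultimately show "jones_value A (word_closure (Suc n) u) = z * jones_value A (word_closure n u)"
    using jones_value_extra_strand[OF A] by simp
qed

section \<open>Trivial links as closed braids\<close>

lemma isotopic_in_context:
  assumes "layers u [] = Some ori" "layers (a @ x @ b) ori = Some ori'" "layers (a @ y @ b) ori = Some ori'"
    "layers v ori' = Some []" "isotopy_move x y"
  shows "isotopic (u @ (a @ x @ b) @ v) (u @ (a @ y @ b) @ v)"
proof -
  have "oriented_link (u @ (a @ x @ b) @ v)" "oriented_link (u @ (a @ y @ b) @ v)"
    using assms by (simp_all only: oriented_link_def layers_append[of u] layers_append[of "_ @ _ @ _" v] bind.bind_lunit)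
  thus ?thesis using isotopicI[OF assms(5), of "u @ a" "b @ v"] by simp
qed

text \<open>
  The circle is to the right of strand \<open>i\<close>.  A second Reidemeister move makes this strand cross the
  circle, the two crossings are turned around the minimum and the maximum of the circle, and then
  cancel again with the strand on the other side.
\<close>

lemma isotopic_circle_past_strand:
  assumes u: "layers u [] = Some ori" and i: "i < length ori" and v: "layers v ori = Some []"
  shows "isotopic (u @ [(i + 1, Cup b), (i + 1, Cap)] @ v) (u @ [(i, Cup b), (i, Cap)] @ v)"
proof -
  obtain p c r where o: "ori = p @ [c] @ r" "length p = i" by (rule split_at_1[OF i])
  note eqs = layer_eqs[OF o(2)] layer_Suc_eqs[OF o(2)]
  \<comment> \<open>the stages of the move, split where the next elementary move applies\<close>
  let ?D0 = "[(i + 1, Cup b)] @ [] @ [(i + 1, Cap)]"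
  let ?D1 = "[(i + 1, Cup b)] @ [(i, Cross True), (i, Cross False)] @ [(i + 1, Cap)]"
  let ?D2 = "[] @ [(i, Cup b), (i + 1, Cross False)] @ [(i, Cross False), (i + 1, Cap)]"
  let ?D3 = "[(i, Cup b)] @ [(i + 1, Cross False), (i + 1, Cross True)] @ [(i, Cap)]"
  let ?D4 = "[(i, Cup b)] @ [] @ [(i, Cap)]"
  have D: "layers ?D0 ori = Some ori" "layers ?D1 ori = Some ori" "layers ?D2 ori = Some ori"
    "layers ?D3 ori = Some ori" "layers ?D4 ori = Some ori"
    unfolding o(1) by (auto simp: eqs simp del: layer.simps)
  have "isotopic (u @ ?D1 @ v) (u @ ?D0 @ v)"
    by (rule isotopic_in_context[OF u D(2,1) v]) (use isotopy_move.R2[of i True] in simp)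
  moreover have "isotopic (u @ ?D2 @ v) (u @ ([] @ [(i + 1, Cup b), (i, Cross True)] @ [(i, Cross False), (i + 1, Cap)]) @ v)"
    by (rule isotopic_in_context[OF u D(3) _ v]) (use isotopy_move.slide_cup[of i b False] D(2) in simp_all)
  moreover have "isotopic (u @ ([(i, Cup b), (i + 1, Cross False)] @ [(i + 1, Cross True), (i, Cap)] @ []) @ v)
      (u @ ([(i, Cup b), (i + 1, Cross False)] @ [(i, Cross False), (i + 1, Cap)] @ []) @ v)"
    by (rule isotopic_in_context[OF u _ _ v]) (use isotopy_move.slide_cap[of i True] D(3,4) in simp_all)
  moreover have "isotopic (u @ ?D3 @ v) (u @ ?D4 @ v)"
    by (rule isotopic_in_context[OF u D(4,5) v]) (use isotopy_move.R2[of "i + 1" False] in simp)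
  ultimately show ?thesis
    by (simp only: append_Cons append_Nil) (blast intro: isotopic_sym isotopic_trans)
qed

lemma isotopic_circle_to_left:
  assumes u: "layers u [] = Some ori" and v: "layers v ori = Some []" and i: "i \<le> length ori"
  shows "isotopic (u @ [(i, Cup b), (i, Cap)] @ v) (u @ [(0, Cup b), (0, Cap)] @ v)"
  using i
proof (induction i)
  case 0
  show ?case using u v by (intro isotopic_refl) (simp add: oriented_link_def layers_append)
next
  case (Suc i)
  have "isotopic (u @ [(Suc i, Cup b), (Suc i, Cap)] @ v) (u @ [(i, Cup b), (i, Cap)] @ v)"
    using isotopic_circle_past_strand[OF u _ v, of i b] Suc.prems by simp
  thus ?case using Suc isotopic_trans by (meson Suc_leD)
qed

lemma isotopic_circle_past_cup:
  assumes u: "layers u [] = Some ori" and j: "layer (j, Cup c) ori = Some ori'" and v: "layers v ori' = Some []"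
  shows "isotopic (u @ [(j, Cup c), (0, Cup b), (0, Cap)] @ v) (u @ [(0, Cup b), (0, Cap), (j, Cup c)] @ v)"
proof -
  have len: "j \<le> length ori" using j by (auto split: if_splits)
  have D: "layers [(0, Cup b), (0, Cap), (j, Cup c)] ori = Some ori'"
    "layers [(0, Cup b), (j + 2, Cup c), (0, Cap)] ori = Some ori'"
    "layers [(j, Cup c), (0, Cup b), (0, Cap)] ori = Some ori'"
    using j len by auto
  have "isotopic (u @ ([(0, Cup b)] @ [(0, Cap), (j, Cup c)] @ []) @ v)
      (u @ ([(0, Cup b)] @ [(j + 2, Cup c), (0, Cap)] @ []) @ v)"
    by (rule isotopic_in_context[OF u _ _ v])
      (use isotopy_move.exchange[of 0 Cap j "Cup c"] D in \<open>simp_all del: layer.simps\<close>)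
  moreover have "isotopic (u @ ([] @ [(0, Cup b), (j + 2, Cup c)] @ [(0, Cap)]) @ v)
      (u @ ([] @ [(j, Cup c), (0, Cup b)] @ [(0, Cap)]) @ v)"
    by (rule isotopic_in_context[OF u _ _ v])
      (use isotopy_move.exchange[of 0 "Cup b" "j + 2" "Cup c"] D in \<open>simp_all del: layer.simps\<close>)
  ultimately show ?thesis
    by (simp only: append_Cons append_Nil) (blast intro: isotopic_sym isotopic_trans)
qed

lemma isotopic_circle_past_cups:
  assumes "layers u [] = Some []" "layers v (braid_state n) = Some []"
  shows "isotopic (u @ cups n @ [(0, Cup b), (0, Cap)] @ v) (u @ [(0, Cup b), (0, Cap)] @ cups n @ v)"
  using assms(2)
proof (induction n arbitrary: v)
  case 0
  thus ?case using assms(1) by (simp add: isotopic_refl oriented_link_def layers_append cups_0)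
next
  case (Suc n)
  have u: "layers (u @ cups n) [] = Some (braid_state n)"
    using assms(1) layers_cups by (simp add: layers_append)
  have l: "layer (n, Cup True) (braid_state n) = Some (braid_state (Suc n))"
    using layers_cups[of "Suc n"] layers_cups[of n] by (cases "layer (n, Cup True) (braid_state n)") (simp_all add: cups_Suc layers_append del: layer.simps replicate.simps)
  have "isotopic ((u @ cups n) @ [(n, Cup True), (0, Cup b), (0, Cap)] @ v)
      ((u @ cups n) @ [(0, Cup b), (0, Cap), (n, Cup True)] @ v)"
    by (rule isotopic_circle_past_cup[OF u l Suc.prems])
  moreover have "isotopic (u @ cups n @ [(0, Cup b), (0, Cap)] @ ([(n, Cup True)] @ v))
      (u @ [(0, Cup b), (0, Cap)] @ cups n @ ([(n, Cup True)] @ v))"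
    by (rule Suc.IH) (simp add: l Suc.prems del: layer.simps replicate.simps)
  ultimately show ?case
    by (simp add: cups_Suc) (blast intro: isotopic_trans)
qed

text \<open>
  The closure of the trivial braid consists of nested circles.  The innermost one slides to the
  left across all strands and then down past the remaining minima.
\<close>

lemma isotopic_trivial_link:
  assumes "layers u [] = Some []"
  shows "isotopic (u @ word_closure n []) (u @ trivial_link n)"
  using assms
proof (induction n arbitrary: u)
  case 0
  thus ?case
    by (simp add: isotopic_refl oriented_link_def word_closure_eq cups_0 caps_0 trivial_link_def)
next
  case (Suc n)
  let ?O = "[(0, Cup True), (0, Cap)]"
  have "isotopic ((u @ cups n) @ [(n, Cup True), (n, Cap)] @ caps n) ((u @ cups n) @ ?O @ caps n)"
    by (rule isotopic_circle_to_left[OF _ layers_caps]) (simp_all add: layers_append Suc.prems layers_cups)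
  moreover have "isotopic (u @ cups n @ ?O @ caps n) (u @ ?O @ cups n @ caps n)"
    by (rule isotopic_circle_past_cups[OF Suc.prems layers_caps])
  moreover have "isotopic ((u @ ?O) @ word_closure n []) ((u @ ?O) @ trivial_link n)"
    by (rule Suc.IH) (simp add: layers_append Suc.prems)
  ultimately show ?case
    by (simp add: word_closure_eq cups_Suc caps_Suc trivial_link_def) (blast intro: isotopic_trans)
qed

section \<open>Kronecker products and traces\<close>

lemma tensor_mat_carrier [simp, intro]:
  "\<lbrakk>A \<in> carrier_mat a b; B \<in> carrier_mat c d\<rbrakk> \<Longrightarrow> A \<otimes>\<^sub>m B \<in> carrier_mat (a * c) (b * d)"
  by (simp add: tensor_mat_def)

lemma dim_tensor_mat [simp]:
  "dim_row (A \<otimes>\<^sub>m B) = dim_row A * dim_row B" "dim_col (A \<otimes>\<^sub>m B) = dim_col A * dim_col B"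
  by (simp_all add: tensor_mat_def)

lemma index_tensor_mat:
  "\<lbrakk>i < dim_row A * dim_row B; j < dim_col A * dim_col B\<rbrakk> \<Longrightarrow>
    (A \<otimes>\<^sub>m B) $$ (i, j) = A $$ (i div dim_row B, j div dim_col B) * B $$ (i mod dim_row B, j mod dim_col B)"
  by (simp add: tensor_mat_def)

lemma div_mod_less_mult:
  fixes i a b :: nat assumes "i < a * b"
  shows "i div b < a" "i mod b < b"
proof -
  have "0 < b" using assms by (cases b) auto
  thus "i mod b < b" by simp
  show "i div b < a" using assms by (simp add: less_mult_imp_div_less)
qed

lemma eq_mult_add_iff: "r < k \<Longrightarrow> i = a * k + r \<longleftrightarrow> i div k = a \<and> i mod k = r" for i a k r :: nat
  using div_mult_mod_eq[of i k] by auto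

lemma sum_div_mod:
  fixes f :: "nat \<Rightarrow> nat \<Rightarrow> 'a::comm_monoid_add"
  shows "(\<Sum>k<a * b. f (k div b) (k mod b)) = (\<Sum>i<a. \<Sum>j<b. f i j)"
proof -
  have "(\<Sum>k<a * b. f (k div b) (k mod b)) = (\<Sum>(i, j)\<in>{..<a} \<times> {..<b}. f i j)"
  proof (rule sum.reindex_bij_witness[where i = "\<lambda>(i, j). i * b + j" and j = "\<lambda>k. (k div b, k mod b)"])
    fix p assume "p \<in> {..<a} \<times> {..<b}"
    then obtain i j where p: "p = (i, j)" "i < a" "j < b" by auto
    have "i * b + j < Suc i * b" using p by simp
    also have "\<dots> \<le> a * b" using p by (intro mult_le_mono1) simp
    finally show "(case p of (i, j) \<Rightarrow> i * b + j) \<in> {..<a * b}" using p by simp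
    show "((case p of (i, j) \<Rightarrow> i * b + j) div b, (case p of (i, j) \<Rightarrow> i * b + j) mod b) = p"
      using p by simp
  qed (auto dest: div_mod_less_mult)
  thus ?thesis by (simp add: sum.cartesian_product)
qed

lemma tensor_mat_mult:
  assumes "A \<in> carrier_mat a b" "C \<in> carrier_mat b c" "B \<in> carrier_mat a' b'" "D \<in> carrier_mat b' c'"
  shows "(A \<otimes>\<^sub>m B) * (C \<otimes>\<^sub>m D) = (A * C) \<otimes>\<^sub>m (B * D)"
proof (rule eq_matI)
  have d: "dim_row A = a" "dim_col A = b" "dim_row C = b" "dim_col C = c" "dim_row B = a'"
    "dim_col B = b'" "dim_row D = b'" "dim_col D = c'" using assms by auto
  fix i j assume "i < dim_row ((A * C) \<otimes>\<^sub>m (B * D))" "j < dim_col ((A * C) \<otimes>\<^sub>m (B * D))"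
  hence ij: "i < a * a'" "j < c * c'" by (simp_all add: d)
  note i = div_mod_less_mult[OF ij(1)] and j = div_mod_less_mult[OF ij(2)]
  have "((A \<otimes>\<^sub>m B) * (C \<otimes>\<^sub>m D)) $$ (i, j) = (\<Sum>k<b * b'. (A \<otimes>\<^sub>m B) $$ (i, k) * (C \<otimes>\<^sub>m D) $$ (k, j))"
    using ij by (simp add: d scalar_prod_def atLeast0LessThan)
  also have "\<dots> = (\<Sum>k<b * b'. (A $$ (i div a', k div b') * C $$ (k div b', j div c')) *
      (B $$ (i mod a', k mod b') * D $$ (k mod b', j mod c')))"
    using ij by (intro sum.cong refl) (simp add: index_tensor_mat d)
  also have "\<dots> = (\<Sum>k<b. \<Sum>l<b'. (A $$ (i div a', k) * C $$ (k, j div c')) * (B $$ (i mod a', l) * D $$ (l, j mod c')))"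
    by (rule sum_div_mod)
  also have "\<dots> = (\<Sum>k<b. A $$ (i div a', k) * C $$ (k, j div c')) * (\<Sum>l<b'. B $$ (i mod a', l) * D $$ (l, j mod c'))"
    by (simp add: sum_product)
  also have "\<dots> = ((A * C) \<otimes>\<^sub>m (B * D)) $$ (i, j)"
    using i j ij by (simp add: index_tensor_mat d scalar_prod_def atLeast0LessThan)
  finally show "((A \<otimes>\<^sub>m B) * (C \<otimes>\<^sub>m D)) $$ (i, j) = ((A * C) \<otimes>\<^sub>m (B * D)) $$ (i, j)" .
qed simp_all

lemma tensor_mat_assoc: "(A \<otimes>\<^sub>m B) \<otimes>\<^sub>m C = A \<otimes>\<^sub>m (B \<otimes>\<^sub>m C)"
proof (rule eq_matI)
  fix i j assume "i < dim_row (A \<otimes>\<^sub>m (B \<otimes>\<^sub>m C))" "j < dim_col (A \<otimes>\<^sub>m (B \<otimes>\<^sub>m C))"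
  hence ij: "i < dim_row A * dim_row B * dim_row C" "j < dim_col A * dim_col B * dim_col C"
    by (simp_all add: mult.assoc)
  hence ij': "i < dim_row A * (dim_row B * dim_row C)" "j < dim_col A * (dim_col B * dim_col C)"
    by (simp_all add: mult.assoc)
  note l = div_mod_less_mult[OF ij(1)] div_mod_less_mult[OF ij(2)] div_mod_less_mult[OF ij'(1)] div_mod_less_mult[OF ij'(2)]
  have dm: "i div (b * c) = i div c div b" "i mod (b * c) mod c = i mod c" for i b c :: nat
    by (simp_all add: div_mult2_eq mult.commute[of b c] mod_mod_cancel)
  have md: "i mod (b * c) div c = i div c mod b" for i b c :: nat
    by (cases "c = 0") (simp_all add: mult.commute[of b c] mod_mult2_eq)
  show "((A \<otimes>\<^sub>m B) \<otimes>\<^sub>m C) $$ (i, j) = (A \<otimes>\<^sub>m (B \<otimes>\<^sub>m C)) $$ (i, j)"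
    using ij ij' l by (simp add: index_tensor_mat dm md mult.assoc)
qed (simp_all add: mult.assoc)

lemma tensor_id_carrier [simp]: "tensor_id d m \<in> carrier_mat (d ^ m) (d ^ m)"
  by (simp add: tensor_id_def)

lemma one_tensor_one: "1\<^sub>m a \<otimes>\<^sub>m 1\<^sub>m b = 1\<^sub>m (a * b)"
proof (rule eq_matI)
  fix i j assume "i < dim_row (1\<^sub>m (a * b) :: complex mat)" "j < dim_col (1\<^sub>m (a * b) :: complex mat)"
  hence ij: "i < a * b" "j < a * b" by simp_all
  have "i = j \<longleftrightarrow> i div b = j div b \<and> i mod b = j mod b" by (metis div_mult_mod_eq)
  thus "(1\<^sub>m a \<otimes>\<^sub>m 1\<^sub>m b) $$ (i, j) = (1\<^sub>m (a * b) :: complex mat) $$ (i, j)"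
    using ij div_mod_less_mult[OF ij(1)] div_mod_less_mult[OF ij(2)] by (simp add: index_tensor_mat)
qed simp_all

lemma tensor_id_add: "tensor_id d a \<otimes>\<^sub>m tensor_id d b = tensor_id d (a + b)"
  by (simp add: tensor_id_def one_tensor_one power_add)

lemma tensor_id_0 [simp]: "tensor_id d 0 = 1\<^sub>m 1"
  by (simp add: tensor_id_def)

lemma tensor_one_right: "A \<otimes>\<^sub>m 1\<^sub>m 1 = A"
  by (auto intro!: eq_matI simp: index_tensor_mat)

lemma tensor_add_left:
  "\<lbrakk>A \<in> carrier_mat a b; B \<in> carrier_mat a b\<rbrakk> \<Longrightarrow> (A + B) \<otimes>\<^sub>m C = A \<otimes>\<^sub>m C + B \<otimes>\<^sub>m C"
  by (rule eq_matI) (auto simp: index_tensor_mat div_mod_less_mult algebra_simps)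

lemma tensor_add_right:
  "\<lbrakk>A \<in> carrier_mat a b; B \<in> carrier_mat a b\<rbrakk> \<Longrightarrow> C \<otimes>\<^sub>m (A + B) = C \<otimes>\<^sub>m A + C \<otimes>\<^sub>m B"
  by (rule eq_matI) (auto simp: index_tensor_mat div_mod_less_mult algebra_simps)

lemma tensor_smult_left: "(c \<cdot>\<^sub>m A) \<otimes>\<^sub>m B = c \<cdot>\<^sub>m (A \<otimes>\<^sub>m B)"
  and tensor_smult_right: "A \<otimes>\<^sub>m (c \<cdot>\<^sub>m B) = c \<cdot>\<^sub>m (A \<otimes>\<^sub>m B)"
  by (rule eq_matI; auto simp: index_tensor_mat div_mod_less_mult)+

lemma tensor_pow_one: "tensor_pow (1\<^sub>m d) n = tensor_id d n"
  by (induction n) (simp_all add: tensor_id_def one_tensor_one)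

lemma mat_trace_add: "\<lbrakk>A \<in> carrier_mat n n; B \<in> carrier_mat n n\<rbrakk> \<Longrightarrow> mat_trace (A + B) = mat_trace A + mat_trace B"
  by (auto simp: mat_trace_def sum.distrib)

lemma mat_trace_smult: "A \<in> carrier_mat n n \<Longrightarrow> mat_trace (c \<cdot>\<^sub>m A) = c * mat_trace A"
  by (auto simp: mat_trace_def sum_distrib_left)

lemma mat_trace_tensor:
  assumes "A \<in> carrier_mat a a" "B \<in> carrier_mat b b"
  shows "mat_trace (A \<otimes>\<^sub>m B) = mat_trace A * mat_trace B"
proof -
  have "mat_trace (A \<otimes>\<^sub>m B) = (\<Sum>i<a * b. A $$ (i div b, i div b) * B $$ (i mod b, i mod b))"
    using assms by (simp add: mat_trace_def index_tensor_mat)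
  also have "\<dots> = mat_trace A * mat_trace B"
    using assms sum_div_mod[of "\<lambda>i j. A $$ (i, i) * B $$ (j, j)" b a] by (simp add: mat_trace_def sum_product)
  finally show ?thesis .
qed

lemma mat_trace_one: "mat_trace (1\<^sub>m n) = of_nat n"
  by (simp add: mat_trace_def)

lemma mat_inv_eq:
  assumes A: "A \<in> carrier_mat n n" and B: "B \<in> carrier_mat n n" and AB: "A * B = 1\<^sub>m n"
  shows "mat_inv A = B"
proof -
  have BA: "B * A = 1\<^sub>m n" using mat_mult_left_right_inverse[OF A B AB] .
  hence "A \<in> Units (ring_mat TYPE(complex) n ())"
    using A B AB by (auto simp: Units_def ring_mat_def)
  then obtain C where C: "mat_inverse A = Some C" using mat_inverse(1)[OF A, where b = "()"] by (cases "mat_inverse A") auto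
  hence "A * C = 1\<^sub>m n" "C \<in> carrier_mat n n" using mat_inverse(2)[OF A C] by auto
  hence "C = (B * A) * C" "B * (A * C) = B" using BA B by simp_all
  hence "C = B" using assoc_mult_mat[OF B A \<open>C \<in> carrier_mat n n\<close>] by simp
  thus ?thesis using C by (simp add: mat_inv_def)
qed

section \<open>Operators and labels of basis vectors\<close>

text \<open>
  The label of a basis vector is a function of its number, in the applications one of its bits.
  Vanishing of traces is always derived from a product in which exactly one factor changes a
  label that the others preserve.
\<close>

definition preserves_label :: "(nat \<Rightarrow> 'b) \<Rightarrow> complex mat \<Rightarrow> bool" where
  "preserves_label g A \<longleftrightarrow> (\<forall>i<dim_row A. \<forall>j<dim_col A. A $$ (i, j) \<noteq> 0 \<longrightarrow> g i = g j)"

definition changes_label :: "(nat \<Rightarrow> 'b) \<Rightarrow> complex mat \<Rightarrow> bool" where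
  "changes_label g A \<longleftrightarrow> (\<forall>i<dim_row A. \<forall>j<dim_col A. A $$ (i, j) \<noteq> 0 \<longrightarrow> g i \<noteq> g j)"

lemma index_mult_nonzero:
  assumes "(A * B) $$ (i, j) \<noteq> (0::complex)" "i < dim_row A" "j < dim_col B" "dim_col A = dim_row B"
  obtains k where "k < dim_row B" "A $$ (i, k) \<noteq> 0" "B $$ (k, j) \<noteq> 0"
proof -
  have "(\<Sum>k<dim_row B. A $$ (i, k) * B $$ (k, j)) \<noteq> 0"
    using assms by (simp add: scalar_prod_def atLeast0LessThan)
  then obtain k where "k < dim_row B" "A $$ (i, k) * B $$ (k, j) \<noteq> 0"
    by (meson lessThan_iff sum.neutral)
  thus ?thesis using that by auto
qed

lemma preserves_label_mult:
  assumes "preserves_label g A" "preserves_label g B" "dim_col A = dim_row B"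
  shows "preserves_label g (A * B)"
  unfolding preserves_label_def
proof (intro allI impI)
  fix i j assume "i < dim_row (A * B)" "j < dim_col (A * B)" "(A * B) $$ (i, j) \<noteq> 0"
  then obtain k where "k < dim_row B" "A $$ (i, k) \<noteq> 0" "B $$ (k, j) \<noteq> 0" "i < dim_row A" "j < dim_col B"
    using assms(3) by (auto simp del: index_mult_mat(1) elim: index_mult_nonzero)
  thus "g i = g j" using assms by (metis preserves_label_def)
qed

lemma changes_label_mult:
  assumes "preserves_label g A \<and> changes_label g B \<or> changes_label g A \<and> preserves_label g B"
    "dim_col A = dim_row B"
  shows "changes_label g (A * B)"
  unfolding changes_label_def
proof (intro allI impI)
  fix i j assume "i < dim_row (A * B)" "j < dim_col (A * B)" "(A * B) $$ (i, j) \<noteq> 0"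
  then obtain k where "k < dim_row B" "A $$ (i, k) \<noteq> 0" "B $$ (k, j) \<noteq> 0" "i < dim_row A" "j < dim_col B"
    using assms(2) by (auto simp del: index_mult_mat(1) elim: index_mult_nonzero)
  thus "g i \<noteq> g j" using assms by (metis preserves_label_def changes_label_def)
qed

lemma mat_trace_changes_label: "\<lbrakk>changes_label g A; dim_row A = dim_col A\<rbrakk> \<Longrightarrow> mat_trace A = 0"
  unfolding changes_label_def mat_trace_def by (auto intro!: sum.neutral)

lemma preserves_label_one: "preserves_label g (1\<^sub>m n)"
  by (auto simp: preserves_label_def)

lemma preserves_label_add:
  assumes "preserves_label g A" "preserves_label g B" "A \<in> carrier_mat a b" "B \<in> carrier_mat a b"
  shows "preserves_label g (A + B)"
  unfolding preserves_label_def
proof (intro allI impI)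
  fix i j assume ij: "i < dim_row (A + B)" "j < dim_col (A + B)" and "(A + B) $$ (i, j) \<noteq> 0"
  hence "A $$ (i, j) \<noteq> 0 \<or> B $$ (i, j) \<noteq> 0" by auto
  thus "g i = g j" using assms ij by (auto simp: preserves_label_def)
qed

lemma preserves_label_smult: "preserves_label g A \<Longrightarrow> preserves_label g (c \<cdot>\<^sub>m A)"
  by (auto simp: preserves_label_def)

lemma preserves_label_tensor_right:
  "\<lbrakk>preserves_label g B; B \<in> carrier_mat n n\<rbrakk> \<Longrightarrow> preserves_label (\<lambda>i. g (i mod n)) (A \<otimes>\<^sub>m B)"
  unfolding preserves_label_def by (auto simp: index_tensor_mat div_mod_less_mult)

lemma changes_label_tensor_right:
  "\<lbrakk>changes_label g B; B \<in> carrier_mat n n\<rbrakk> \<Longrightarrow> changes_label (\<lambda>i. g (i mod n)) (A \<otimes>\<^sub>m B)"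
  unfolding changes_label_def by (auto simp: index_tensor_mat div_mod_less_mult)

lemma preserves_label_tensor_left:
  "\<lbrakk>preserves_label g A; B \<in> carrier_mat n n\<rbrakk> \<Longrightarrow> preserves_label (\<lambda>i. g (i div n)) (A \<otimes>\<^sub>m B)"
  unfolding preserves_label_def by (auto simp: index_tensor_mat div_mod_less_mult)

lemma mat_adjoint_index:
  "\<lbrakk>i < dim_col A; j < dim_row A\<rbrakk> \<Longrightarrow> mat_adjoint A $$ (i, j) = cnj (A $$ (j, i))"
  unfolding mat_adjoint_def by (simp add: mat_of_rows_index)

lemma dim_mat_adjoint: "dim_row (mat_adjoint A) = dim_col A" "dim_col (mat_adjoint A) = dim_row A" for A :: "complex mat"
  by (simp_all add: mat_adjoint_def)

lemma preserves_label_adjoint: "preserves_label g A \<Longrightarrow> preserves_label g (mat_adjoint A)"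
  unfolding preserves_label_def by (auto simp: mat_adjoint_index dim_mat_adjoint)

section \<open>Braid words acting on tensor powers\<close>

lemma gYB_operatorD:
  assumes "gYB_operator d k m R"
  shows "R \<in> carrier_mat (d ^ k) (d ^ k)"
    and "mat_inv R \<in> carrier_mat (d ^ k) (d ^ k)"
    and "R * mat_inv R = 1\<^sub>m (d ^ k)" "mat_inv R * R = 1\<^sub>m (d ^ k)"
proof -
  show R: "R \<in> carrier_mat (d ^ k) (d ^ k)" using assms by (simp add: gYB_operator_def)
  obtain B where B: "inverts_mat R B" "inverts_mat B R"
    using assms by (auto simp: gYB_operator_def invertible_mat_def)
  have Bc: "B \<in> carrier_mat (d ^ k) (d ^ k)"
    using B R unfolding inverts_mat_def
    by (metis carrier_matD carrier_matI index_mult_mat(2,3) index_one_mat(2,3))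
  have RB: "R * B = 1\<^sub>m (d ^ k)" "B * R = 1\<^sub>m (d ^ k)" using B R Bc by (auto simp: inverts_mat_def)
  have "mat_inv R = B" by (rule mat_inv_eq[OF R Bc RB(1)])
  thus "mat_inv R \<in> carrier_mat (d ^ k) (d ^ k)" "R * mat_inv R = 1\<^sub>m (d ^ k)" "mat_inv R * R = 1\<^sub>m (d ^ k)"
    using RB Bc by simp_all
qed

lemma tensor_id_side_carrier:
  assumes "X \<in> carrier_mat (d ^ k) (d ^ k)"
  shows "X \<otimes>\<^sub>m tensor_id d b \<in> carrier_mat (d ^ (k + b)) (d ^ (k + b))"
    and "tensor_id d b \<otimes>\<^sub>m X \<in> carrier_mat (d ^ (k + b)) (d ^ (k + b))"
  unfolding power_add
  using tensor_mat_carrier[OF assms tensor_id_carrier[of d b]] tensor_mat_carrier[OF tensor_id_carrier[of d b] assms]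
  by (simp_all only: mult.commute[of "d ^ b"])

text \<open>
  The identities between gYB operators live on a few tensor factors and are transported by \<open>pad\<close>
  to the operators of longer braids.
\<close>

definition pad :: "nat \<Rightarrow> nat \<Rightarrow> nat \<Rightarrow> complex mat \<Rightarrow> complex mat" where
  "pad d a b X = tensor_id d a \<otimes>\<^sub>m X \<otimes>\<^sub>m tensor_id d b"

lemma pad_carrier:
  "X \<in> carrier_mat (d ^ c) (d ^ c) \<Longrightarrow> pad d a b X \<in> carrier_mat (d ^ (a + c + b)) (d ^ (a + c + b))"
  unfolding pad_def power_add by (intro tensor_mat_carrier tensor_id_carrier)

lemma pad_mult:
  assumes "X \<in> carrier_mat (d ^ c) (d ^ c)" "Y \<in> carrier_mat (d ^ c) (d ^ c)"
  shows "pad d a b X * pad d a b Y = pad d a b (X * Y)"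
proof -
  have "pad d a b X * pad d a b Y =
      ((tensor_id d a \<otimes>\<^sub>m X) * (tensor_id d a \<otimes>\<^sub>m Y)) \<otimes>\<^sub>m (tensor_id d b * tensor_id d b)"
    unfolding pad_def by (rule tensor_mat_mult) (rule tensor_mat_carrier tensor_id_carrier assms)+
  also have "(tensor_id d a \<otimes>\<^sub>m X) * (tensor_id d a \<otimes>\<^sub>m Y) = (tensor_id d a * tensor_id d a) \<otimes>\<^sub>m (X * Y)"
    by (rule tensor_mat_mult) (rule tensor_id_carrier assms)+
  finally show ?thesis by (simp add: pad_def tensor_id_def)
qed

lemma pad_tensor_left: "pad d a b (tensor_id d c \<otimes>\<^sub>m X) = pad d (a + c) b X"
  unfolding pad_def tensor_id_add[symmetric] by (simp add: tensor_mat_assoc)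

lemma pad_tensor_right: "pad d a b (X \<otimes>\<^sub>m tensor_id d c) = pad d a (c + b) X"
  unfolding pad_def tensor_id_add[symmetric] by (simp add: tensor_mat_assoc)

lemma pad_one: "pad d a b (1\<^sub>m (d ^ c)) = 1\<^sub>m (d ^ (a + c + b))"
  by (simp add: pad_def tensor_id_def one_tensor_one power_add)

lemma rho_letter_pad:
  "rho_letter d m R n (i, s) = pad d (m * (i - 1)) (m * (n - i - 1)) (if s then R else mat_inv R)"
  by (simp add: pad_def)

lemma factors_eq:
  "\<lbrakk>1 \<le> i; i < n\<rbrakk> \<Longrightarrow> m * (i - 1) + k + m * (n - i - 1) = factors k m n"
proof -
  assume "1 \<le> i" "i < n"
  then obtain a b where "i = Suc a" "n = Suc (Suc (a + b))"
    by (metis Suc_diff_Suc Suc_le_D less_imp_add_positive add_Suc_right One_nat_def add_Suc less_iff_Suc_add)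
  thus ?thesis by (simp add: factors_def algebra_simps)
qed

declare rho_letter.simps [simp del]

lemma rho_letter_carrier:
  assumes "gYB_operator d k m R" "1 \<le> i" "i < n"
  shows "rho_letter d m R n (i, s) \<in> carrier_mat (d ^ factors k m n) (d ^ factors k m n)"
  unfolding rho_letter_pad factors_eq[OF assms(2,3), of m k, symmetric]
  by (rule pad_carrier) (use gYB_operatorD[OF assms(1)] in simp)

lemma rho_word_Nil: "rho_word d k m R n [] = 1\<^sub>m (d ^ factors k m n)"
  and rho_word_Cons: "rho_word d k m R n (l # w) = rho_letter d m R n l * rho_word d k m R n w"
  by (simp_all add: rho_word_def tensor_id_def)

lemma rho_word_carrier:
  assumes "gYB_operator d k m R" "w \<in> braid_words n"
  shows "rho_word d k m R n w \<in> carrier_mat (d ^ factors k m n) (d ^ factors k m n)"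
  using assms(2)
proof (induction w rule: list.induct)
  case (Cons l w)
  thus ?case
    using rho_letter_carrier[OF assms(1)] by (cases l) (auto simp: rho_word_Cons braid_words_def intro!: mult_carrier_mat)
qed (simp add: rho_word_Nil)

lemma rho_word_append:
  assumes R: "gYB_operator d k m R" and "u \<in> braid_words n" and v: "v \<in> braid_words n"
  shows "rho_word d k m R n (u @ v) = rho_word d k m R n u * rho_word d k m R n v"
  using assms(2)
proof (induction u rule: list.induct)
  case Nil
  thus ?case using rho_word_carrier[OF R v] by (simp add: rho_word_Nil)
next
  case (Cons l u)
  obtain i s where l: "l = (i, s)" by (cases l)
  have u: "u \<in> braid_words n" and i: "1 \<le> i" "i < n" using Cons.prems l by (auto simp: braid_words_def)
  show ?case
    using Cons.IH[OF u] assoc_mult_mat[OF rho_letter_carrier[OF R i] rho_word_carrier[OF R u] rho_word_carrier[OF R v], of s] l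
    by (simp add: rho_word_Cons)
qed

lemma rho_word_single:
  assumes "gYB_operator d k m R" "1 \<le> i" "i < n"
  shows "rho_word d k m R n [(i, s)] = rho_letter d m R n (i, s)"
  using rho_letter_carrier[OF assms, of s] by (simp add: rho_word_Cons rho_word_Nil)

lemma rho_letter_inverse:
  assumes R: "gYB_operator d k m R" and i: "1 \<le> i" "i < n"
  shows "rho_letter d m R n (i, s) * rho_letter d m R n (i, \<not> s) = 1\<^sub>m (d ^ factors k m n)"
  unfolding rho_letter_pad factors_eq[OF i, of m k, symmetric]
  by (subst pad_mult[of _ d k]) (use gYB_operatorD[OF R] in \<open>simp_all add: pad_one\<close>)

text \<open>
  For letters at distance \<open>t\<close> the common identity factors are split off; what remains is the far
  commutation of a gYB operator with \<open>j = t + 2\<close>.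
\<close>

lemma rho_letter_far:
  assumes R: "gYB_operator d k m R" and ij: "1 \<le> i" "i + 2 \<le> j" "j < n"
  shows "rho_letter d m R n (i, True) * rho_letter d m R n (j, True)
    = rho_letter d m R n (j, True) * rho_letter d m R n (i, True)"
proof -
  define t where "t = j - i"
  note Rc = gYB_operatorD(1)[OF R]
  let ?a = "m * (i - 1)" and ?b = "m * (n - j - 1)"
  let ?X = "R \<otimes>\<^sub>m tensor_id d (m * t)" and ?Y = "tensor_id d (m * t) \<otimes>\<^sub>m R"
  have XY: "?X * ?Y = ?Y * ?X"
  proof -
    have "4 \<le> t + 2" using ij by (simp add: t_def)
    hence "(R \<otimes>\<^sub>m tensor_id d (m * (t + 2 - 2))) * (tensor_id d (m * (t + 2 - 2)) \<otimes>\<^sub>m R) =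
        (tensor_id d (m * (t + 2 - 2)) \<otimes>\<^sub>m R) * (R \<otimes>\<^sub>m tensor_id d (m * (t + 2 - 2)))"
      using R unfolding gYB_operator_def by blast
    thus ?thesis by simp
  qed
  have c: "?X \<in> carrier_mat (d ^ (k + m * t)) (d ^ (k + m * t))" "?Y \<in> carrier_mat (d ^ (k + m * t)) (d ^ (k + m * t))"
    by (rule tensor_id_side_carrier[OF Rc])+
  have "n - i - 1 = t + (n - j - 1)" "j - 1 = i - 1 + t" using ij by (simp_all add: t_def)
  hence "rho_letter d m R n (i, True) = pad d ?a ?b ?X" "rho_letter d m R n (j, True) = pad d ?a ?b ?Y"
    unfolding rho_letter_pad pad_tensor_left pad_tensor_right by (simp_all add: distrib_left)
  thus ?thesis by (simp add: pad_mult[OF c] pad_mult[OF c(2,1)] XY)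
qed

lemma rho_letter_braid:
  assumes R: "gYB_operator d k m R" and i: "1 \<le> i" "i + 1 < n"
  shows "rho_letter d m R n (i, True) * rho_letter d m R n (i + 1, True) * rho_letter d m R n (i, True)
    = rho_letter d m R n (i + 1, True) * rho_letter d m R n (i, True) * rho_letter d m R n (i + 1, True)"
proof -
  note Rc = gYB_operatorD(1)[OF R]
  let ?a = "m * (i - 1)" and ?b = "m * (n - i - 2)"
  let ?X = "R \<otimes>\<^sub>m tensor_id d m" and ?Y = "tensor_id d m \<otimes>\<^sub>m R"
  have XY: "?X * ?Y * ?X = ?Y * ?X * ?Y" using R by (simp add: gYB_operator_def)
  have c: "?X \<in> carrier_mat (d ^ (k + m)) (d ^ (k + m))" "?Y \<in> carrier_mat (d ^ (k + m)) (d ^ (k + m))"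
    by (rule tensor_id_side_carrier[OF Rc])+
  have "n - i - 1 = 1 + (n - i - 2)" "i + 1 - 1 = i - 1 + 1" "n - (i + 1) - 1 = n - i - 2" using i by simp_all
  hence "m * (n - i - 1) = m + m * (n - i - 2)" "m * (i + 1 - 1) = m * (i - 1) + m"
    "m * (n - (i + 1) - 1) = m * (n - i - 2)"
    by (simp_all only: distrib_left mult_1_right)
  hence "rho_letter d m R n (i, True) = pad d ?a ?b ?X" "rho_letter d m R n (i + 1, True) = pad d ?a ?b ?Y"
    unfolding rho_letter_pad pad_tensor_left pad_tensor_right by (simp_all only: if_True)
  moreover note pad_mult[OF c] pad_mult[OF c(2,1)] pad_mult[OF mult_carrier_mat[OF c] c(1)]
    pad_mult[OF mult_carrier_mat[OF c(2,1)] c(2)]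
  ultimately show ?thesis by (simp only: XY)
qed

lemma rho_word_relation:
  assumes R: "gYB_operator d k m R" and xy: "braid_relation x y" "x \<in> braid_words n" "y \<in> braid_words n"
  shows "rho_word d k m R n x = rho_word d k m R n y"
  using xy(1)
proof cases
  case (cancel i s)
  hence i: "1 \<le> i" "i < n" using xy by (auto simp: braid_words_def)
  show ?thesis
    using rho_letter_inverse[OF R i, of s] rho_letter_carrier[OF R i, of "\<not> s"] cancel
    by (simp add: rho_word_Cons rho_word_Nil)
next
  case (far i j)
  hence i: "1 \<le> i" "i < n" "1 \<le> j" "j < n" using xy by (auto simp: braid_words_def)
  show ?thesis
    using rho_letter_far[OF R, of i j n] rho_letter_carrier[OF R i(1,2), of True]
      rho_letter_carrier[OF R i(3,4), of True] far i
    by (simp add: rho_word_Cons rho_word_Nil)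
next
  case (braid i)
  hence i: "1 \<le> i" "i < n" "1 \<le> i + 1" "i + 1 < n" using xy by (auto simp: braid_words_def)
  note c = rho_letter_carrier[OF R i(1,2), of True] rho_letter_carrier[OF R i(3,4), of True]
  have "rho_word d k m R n x = rho_letter d m R n (i, True) * rho_letter d m R n (i + 1, True) * rho_letter d m R n (i, True)"
    using c braid by (simp add: rho_word_Cons rho_word_Nil del: add_Suc_right)
  also have "\<dots> = rho_word d k m R n y"
    unfolding rho_letter_braid[OF R i(1,4)]
    using c braid by (simp add: rho_word_Cons rho_word_Nil)
  finally show ?thesis .
qed

lemma rho_word_relation_context:
  assumes R: "gYB_operator d k m R" and xy: "braid_relation x y"
    and w: "u @ x @ v \<in> braid_words n" "u @ y @ v \<in> braid_words n"
  shows "rho_word d k m R n (u @ x @ v) = rho_word d k m R n (u @ y @ v)"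
proof -
  have "u \<in> braid_words n" "v \<in> braid_words n" "x \<in> braid_words n" "y \<in> braid_words n"
    "x @ v \<in> braid_words n" "y @ v \<in> braid_words n"
    using w by (auto simp: braid_words_def)
  thus ?thesis using rho_word_relation[OF R xy] by (simp add: rho_word_append[OF R])
qed

lemma rho_word_extra_strand:
  assumes R: "gYB_operator d k m R" and "w \<in> braid_words n" and n: "1 \<le> n" and mk: "m \<le> k"
  shows "rho_word d k m R (Suc n) w = rho_word d k m R n w \<otimes>\<^sub>m tensor_id d m"
  using assms(2)
proof (induction w rule: list.induct)
  case Nil
  have "factors k m (Suc n) = factors k m n + m" using n mk
    by (cases n) (simp_all add: factors_def algebra_simps)
  thus ?case by (simp add: rho_word_Nil tensor_id_def one_tensor_one power_add)
next
  case (Cons l w)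
  obtain i s where l: "l = (i, s)" by (cases l)
  have w: "w \<in> braid_words n" and i: "1 \<le> i" "i < n" using Cons.prems l by (auto simp: braid_words_def)
  have "Suc n - i - 1 = (n - i - 1) + 1" using i by simp
  hence "m * (Suc n - i - 1) = m * (n - i - 1) + m" by (simp only: distrib_left mult_1_right)
  hence "rho_letter d m R (Suc n) (i, s) = rho_letter d m R n (i, s) \<otimes>\<^sub>m tensor_id d m"
    by (simp only: rho_letter_pad pad_def tensor_id_add[symmetric] tensor_mat_assoc)
  moreover have "(rho_letter d m R n (i, s) \<otimes>\<^sub>m tensor_id d m) * (rho_word d k m R n w \<otimes>\<^sub>m tensor_id d m)
      = (rho_letter d m R n (i, s) * rho_word d k m R n w) \<otimes>\<^sub>m (tensor_id d m * tensor_id d m)"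
    by (rule tensor_mat_mult) (rule rho_letter_carrier[OF R i] rho_word_carrier[OF R w] tensor_id_carrier)+
  ultimately show ?case
    using Cons.IH[OF w] l by (simp add: rho_word_Cons tensor_id_def)
qed

section \<open>The operator of type III\<close>

text \<open>
  With one nonzero entry in every column, identities between products become finite checks of
  row numbers and coefficients.
\<close>

definition monomial_mat :: "nat \<Rightarrow> (nat \<Rightarrow> nat) \<Rightarrow> (nat \<Rightarrow> complex) \<Rightarrow> complex mat" where
  "monomial_mat N \<pi> \<phi> = mat N N (\<lambda>(i, j). if i = \<pi> j then \<phi> j else 0)"

lemma monomial_mat_carrier [simp]: "monomial_mat N \<pi> \<phi> \<in> carrier_mat N N"
  and dim_monomial_mat [simp]: "dim_row (monomial_mat N \<pi> \<phi>) = N" "dim_col (monomial_mat N \<pi> \<phi>) = N"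
  by (simp_all add: monomial_mat_def)

lemma monomial_mat_cong:
  "(\<And>j. j < N \<Longrightarrow> \<pi> j = \<pi>' j \<and> \<phi> j = \<phi>' j) \<Longrightarrow> monomial_mat N \<pi> \<phi> = monomial_mat N \<pi>' \<phi>'"
  by (rule eq_matI) (auto simp: monomial_mat_def)

lemma monomial_mat_mult:
  assumes "\<And>j. j < N \<Longrightarrow> \<pi>' j < N"
  shows "monomial_mat N \<pi> \<phi> * monomial_mat N \<pi>' \<phi>' = monomial_mat N (\<lambda>j. \<pi> (\<pi>' j)) (\<lambda>j. \<phi> (\<pi>' j) * \<phi>' j)"
proof (rule eq_matI)
  fix i j assume ij: "i < dim_row (monomial_mat N (\<lambda>j. \<pi> (\<pi>' j)) (\<lambda>j. \<phi> (\<pi>' j) * \<phi>' j))"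
    "j < dim_col (monomial_mat N (\<lambda>j. \<pi> (\<pi>' j)) (\<lambda>j. \<phi> (\<pi>' j) * \<phi>' j))"
  hence "(monomial_mat N \<pi> \<phi> * monomial_mat N \<pi>' \<phi>') $$ (i, j)
      = (\<Sum>k<N. (if i = \<pi> k then \<phi> k else 0) * (if k = \<pi>' j then \<phi>' j else 0))"
    by (simp add: monomial_mat_def scalar_prod_def atLeast0LessThan)
  also have "\<dots> = (\<Sum>k<N. if k = \<pi>' j then (if i = \<pi> k then \<phi> k else 0) * \<phi>' j else 0)"
    by (intro sum.cong) auto
  also have "\<dots> = (if i = \<pi> (\<pi>' j) then \<phi> (\<pi>' j) else 0) * \<phi>' j"
    using assms[of j] ij by simp
  finally show "(monomial_mat N \<pi> \<phi> * monomial_mat N \<pi>' \<phi>') $$ (i, j)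
      = monomial_mat N (\<lambda>j. \<pi> (\<pi>' j)) (\<lambda>j. \<phi> (\<pi>' j) * \<phi>' j) $$ (i, j)"
    using ij by (simp add: monomial_mat_def)
qed simp_all

lemma monomial_mat_tensor_one:
  "monomial_mat N \<pi> \<phi> \<otimes>\<^sub>m 1\<^sub>m k = monomial_mat (N * k) (\<lambda>j. \<pi> (j div k) * k + j mod k) (\<lambda>j. \<phi> (j div k))"
proof (rule eq_matI)
  fix i j assume ij: "i < dim_row (monomial_mat (N * k) (\<lambda>j. \<pi> (j div k) * k + j mod k) (\<lambda>j. \<phi> (j div k)))"
    "j < dim_col (monomial_mat (N * k) (\<lambda>j. \<pi> (j div k) * k + j mod k) (\<lambda>j. \<phi> (j div k)))"
  have "i = \<pi> (j div k) * k + j mod k \<longleftrightarrow> i div k = \<pi> (j div k) \<and> i mod k = j mod k"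
    by (rule eq_mult_add_iff) (use ij div_mod_less_mult(2) in simp)
  thus "(monomial_mat N \<pi> \<phi> \<otimes>\<^sub>m 1\<^sub>m k) $$ (i, j)
      = monomial_mat (N * k) (\<lambda>j. \<pi> (j div k) * k + j mod k) (\<lambda>j. \<phi> (j div k)) $$ (i, j)"
    using ij by (simp add: index_tensor_mat monomial_mat_def div_mod_less_mult)
qed (simp_all add: monomial_mat_def)

lemma one_tensor_monomial_mat:
  assumes "\<And>j. j < N \<Longrightarrow> \<pi> j < N"
  shows "1\<^sub>m k \<otimes>\<^sub>m monomial_mat N \<pi> \<phi> = monomial_mat (k * N) (\<lambda>j. j div N * N + \<pi> (j mod N)) (\<lambda>j. \<phi> (j mod N))"
proof (rule eq_matI)
  fix i j assume ij: "i < dim_row (monomial_mat (k * N) (\<lambda>j. j div N * N + \<pi> (j mod N)) (\<lambda>j. \<phi> (j mod N)))"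
    "j < dim_col (monomial_mat (k * N) (\<lambda>j. j div N * N + \<pi> (j mod N)) (\<lambda>j. \<phi> (j mod N)))"
  hence "\<pi> (j mod N) < N" using assms div_mod_less_mult(2) by simp
  hence "i = j div N * N + \<pi> (j mod N) \<longleftrightarrow> i div N = j div N \<and> i mod N = \<pi> (j mod N)"
    by (rule eq_mult_add_iff)
  thus "(1\<^sub>m k \<otimes>\<^sub>m monomial_mat N \<pi> \<phi>) $$ (i, j)
      = monomial_mat (k * N) (\<lambda>j. j div N * N + \<pi> (j mod N)) (\<lambda>j. \<phi> (j mod N)) $$ (i, j)"
    using ij by (simp add: index_tensor_mat monomial_mat_def div_mod_less_mult)
qed (simp_all add: monomial_mat_def)

text \<open>
  Number \<open>j = 4 a + 2 b + c\<close> is the basis vector with bits \<open>a\<close>, \<open>b\<close>, \<open>c\<close>, and \<open>b\<close> is flipped.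
\<close>

definition flip_perm :: "nat \<Rightarrow> nat" where
  "flip_perm j = [2, 3, 0, 1, 6, 7, 4, 5] ! j"

text \<open>
  With \<open>j = 4 a + 2 b + c\<close> this is \<open>- ((-1) ^ (a + b)) * q ^ ((2 b - 1) (a + c))\<close>; in \<open>R_III \<theta>\<close> the
  number \<open>q\<close> is \<open>exp (\<i> \<theta>)\<close>.
\<close>

definition flip_phase :: "complex \<Rightarrow> nat \<Rightarrow> complex" where
  "flip_phase q j = [- 1, - inverse q, 1, q, inverse q, inverse q ^ 2, - q, - (q ^ 2)] ! j"

definition flip_mat :: "complex \<Rightarrow> complex mat" where
  "flip_mat q = monomial_mat 8 flip_perm (flip_phase q)"

lemma flip_perm_less: "j < 8 \<Longrightarrow> flip_perm j < 8"
proof -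
  have "\<forall>j\<in>{..<8::nat}. flip_perm j < 8" by (simp add: lessThan_nat_numeral lessThan_Suc flip_perm_def)
  thus "j < 8 \<Longrightarrow> flip_perm j < 8" by simp
qed

lemma flip_mat_carrier [simp]: "flip_mat q \<in> carrier_mat 8 8"
  by (simp add: flip_mat_def)

lemma flip_mat_square:
  assumes "q \<noteq> 0"
  shows "flip_mat q * flip_mat q = - 1\<^sub>m 8"
proof -
  have "\<forall>j\<in>{..<8::nat}. flip_perm (flip_perm j) = j \<and> flip_phase q (flip_perm j) * flip_phase q j = - 1"
    using assms by (simp add: lessThan_nat_numeral lessThan_Suc flip_perm_def flip_phase_def power_mult_distrib[symmetric])
  hence "flip_mat q * flip_mat q = monomial_mat 8 (\<lambda>j. j) (\<lambda>j. - 1)"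
    unfolding flip_mat_def
    by (subst monomial_mat_mult[OF flip_perm_less]) (auto intro!: monomial_mat_cong)
  also have "\<dots> = - 1\<^sub>m 8" by (rule eq_matI) (auto simp: monomial_mat_def)
  finally show ?thesis .
qed

text \<open>
  The bit flipped by the left operator determines, as bit \<open>a\<close>, a sign of the right operator, which
  is why the two orders differ by \<open>- 1\<close>.  The powers of \<open>q\<close> agree in both orders.
\<close>

lemma flip_mat_anticommute:
  assumes "q \<noteq> 0"
  shows "(flip_mat q \<otimes>\<^sub>m 1\<^sub>m 2) * (1\<^sub>m 2 \<otimes>\<^sub>m flip_mat q) = - ((1\<^sub>m 2 \<otimes>\<^sub>m flip_mat q) * (flip_mat q \<otimes>\<^sub>m 1\<^sub>m 2))"
proof -
  let ?l = "\<lambda>j. flip_perm (j div 2) * 2 + j mod 2" and ?r = "\<lambda>j. j div 8 * 8 + flip_perm (j mod 8)"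
  have l: "flip_mat q \<otimes>\<^sub>m 1\<^sub>m 2 = monomial_mat 16 ?l (\<lambda>j. flip_phase q (j div 2))"
    unfolding flip_mat_def monomial_mat_tensor_one by simp
  have r: "1\<^sub>m 2 \<otimes>\<^sub>m flip_mat q = monomial_mat 16 ?r (\<lambda>j. flip_phase q (j mod 8))"
    unfolding flip_mat_def by (subst one_tensor_monomial_mat[OF flip_perm_less]) simp_all
  have "\<forall>j\<in>{..<16::nat}. ?l j < 16 \<and> ?r j < 16 \<and> ?l (?r j) = ?r (?l j) \<and>
      flip_phase q (?r j div 2) * flip_phase q (j mod 8) = - (flip_phase q (?l j mod 8) * flip_phase q (j div 2))"
    using assms by (simp add: lessThan_nat_numeral lessThan_Suc flip_perm_def flip_phase_def field_simps power2_eq_square)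
  hence *: "\<And>j. j < 16 \<Longrightarrow> ?l j < 16" "\<And>j. j < 16 \<Longrightarrow> ?r j < 16" "\<And>j. j < 16 \<Longrightarrow> ?l (?r j) = ?r (?l j)"
    "\<And>j. j < 16 \<Longrightarrow> flip_phase q (?r j div 2) * flip_phase q (j mod 8) = - (flip_phase q (?l j mod 8) * flip_phase q (j div 2))"
    by simp_all
  have "monomial_mat 16 (\<lambda>j. ?l (?r j)) (\<lambda>j. flip_phase q (?r j div 2) * flip_phase q (j mod 8))
      = monomial_mat 16 (\<lambda>j. ?r (?l j)) (\<lambda>j. - (flip_phase q (?l j mod 8) * flip_phase q (j div 2)))"
    by (rule monomial_mat_cong) (use *(3,4) in blast)
  also have "\<dots> = - monomial_mat 16 (\<lambda>j. ?r (?l j)) (\<lambda>j. flip_phase q (?l j mod 8) * flip_phase q (j div 2))"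
    by (rule eq_matI) (auto simp: monomial_mat_def)
  finally show ?thesis
    unfolding l r by (simp only: monomial_mat_mult[OF *(1)] monomial_mat_mult[OF *(2)])
qed

text \<open>
  The operators share one bit, which neither of them flips.
\<close>

lemma flip_mat_far:
  assumes "q \<noteq> 0"
  shows "(flip_mat q \<otimes>\<^sub>m 1\<^sub>m 4) * (1\<^sub>m 4 \<otimes>\<^sub>m flip_mat q) = (1\<^sub>m 4 \<otimes>\<^sub>m flip_mat q) * (flip_mat q \<otimes>\<^sub>m 1\<^sub>m 4)"
proof -
  let ?l = "\<lambda>j. flip_perm (j div 4) * 4 + j mod 4" and ?r = "\<lambda>j. j div 8 * 8 + flip_perm (j mod 8)"
  have l: "flip_mat q \<otimes>\<^sub>m 1\<^sub>m 4 = monomial_mat 32 ?l (\<lambda>j. flip_phase q (j div 4))"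
    unfolding flip_mat_def monomial_mat_tensor_one by simp
  have r: "1\<^sub>m 4 \<otimes>\<^sub>m flip_mat q = monomial_mat 32 ?r (\<lambda>j. flip_phase q (j mod 8))"
    unfolding flip_mat_def by (subst one_tensor_monomial_mat[OF flip_perm_less]) simp_all
  have "\<forall>j\<in>{..<32::nat}. ?l j < 32 \<and> ?r j < 32 \<and> ?l (?r j) = ?r (?l j) \<and>
      flip_phase q (?r j div 4) * flip_phase q (j mod 8) = flip_phase q (?l j mod 8) * flip_phase q (j div 4)"
    using assms by (simp add: lessThan_nat_numeral lessThan_Suc flip_perm_def flip_phase_def field_simps power2_eq_square)
  hence *: "\<And>j. j < 32 \<Longrightarrow> ?l j < 32" "\<And>j. j < 32 \<Longrightarrow> ?r j < 32" "\<And>j. j < 32 \<Longrightarrow> ?l (?r j) = ?r (?l j)"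
    "\<And>j. j < 32 \<Longrightarrow> flip_phase q (?r j div 4) * flip_phase q (j mod 8) = flip_phase q (?l j mod 8) * flip_phase q (j div 4)"
    by simp_all
  have "monomial_mat 32 (\<lambda>j. ?l (?r j)) (\<lambda>j. flip_phase q (?r j div 4) * flip_phase q (j mod 8))
      = monomial_mat 32 (\<lambda>j. ?r (?l j)) (\<lambda>j. flip_phase q (?l j mod 8) * flip_phase q (j div 4))"
    by (rule monomial_mat_cong) (use *(3,4) in blast)
  thus ?thesis
    unfolding l r by (simp only: monomial_mat_mult[OF *(1)] monomial_mat_mult[OF *(2)])
qed

lemma R_III_eq:
  "R_III \<theta> = complex_of_real (1 / sqrt 2) \<cdot>\<^sub>m (1\<^sub>m 8 + flip_mat (exp (\<i> * complex_of_real \<theta>)))"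
proof (rule eq_matI)
  define q where "q = exp (\<i> * complex_of_real \<theta>)"
  have e: "exp (\<i> * complex_of_real (- \<theta>)) = inverse q" "exp (\<i> * complex_of_real (2 * \<theta>)) = q ^ 2"
    "exp (\<i> * complex_of_real (- 2 * \<theta>)) = inverse q ^ 2"
    unfolding q_def by (simp_all add: exp_minus exp_double[symmetric] power_inverse mult.left_commute[of \<i> 2]
        exp_minus[of "2 * (\<i> * complex_of_real \<theta>)", simplified])
  have dims: "dim_row (R_III \<theta>) = 8" "dim_col (R_III \<theta>) = 8"
    by (simp_all add: R_III_def Let_def mat_of_rows_list_def)
  show "dim_row (R_III \<theta>) = dim_row (complex_of_real (1 / sqrt 2) \<cdot>\<^sub>m (1\<^sub>m 8 + flip_mat (exp (\<i> * complex_of_real \<theta>))))"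
    "dim_col (R_III \<theta>) = dim_col (complex_of_real (1 / sqrt 2) \<cdot>\<^sub>m (1\<^sub>m 8 + flip_mat (exp (\<i> * complex_of_real \<theta>))))"
    by (simp_all add: dims flip_mat_def)
  have "\<forall>i\<in>{..<8::nat}. \<forall>j\<in>{..<8::nat}. R_III \<theta> $$ (i, j) = (complex_of_real (1 / sqrt 2) \<cdot>\<^sub>m (1\<^sub>m 8 + flip_mat q)) $$ (i, j)"
    unfolding R_III_def Let_def q_def[symmetric] e
    by (simp add: lessThan_nat_numeral lessThan_Suc mat_of_rows_list_def flip_mat_def monomial_mat_def
        flip_perm_def flip_phase_def)
  thus "R_III \<theta> $$ (i, j) = (complex_of_real (1 / sqrt 2) \<cdot>\<^sub>m (1\<^sub>m 8 + flip_mat (exp (\<i> * complex_of_real \<theta>)))) $$ (i, j)"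
    if "i < dim_row (complex_of_real (1 / sqrt 2) \<cdot>\<^sub>m (1\<^sub>m 8 + flip_mat (exp (\<i> * complex_of_real \<theta>))))"
      "j < dim_col (complex_of_real (1 / sqrt 2) \<cdot>\<^sub>m (1\<^sub>m 8 + flip_mat (exp (\<i> * complex_of_real \<theta>))))" for i j
    using that by (simp add: q_def flip_mat_def)
qed

text \<open>
  Both sides equal \<open>2 P + 2 Q\<close>.
\<close>

lemma anticommuting_units_braid:
  fixes P Q :: "'a :: comm_ring_1 mat"
  assumes P: "P \<in> carrier_mat N N" and Q: "Q \<in> carrier_mat N N"
    and P2: "P * P = - 1\<^sub>m N" and Q2: "Q * Q = - 1\<^sub>m N" and anti: "P * Q = - (Q * P)"
  shows "(1\<^sub>m N + P) * (1\<^sub>m N + Q) * (1\<^sub>m N + P) = (1\<^sub>m N + Q) * (1\<^sub>m N + P) * (1\<^sub>m N + Q)"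
proof -
  have key: "(1\<^sub>m N + P) * (1\<^sub>m N + Q) * (1\<^sub>m N + P) = P + P + Q + Q"
    if P: "P \<in> carrier_mat N N" and Q: "Q \<in> carrier_mat N N"
      and P2: "P * P = - 1\<^sub>m N" and anti: "P * Q = - (Q * P)" for P Q :: "'a mat"
  proof -
    have QP: "Q * P \<in> carrier_mat N N" using P Q by simp
    have "P * Q * P = - (Q * (P * P))" unfolding anti using P Q by simp
    also have "\<dots> = Q" unfolding P2 using Q by simp
    finally have PQP: "P * Q * P = Q" .
    have 1: "(1\<^sub>m N + P) * (1\<^sub>m N + Q) = 1\<^sub>m N + P + (Q + P * Q)"
      using P Q by (simp add: add_mult_distrib_mat[of _ N N _ _ N] mult_add_distrib_mat[of _ N N _ N])
    have "(1\<^sub>m N + P + (Q + P * Q)) * (1\<^sub>m N + P)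
        = 1\<^sub>m N + P + (Q + P * Q) + (P + P * P + (Q * P + P * Q * P))"
      using P Q by (simp add: add_mult_distrib_mat[of _ N N _ _ N] mult_add_distrib_mat[of _ N N _ N])
    also have "\<dots> = P + P + Q + Q"
      unfolding PQP unfolding P2 anti using P Q QP by (intro eq_matI) (auto simp del: index_mult_mat(1))
    finally show ?thesis unfolding 1 .
  qed
  have anti': "Q * P = - (P * Q)" unfolding anti using P Q by simp
  show ?thesis
    unfolding key[OF P Q P2 anti] key[OF Q P Q2 anti'] using P Q by (intro eq_matI) auto
qed

lemma one_add_commute:
  fixes P Q :: "'a :: comm_ring_1 mat"
  assumes "P \<in> carrier_mat N N" "Q \<in> carrier_mat N N" "P * Q = Q * P"
  shows "(1\<^sub>m N + P) * (1\<^sub>m N + Q) = (1\<^sub>m N + Q) * (1\<^sub>m N + P)"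
proof -
  have "(1\<^sub>m N + P) * (1\<^sub>m N + Q) = 1\<^sub>m N + P + (Q + P * Q)"
    using assms(1,2) by (simp add: add_mult_distrib_mat[of _ N N _ _ N] mult_add_distrib_mat[of _ N N _ N])
  also have "\<dots> = 1\<^sub>m N + Q + (P + Q * P)"
    unfolding assms(3) using assms(1,2) by (intro eq_matI) (auto simp del: index_mult_mat(1))
  also have "\<dots> = (1\<^sub>m N + Q) * (1\<^sub>m N + P)"
    using assms(1,2) by (simp add: add_mult_distrib_mat[of _ N N _ _ N] mult_add_distrib_mat[of _ N N _ N])
  finally show ?thesis .
qed

lemma smult_smult_mat: "c \<cdot>\<^sub>m (d \<cdot>\<^sub>m A) = (c * d) \<cdot>\<^sub>m A" for A :: "'a :: semigroup_mult mat"
  by (rule eq_matI) (auto simp: mult.assoc)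

lemma smult_mult_smult_mat:
  fixes A B :: "'a :: comm_ring_1 mat"
  assumes "A \<in> carrier_mat n n" "B \<in> carrier_mat n n"
  shows "(c \<cdot>\<^sub>m A) * (d \<cdot>\<^sub>m B) = (c * d) \<cdot>\<^sub>m (A * B)"
  using assms by (simp add: mult_smult_assoc_mat[of _ n n _ n] mult_smult_distrib[of _ n n _ n] smult_smult_mat mult.commute)

lemma uminus_eq_smult_mat: "- A = (- 1) \<cdot>\<^sub>m A" for A :: "'a :: ring_1 mat"
  by (rule eq_matI) auto

text \<open>
  If \<open>Y\<^sup>2 = - 1\<close>, this is \<open>exp (\<pi> Y / 4)\<close>, the rotation by an eighth of a full turn in the planes of the
  complex structure \<open>Y\<close>.
\<close>

definition eighth_turn :: "complex mat \<Rightarrow> complex mat" where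
  "eighth_turn Y = complex_of_real (1 / sqrt 2) \<cdot>\<^sub>m (1\<^sub>m (dim_row Y) + Y)"

lemma eighth_turn_carrier [simp]: "Y \<in> carrier_mat N N \<Longrightarrow> eighth_turn Y \<in> carrier_mat N N"
  by (simp add: eighth_turn_def)

lemma eighth_turn_tensor:
  assumes "Y \<in> carrier_mat N N"
  shows "eighth_turn Y \<otimes>\<^sub>m 1\<^sub>m k = eighth_turn (Y \<otimes>\<^sub>m 1\<^sub>m k)" "1\<^sub>m k \<otimes>\<^sub>m eighth_turn Y = eighth_turn (1\<^sub>m k \<otimes>\<^sub>m Y)"
  using assms
  by (simp_all add: eighth_turn_def tensor_smult_left tensor_smult_right tensor_add_left[of _ N N]
      tensor_add_right[of _ N N] one_tensor_one)

lemma eighth_turn_inverse: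
  assumes Y: "Y \<in> carrier_mat N N" and Y2: "Y * Y = - 1\<^sub>m N"
  shows "eighth_turn Y * eighth_turn (- Y) = 1\<^sub>m N"
proof -
  let ?c = "complex_of_real (1 / sqrt 2)"
  have c: "?c * ?c = 1 / 2" by (simp add: of_real_mult[symmetric] del: of_real_mult)
  have "(1\<^sub>m N + Y) * (1\<^sub>m N + - Y) = 1\<^sub>m N + Y + - (Y + Y * Y)"
    using Y by (simp add: add_mult_distrib_mat[of _ N N _ _ N] mult_add_distrib_mat[of _ N N _ N])
  also have "\<dots> = 2 \<cdot>\<^sub>m 1\<^sub>m N" unfolding Y2 using Y by (intro eq_matI) auto
  finally have *: "(1\<^sub>m N + Y) * (1\<^sub>m N + - Y) = 2 \<cdot>\<^sub>m 1\<^sub>m N" .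
  have "eighth_turn Y * eighth_turn (- Y) = (?c * ?c) \<cdot>\<^sub>m ((1\<^sub>m N + Y) * (1\<^sub>m N + - Y))"
    using Y by (simp add: eighth_turn_def mult_smult_assoc_mat[of _ N N _ N] mult_smult_distrib[of _ N N _ N] smult_smult_mat)
  thus ?thesis unfolding * c by (intro eq_matI) auto
qed

lemma eighth_turn_braid:
  assumes P: "P \<in> carrier_mat N N" and Q: "Q \<in> carrier_mat N N"
    and "P * P = - 1\<^sub>m N" "Q * Q = - 1\<^sub>m N" "P * Q = - (Q * P)"
  shows "eighth_turn P * eighth_turn Q * eighth_turn P = eighth_turn Q * eighth_turn P * eighth_turn Q"
proof -
  let ?c = "complex_of_real (1 / sqrt 2)"
  have *: "eighth_turn P * eighth_turn Q * eighth_turn P = (?c * ?c * ?c) \<cdot>\<^sub>m ((1\<^sub>m N + P) * (1\<^sub>m N + Q) * (1\<^sub>m N + P))"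
    if P: "P \<in> carrier_mat N N" and Q: "Q \<in> carrier_mat N N" for P Q
  proof -
    have c: "1\<^sub>m N + P \<in> carrier_mat N N" "1\<^sub>m N + Q \<in> carrier_mat N N" using P Q by simp_all
    have h: "eighth_turn P = ?c \<cdot>\<^sub>m (1\<^sub>m N + P)" "eighth_turn Q = ?c \<cdot>\<^sub>m (1\<^sub>m N + Q)" using P Q by (simp_all add: eighth_turn_def)
    show ?thesis
      unfolding h smult_mult_smult_mat[OF c] smult_mult_smult_mat[OF mult_carrier_mat[OF c] c(1)] ..
  qed
  show ?thesis unfolding *[OF P Q] *[OF Q P] anticommuting_units_braid[OF assms] ..
qed

lemma eighth_turn_commute:
  assumes P: "P \<in> carrier_mat N N" and Q: "Q \<in> carrier_mat N N" and "P * Q = Q * P"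
  shows "eighth_turn P * eighth_turn Q = eighth_turn Q * eighth_turn P"
proof -
  let ?c = "complex_of_real (1 / sqrt 2)"
  have *: "eighth_turn P * eighth_turn Q = (?c * ?c) \<cdot>\<^sub>m ((1\<^sub>m N + P) * (1\<^sub>m N + Q))"
    if P: "P \<in> carrier_mat N N" and Q: "Q \<in> carrier_mat N N" for P Q
    using that by (simp add: eighth_turn_def mult_smult_assoc_mat[of _ N N _ N] mult_smult_distrib[of _ N N _ N] smult_smult_mat)
  show ?thesis unfolding *[OF P Q] *[OF Q P] one_add_commute[OF assms] ..
qed

lemma R_III_eighth_turn: "R_III \<theta> = eighth_turn (flip_mat (exp (\<i> * complex_of_real \<theta>)))"
  by (simp add: R_III_eq eighth_turn_def flip_mat_def)

text \<open>
  The braid relation follows from anticommutation.  In the far commutation relations the two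
  operators overlap in one bit for \<open>j = 4\<close> and act on disjoint bits for \<open>j \<ge> 5\<close>.
\<close>

lemma gYB_eighth_turn_flip_mat:
  assumes q: "q \<noteq> 0"
  shows "gYB_operator 2 3 1 (eighth_turn (flip_mat q))"
proof -
  let ?Y = "flip_mat q"
  let ?R = "eighth_turn ?Y"
  have Yc: "?Y \<in> carrier_mat 8 8" by simp
  have Rc: "?R \<in> carrier_mat 8 8" by simp
  note Y2 = flip_mat_square[OF q]
  have inv: "?R * eighth_turn (- ?Y) = 1\<^sub>m 8" by (rule eighth_turn_inverse[OF Yc Y2])
  have "eighth_turn (- ?Y) * ?R = 1\<^sub>m 8"
    by (rule mat_mult_left_right_inverse[OF Rc _ inv]) simp
  hence "invertible_mat ?R"
    using inv Rc unfolding invertible_mat_def inverts_mat_def by (intro conjI exI[of _ "eighth_turn (- ?Y)"]) (auto simp: eighth_turn_def flip_mat_def)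
  moreover have "(?R \<otimes>\<^sub>m tensor_id 2 1) * (tensor_id 2 1 \<otimes>\<^sub>m ?R) * (?R \<otimes>\<^sub>m tensor_id 2 1)
      = (tensor_id 2 1 \<otimes>\<^sub>m ?R) * (?R \<otimes>\<^sub>m tensor_id 2 1) * (tensor_id 2 1 \<otimes>\<^sub>m ?R)"
  proof -
    let ?P = "?Y \<otimes>\<^sub>m 1\<^sub>m 2" and ?Q = "1\<^sub>m 2 \<otimes>\<^sub>m ?Y"
    have c: "?P \<in> carrier_mat 16 16" "?Q \<in> carrier_mat 16 16"
      using tensor_mat_carrier[OF Yc one_carrier_mat[of 2]] tensor_mat_carrier[OF one_carrier_mat[of 2] Yc] by simp_all
    have m: "- 1\<^sub>m 8 \<otimes>\<^sub>m 1\<^sub>m 2 = - (1\<^sub>m 16 :: complex mat)" "1\<^sub>m 2 \<otimes>\<^sub>m - 1\<^sub>m 8 = - (1\<^sub>m 16 :: complex mat)"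
      using tensor_smult_left[of "- 1" "1\<^sub>m 8" "1\<^sub>m 2"] tensor_smult_right[of "1\<^sub>m 2" "- 1" "1\<^sub>m 8"]
      by (simp_all add: one_tensor_one uminus_eq_smult_mat)
    have "?P * ?P = - 1\<^sub>m 16" "?Q * ?Q = - 1\<^sub>m 16"
      using tensor_mat_mult[OF Yc Yc one_carrier_mat one_carrier_mat, of 2]
        tensor_mat_mult[OF one_carrier_mat one_carrier_mat Yc Yc, of 2] m by (simp_all add: Y2)
    thus ?thesis
      using eighth_turn_braid[OF c _ _ flip_mat_anticommute[OF q]] by (simp add: tensor_id_def eighth_turn_tensor[OF Yc])
  qed
  moreover have "(?R \<otimes>\<^sub>m tensor_id 2 (1 * (j - 2))) * (tensor_id 2 (1 * (j - 2)) \<otimes>\<^sub>m ?R)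
      = (tensor_id 2 (1 * (j - 2)) \<otimes>\<^sub>m ?R) * (?R \<otimes>\<^sub>m tensor_id 2 (1 * (j - 2)))" if j: "4 \<le> j" for j
  proof (cases "j = 4")
    case True
    have c: "?Y \<otimes>\<^sub>m 1\<^sub>m 4 \<in> carrier_mat 32 32" "1\<^sub>m 4 \<otimes>\<^sub>m ?Y \<in> carrier_mat 32 32"
      using tensor_mat_carrier[OF Yc one_carrier_mat[of 4]] tensor_mat_carrier[OF one_carrier_mat[of 4] Yc] by simp_all
    show ?thesis
      using eighth_turn_commute[OF c flip_mat_far[OF q]] True by (simp add: tensor_id_def eighth_turn_tensor[OF Yc])
  next
    case False
    define t where "t = j - 5"
    have t: "1 * (j - 2) = 3 + t" "1 * (j - 2) = t + 3" using j False by (simp_all add: t_def)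
    let ?I = "tensor_id 2 t" and ?J = "tensor_id 2 3"
    have J: "?J \<in> carrier_mat 8 8" and I: "?I \<in> carrier_mat (2 ^ t) (2 ^ t)"
      using tensor_id_carrier[of 2 3] by simp_all
    have "(?R \<otimes>\<^sub>m tensor_id 2 (t + 3)) = (?R \<otimes>\<^sub>m ?I) \<otimes>\<^sub>m ?J" "(tensor_id 2 (3 + t) \<otimes>\<^sub>m ?R) = (?J \<otimes>\<^sub>m ?I) \<otimes>\<^sub>m ?R"
      by (simp_all only: tensor_id_add[symmetric] tensor_mat_assoc)
    moreover have "((?R \<otimes>\<^sub>m ?I) \<otimes>\<^sub>m ?J) * ((?J \<otimes>\<^sub>m ?I) \<otimes>\<^sub>m ?R) = ((?R * ?J) \<otimes>\<^sub>m (?I * ?I)) \<otimes>\<^sub>m (?J * ?R)"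
      using tensor_mat_mult[OF tensor_mat_carrier[OF Rc I] tensor_mat_carrier[OF J I] J Rc] tensor_mat_mult[OF Rc J I I] by simp
    moreover have "((?J \<otimes>\<^sub>m ?I) \<otimes>\<^sub>m ?R) * ((?R \<otimes>\<^sub>m ?I) \<otimes>\<^sub>m ?J) = ((?J * ?R) \<otimes>\<^sub>m (?I * ?I)) \<otimes>\<^sub>m (?R * ?J)"
      using tensor_mat_mult[OF tensor_mat_carrier[OF J I] tensor_mat_carrier[OF Rc I] Rc J] tensor_mat_mult[OF J Rc I I] by simp
    moreover have "?R * ?J = ?R" "?J * ?R = ?R"
      using right_mult_one_mat[OF Rc] left_mult_one_mat[OF Rc] by (simp_all add: tensor_id_def)
    ultimately show ?thesis by (simp only: t(1)) (simp only: t[symmetric] add.commute)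
  qed
  ultimately show ?thesis using Rc by (simp add: gYB_operator_def)
qed

lemma mat_inv_eighth_turn: "q \<noteq> 0 \<Longrightarrow> mat_inv (eighth_turn (flip_mat q)) = eighth_turn (- flip_mat q)"
  by (rule mat_inv_eq[of _ 8]) (simp_all add: eighth_turn_inverse[OF flip_mat_carrier flip_mat_square])

section \<open>The trace of the representation\<close>

abbreviation last_bit :: "nat \<Rightarrow> nat" where "last_bit i \<equiv> i mod 2"
abbreviation next_bit :: "nat \<Rightarrow> nat" where "next_bit i \<equiv> i div 2 mod 2"

lemma flip_perm_bits: "j < 8 \<Longrightarrow> flip_perm j mod 2 = j mod 2 \<and> flip_perm j div 2 mod 2 \<noteq> j div 2 mod 2"
proof -
  have "\<forall>j\<in>{..<8::nat}. flip_perm j mod 2 = j mod 2 \<and> flip_perm j div 2 mod 2 \<noteq> j div 2 mod 2"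
    by (simp add: lessThan_nat_numeral lessThan_Suc flip_perm_def)
  thus "j < 8 \<Longrightarrow> flip_perm j mod 2 = j mod 2 \<and> flip_perm j div 2 mod 2 \<noteq> j div 2 mod 2" by simp
qed

lemma flip_mat_labels: "preserves_label last_bit (flip_mat q)" "changes_label next_bit (flip_mat q)"
  unfolding preserves_label_def changes_label_def flip_mat_def monomial_mat_def
  using flip_perm_bits by auto

lemma preserves_label_eighth_turn:
  "\<lbrakk>preserves_label g Y; Y \<in> carrier_mat N N\<rbrakk> \<Longrightarrow> preserves_label g (eighth_turn Y)"
  unfolding eighth_turn_def
  by (intro preserves_label_smult preserves_label_add[of _ _ _ N N] preserves_label_one) auto

lemma preserves_label_uminus: "preserves_label g A \<Longrightarrow> preserves_label g (- A)"
  by (auto simp: preserves_label_def)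

lemma factors_3_1: "1 \<le> n \<Longrightarrow> factors 3 1 n = n + 1"
  by (simp add: factors_def)

text \<open>
  A letter flips only the middle one of the three bits that it acts on.
\<close>

lemma rho_letter_last_bit:
  assumes "q \<noteq> 0"
  shows "preserves_label last_bit (rho_letter 2 1 (eighth_turn (flip_mat q)) n (i, s))"
proof -
  let ?X = "if s then eighth_turn (flip_mat q) else mat_inv (eighth_turn (flip_mat q))"
  have X: "preserves_label last_bit ?X" "?X \<in> carrier_mat 8 8"
    using assms by (simp_all add: mat_inv_eighth_turn preserves_label_eighth_turn[of _ _ 8] preserves_label_uminus flip_mat_labels)
  have *: "preserves_label (\<lambda>x. last_bit (x mod 8)) (tensor_id 2 (1 * (i - 1)) \<otimes>\<^sub>m ?X)"
    by (rule preserves_label_tensor_right[OF X])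
  show ?thesis
  proof (cases "n - i - 1")
    case 0
    have "last_bit (x mod 8) = last_bit x" for x :: nat by (simp add: mod_mod_cancel)
    thus ?thesis using * 0 by (simp only: rho_letter_pad pad_def tensor_id_0 mult_0_right tensor_one_right)
  next
    case (Suc b)
    have "preserves_label (\<lambda>x. last_bit (x mod 2 ^ Suc b)) ((tensor_id 2 (1 * (i - 1)) \<otimes>\<^sub>m ?X) \<otimes>\<^sub>m tensor_id 2 (Suc b))"
      by (rule preserves_label_tensor_right[OF _ tensor_id_carrier]) (simp add: tensor_id_def preserves_label_one)
    moreover have "last_bit (x mod 2 ^ Suc b) = last_bit x" for x :: nat by (simp add: mod_mod_cancel)
    ultimately show ?thesis by (simp only: rho_letter_pad pad_def Suc mult_1)
  qed
qed

lemma rho_word_last_bit: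
  assumes q: "q \<noteq> 0" and "w \<in> braid_words n"
  shows "preserves_label last_bit (rho_word 2 3 1 (eighth_turn (flip_mat q)) n w)"
  using assms(2)
proof (induction w rule: list.induct)
  case (Cons l w)
  obtain i s where l: "l = (i, s)" by (cases l)
  have w: "w \<in> braid_words n" and i: "1 \<le> i" "i < n" using Cons.prems l by (auto simp: braid_words_def)
  note R = gYB_eighth_turn_flip_mat[OF q]
  show ?case
    unfolding rho_word_Cons l
    by (rule preserves_label_mult[OF rho_letter_last_bit[OF q] Cons.IH[OF w]])
      (use rho_letter_carrier[OF R i, of s] rho_word_carrier[OF R w] in auto)
qed (simp add: rho_word_Nil preserves_label_one)

text \<open>
  The flip is the only factor that changes the last bit but one.
\<close>

lemma mat_trace_flip:
  assumes U: "U \<in> carrier_mat (2 ^ (n + 1)) (2 ^ (n + 1))" "preserves_label last_bit U"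
    and V: "V \<in> carrier_mat (2 ^ (n + 1)) (2 ^ (n + 1))" "preserves_label last_bit V" and n: "1 \<le> n"
  shows "mat_trace ((U \<otimes>\<^sub>m 1\<^sub>m 2) * (tensor_id 2 (n - 1) \<otimes>\<^sub>m flip_mat q) * (V \<otimes>\<^sub>m 1\<^sub>m 2)) = 0"
proof -
  let ?W = "tensor_id 2 (n - 1) \<otimes>\<^sub>m flip_mat q"
  have dims: "dim_row (tensor_id 2 (n - 1)) * 8 = 2 ^ (n + 2)" "dim_col (tensor_id 2 (n - 1)) * 8 = 2 ^ (n + 2)"
    using n by (cases n; simp add: tensor_id_def)+
  have "changes_label (\<lambda>i. next_bit (i mod 8)) ?W"
    by (rule changes_label_tensor_right[OF flip_mat_labels(2)]) simp
  moreover have "next_bit (i mod 8) = next_bit i" for i :: nat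
    using mod_mult2_eq[of i 2 4] by (simp add: mod_mod_cancel)
  ultimately have W: "changes_label next_bit ?W" by simp
  have UV: "preserves_label next_bit (U \<otimes>\<^sub>m 1\<^sub>m 2)" "preserves_label next_bit (V \<otimes>\<^sub>m 1\<^sub>m 2)"
    using preserves_label_tensor_left[OF U(2) one_carrier_mat[of 2]] preserves_label_tensor_left[OF V(2) one_carrier_mat[of 2]] by simp_all
  have "changes_label next_bit ((U \<otimes>\<^sub>m 1\<^sub>m 2) * ?W)"
    by (rule changes_label_mult) (use W UV U dims in \<open>auto simp: flip_mat_def\<close>)
  hence "changes_label next_bit ((U \<otimes>\<^sub>m 1\<^sub>m 2) * ?W * (V \<otimes>\<^sub>m 1\<^sub>m 2))"
    by (intro changes_label_mult) (use UV V dims in \<open>auto simp: flip_mat_def\<close>)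
  thus ?thesis by (rule mat_trace_changes_label) (use U V in auto)
qed

lemma mult_smult_one_add_mult:
  fixes U V W :: "'a :: comm_ring_1 mat"
  assumes U: "U \<in> carrier_mat N N" and W: "W \<in> carrier_mat N N" and V: "V \<in> carrier_mat N N"
  shows "U * (c \<cdot>\<^sub>m (1\<^sub>m N + W) * V) = c \<cdot>\<^sub>m (U * V + U * W * V)"
proof -
  have W1: "1\<^sub>m N + W \<in> carrier_mat N N" using W by simp
  have "(1\<^sub>m N + W) * V = V + W * V"
    using add_mult_distrib_mat[OF one_carrier_mat W V] left_mult_one_mat[OF V] by simp
  moreover have "U * (V + W * V) = U * V + U * W * V"
    using mult_add_distrib_mat[OF U V mult_carrier_mat[OF W V]] assoc_mult_mat[OF U W V] by simp
  ultimately show ?thesis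
    unfolding mult_smult_assoc_mat[OF W1 V] mult_smult_distrib[OF U mult_carrier_mat[OF W1 V]]
    by (simp only:)
qed

text \<open>
  In \<open>R = (1 + Y) / sqrt 2\<close> the summand with \<open>Y\<close> has trace \<open>0\<close> by the preceding lemmas.  The
  other one contributes \<open>2 / sqrt 2\<close>, the trace of the identity on the new bit divided by \<open>sqrt 2\<close>.
\<close>

lemma mat_trace_stabilization:
  assumes q: "q \<noteq> 0" and n: "1 \<le> n" and u: "u \<in> braid_words n" and v: "v \<in> braid_words n"
  defines "R \<equiv> eighth_turn (flip_mat q)"
  shows "mat_trace (rho_word 2 3 1 R (Suc n) (u @ [(n, True)] @ v)) =
    complex_of_real (sqrt 2) * mat_trace (rho_word 2 3 1 R n (u @ v))"
proof -
  let ?c = "complex_of_real (1 / sqrt 2)" and ?N = "2 ^ (n + 1) :: nat"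
  note R = gYB_eighth_turn_flip_mat[OF q, folded R_def]
  define U V where "U = rho_word 2 3 1 R n u" and "V = rho_word 2 3 1 R n v"
  have U: "U \<in> carrier_mat ?N ?N" and V: "V \<in> carrier_mat ?N ?N"
    using rho_word_carrier[OF R u] rho_word_carrier[OF R v] factors_3_1[OF n] by (simp_all add: U_def V_def)
  have N2: "?N * 2 = 2 ^ (n + 2)" "2 ^ (n - 1) * 8 = (2::nat) ^ (n + 2)" using n by (cases n; simp)+
  let ?U = "U \<otimes>\<^sub>m 1\<^sub>m 2" and ?V = "V \<otimes>\<^sub>m 1\<^sub>m 2" and ?W = "tensor_id 2 (n - 1) \<otimes>\<^sub>m flip_mat q" and ?M = "2 ^ (n + 2) :: nat"
  have c: "?U \<in> carrier_mat ?M ?M" "?V \<in> carrier_mat ?M ?M" "?W \<in> carrier_mat ?M ?M"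
    using tensor_mat_carrier[OF U one_carrier_mat[of 2]] tensor_mat_carrier[OF V one_carrier_mat[of 2]]
      tensor_mat_carrier[OF tensor_id_carrier[of 2 "n - 1"] flip_mat_carrier[of q]] unfolding N2 by simp_all
  have words: "u \<in> braid_words (Suc n)" "v \<in> braid_words (Suc n)" "[(n, True)] \<in> braid_words (Suc n)" "[(n, True)] @ v \<in> braid_words (Suc n)"
    using u v n by (auto simp: braid_words_def in_lists_conv_set)
  have extra: "rho_word 2 3 1 R (Suc n) u = ?U" "rho_word 2 3 1 R (Suc n) v = ?V"
    using rho_word_extra_strand[OF R u n] rho_word_extra_strand[OF R v n] by (simp_all add: U_def V_def tensor_id_def)
  have "rho_word 2 3 1 R (Suc n) [(n, True)] = tensor_id 2 (n - 1) \<otimes>\<^sub>m R"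
    using rho_word_single[OF R n, of "Suc n" True] by (simp add: rho_letter_pad pad_def tensor_one_right[unfolded One_nat_def])
  also have "\<dots> = eighth_turn ?W"
    unfolding R_def tensor_id_def by (rule eighth_turn_tensor(2)[OF flip_mat_carrier])
  also have "\<dots> = ?c \<cdot>\<^sub>m (1\<^sub>m ?M + ?W)" by (simp only: eighth_turn_def carrier_matD(1)[OF c(3)])
  finally have "rho_word 2 3 1 R (Suc n) (u @ [(n, True)] @ v) = ?U * (?c \<cdot>\<^sub>m (1\<^sub>m ?M + ?W) * ?V)"
    by (simp only: rho_word_append[OF R words(1,4)] rho_word_append[OF R words(3,2)] extra)
  also have "\<dots> = ?c \<cdot>\<^sub>m (?U * ?V + ?U * ?W * ?V)"
    by (rule mult_smult_one_add_mult[OF c(1,3,2)])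
  finally have "mat_trace (rho_word 2 3 1 R (Suc n) (u @ [(n, True)] @ v)) = ?c * (mat_trace (?U * ?V) + mat_trace (?U * ?W * ?V))"
    using c by (simp add: mat_trace_smult[of _ ?M] mat_trace_add[of _ ?M])
  also have "mat_trace (?U * ?W * ?V) = 0"
    by (rule mat_trace_flip[OF U _ V _ n]) (use rho_word_last_bit[OF q] u v in \<open>simp_all add: U_def V_def R_def\<close>)
  also have "?U * ?V = (U * V) \<otimes>\<^sub>m 1\<^sub>m 2"
    using tensor_mat_mult[OF U V one_carrier_mat one_carrier_mat, of 2] by simp
  also have "mat_trace \<dots> = 2 * mat_trace (U * V)"
    using mat_trace_tensor[OF mult_carrier_mat[OF U V] one_carrier_mat[of 2]] by (simp add: mat_trace_one)
  also have "U * V = rho_word 2 3 1 R n (u @ v)" by (simp only: U_def V_def rho_word_append[OF R u v])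
  also have "?c * (2 * x + 0) = complex_of_real (sqrt 2) * x" for x
  proof -
    have "complex_of_real (sqrt 2) * complex_of_real (sqrt 2) = 2"
      by (simp flip: of_real_mult)
    thus ?thesis by (simp add: field_simps)
  qed
  finally show ?thesis .
qed

text \<open>
  The value \<open>T_braid\<close> on words, for \<open>\<mu> = 1\<close>, \<open>\<alpha> = 1\<close> and \<open>\<beta> = sqrt 2\<close>.
\<close>

definition normalized_trace :: "complex mat \<Rightarrow> nat \<Rightarrow> braid_word \<Rightarrow> complex" where
  "normalized_trace R n w = inverse (complex_of_real (sqrt 2)) ^ n * mat_trace (rho_word 2 3 1 R n w)"

lemma rho_letter_skein:
  assumes q: "q \<noteq> 0" and i: "1 \<le> i" "i < n"
  defines "R \<equiv> eighth_turn (flip_mat q)"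
  shows "rho_letter 2 1 R n (i, True) + rho_letter 2 1 R n (i, False) = complex_of_real (sqrt 2) \<cdot>\<^sub>m 1\<^sub>m (2 ^ factors 3 1 n)"
proof -
  note R = gYB_eighth_turn_flip_mat[OF q, folded R_def]
  have Rc: "R \<in> carrier_mat 8 8" "mat_inv R \<in> carrier_mat 8 8" using gYB_operatorD[OF R] by simp_all
  have two: "1 / complex_of_real (sqrt 2) + 1 / complex_of_real (sqrt 2) = complex_of_real (sqrt 2)"
    by (simp flip: of_real_mult of_real_add of_real_divide add: field_simps)
  have sum: "R + mat_inv R = complex_of_real (sqrt 2) \<cdot>\<^sub>m 1\<^sub>m (2 ^ 3)"
    unfolding R_def mat_inv_eighth_turn[OF q] unfolding eighth_turn_def using two
    by (intro eq_matI) (auto simp: flip_mat_def algebra_simps)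
  have "rho_letter 2 1 R n (i, True) + rho_letter 2 1 R n (i, False) = pad 2 (1 * (i - 1)) (1 * (n - i - 1)) (R + mat_inv R)"
    unfolding rho_letter_pad pad_def tensor_add_right[OF Rc]
    using tensor_add_left[OF tensor_mat_carrier[OF tensor_id_carrier Rc(1)] tensor_mat_carrier[OF tensor_id_carrier Rc(2)]] by simp
  also have "\<dots> = complex_of_real (sqrt 2) \<cdot>\<^sub>m pad 2 (1 * (i - 1)) (1 * (n - i - 1)) (1\<^sub>m (2 ^ 3))"
    unfolding sum pad_def tensor_smult_left tensor_smult_right ..
  finally show ?thesis unfolding pad_one factors_eq[OF i, of 1 3] .
qed

lemma skein_trace_normalized_trace:
  assumes q: "q \<noteq> 0"
  defines "R \<equiv> eighth_turn (flip_mat q)"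
  shows "skein_trace (complex_of_real (sqrt 2)) 1 (complex_of_real (sqrt 2)) (normalized_trace R)"
proof (rule skein_traceI)
  let ?r = "complex_of_real (sqrt 2)"
  have r2: "?r * ?r = 2" by (simp flip: of_real_mult)
  note R = gYB_eighth_turn_flip_mat[OF q, folded R_def]
  {
    fix n u v assume n: "1 \<le> n" and u: "u \<in> braid_words n" and v: "v \<in> braid_words n"
    let ?N = "2 ^ factors 3 1 n :: nat" and ?U = "rho_word 2 3 1 R n u" and ?V = "rho_word 2 3 1 R n v"
    show "normalized_trace R n (u @ [(i, True)] @ v) + normalized_trace R n (u @ [(i, False)] @ v)
        = ?r * normalized_trace R n (u @ v)" if "i \<in> {1..<n}" for i
    proof -
      have i: "1 \<le> i" "i < n" using that by auto
      let ?L = "\<lambda>s. rho_letter 2 1 R n (i, s)"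
      note c = rho_word_carrier[OF R u] rho_word_carrier[OF R v] rho_letter_carrier[OF R i]
      have w: "rho_word 2 3 1 R n (u @ [(i, s)] @ v) = ?U * (?L s * ?V)" for s
        using rho_word_append[OF R u, of "[(i, s)] @ v"] v i by (simp add: rho_word_Cons braid_words_def)
      have "mat_trace (?U * (?L True * ?V)) + mat_trace (?U * (?L False * ?V)) = mat_trace (?U * ((?L True + ?L False) * ?V))"
        unfolding add_mult_distrib_mat[OF c(3,3,2)] mult_add_distrib_mat[OF c(1) mult_carrier_mat[OF c(3,2)] mult_carrier_mat[OF c(3,2)]]
        by (rule mat_trace_add[symmetric]) (rule mult_carrier_mat[OF c(1) mult_carrier_mat[OF c(3,2)]])+
      also have "\<dots> = ?r * mat_trace (?U * ?V)"
        unfolding rho_letter_skein[OF q i, folded R_def]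
        using c by (simp add: mult_smult_assoc_mat[of _ ?N ?N _ ?N] mult_smult_distrib[of _ ?N ?N _ ?N] mat_trace_smult[of _ ?N])
      finally show ?thesis
        unfolding normalized_trace_def w rho_word_append[OF R u v] by (simp add: distrib_left[symmetric])
    qed
    show "normalized_trace R n (u @ x @ v) = normalized_trace R n (u @ y @ v)"
      if "x \<in> braid_words n" "y \<in> braid_words n" "braid_relation x y" for x y
      using rho_word_relation_context[OF R that(3), of u v n] u v that by (simp add: normalized_trace_def braid_words_def)
    show "normalized_trace R (Suc n) (u @ [(n, True)] @ v) = 1 * normalized_trace R n (u @ v)"
      unfolding normalized_trace_def R_def mat_trace_stabilization[OF q n u v] by simp
  }
  fix n u assume n: "1 \<le> n" and u: "u \<in> braid_words n"
  have "mat_trace (rho_word 2 3 1 R (Suc n) u) = 2 * mat_trace (rho_word 2 3 1 R n u)"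
    using rho_word_extra_strand[OF R u n] mat_trace_tensor[OF rho_word_carrier[OF R u] tensor_id_carrier[of 2 1]] by (simp add: tensor_id_def mat_trace_one)
  thus "normalized_trace R (Suc n) u = ?r * normalized_trace R n u"
    unfolding normalized_trace_def using r2 by (simp add: field_simps)
qed

section \<open>Braid classes\<close>

lemma equiv_braid_equiv: "equiv (braid_words n) (braid_equiv n)"
  unfolding braid_equiv_def
  by (intro equivI refl_onI symI transI) (auto intro: equivclp_sym equivclp_trans)

lemma braid_equiv_in_words: "(w, w') \<in> braid_equiv n \<Longrightarrow> w \<in> braid_words n \<and> w' \<in> braid_words n"
  by (auto simp: braid_equiv_def)

text \<open>
  A relation between subwords may be applied inside a longer word, so concatenation is well defined on
  classes.
\<close>

lemma braid_equiv_append: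
  assumes "(w, w') \<in> braid_equiv n" "a \<in> braid_words n" "b \<in> braid_words n"
  shows "(a @ w @ b, a @ w' @ b) \<in> braid_equiv n"
proof -
  have step: "braid_step n (a @ y @ b) (a @ z @ b)" if yz: "braid_step n y z" for y z
  proof -
    obtain u v x x' where "braid_relation x x'" "y = u @ x @ v" "z = u @ x' @ v"
      and w: "y \<in> braid_words n" "z \<in> braid_words n" using yz by (auto simp: braid_step_def)
    moreover from this have "a @ y @ b = (a @ u) @ x @ (v @ b)" "a @ z @ b = (a @ u) @ x' @ (v @ b)" by simp_all
    moreover have "a @ y @ b \<in> braid_words n" "a @ z @ b \<in> braid_words n" using w assms by simp_all
    ultimately show ?thesis unfolding braid_step_def by blast
  qed
  have "equivclp (braid_step n) w w'" using assms(1) by (simp add: braid_equiv_def)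
  hence "equivclp (braid_step n) (a @ w @ b) (a @ w' @ b)"
  proof (induction rule: equivclp_induct)
    case (step y z)
    hence "equivclp (braid_step n) (a @ y @ b) (a @ z @ b)"
      using \<open>\<And>z y. braid_step n y z \<Longrightarrow> braid_step n (a @ y @ b) (a @ z @ b)\<close> by (auto intro: equivclp_sym)
    thus ?case using step.IH equivclp_trans by fast
  qed simp
  thus ?thesis using assms braid_equiv_in_words[OF assms(1)] by (simp add: braid_equiv_def)
qed

definition braid_class :: "nat \<Rightarrow> braid_word \<Rightarrow> braid_word set" where
  "braid_class n w = braid_equiv n `` {w}"

lemma braid_class_eq_iff:
  "\<lbrakk>u \<in> braid_words n; v \<in> braid_words n\<rbrakk> \<Longrightarrow> braid_class n u = braid_class n v \<longleftrightarrow> (u, v) \<in> braid_equiv n"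
  unfolding braid_class_def by (rule eq_equiv_class_iff[OF equiv_braid_equiv])

lemma carrier_braid_group: "carrier (braid_group n) = braid_class n ` braid_words n"
  by (auto simp: braid_group_def quotient_def braid_class_def)

lemma one_braid_group: "\<one>\<^bsub>braid_group n\<^esub> = braid_class n []"
  by (simp add: braid_group_def braid_class_def)

lemma mult_braid_group:
  assumes u: "u \<in> braid_words n" and v: "v \<in> braid_words n"
  shows "braid_class n u \<otimes>\<^bsub>braid_group n\<^esub> braid_class n v = braid_class n (u @ v)"
proof -
  have "braid_equiv n `` {x @ y} = braid_class n (u @ v)"
    if "x \<in> braid_class n u" "y \<in> braid_class n v" for x y
  proof -
    have xy: "(u, x) \<in> braid_equiv n" "(v, y) \<in> braid_equiv n" using that by (auto simp: braid_class_def)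
    note w = braid_equiv_in_words[OF xy(1)] braid_equiv_in_words[OF xy(2)]
    have "(u @ v, x @ v) \<in> braid_equiv n" "(x @ v, x @ y) \<in> braid_equiv n"
      using braid_equiv_append[OF xy(1), of "[]" v] braid_equiv_append[OF xy(2), of x "[]"] w by simp_all
    hence "(u @ v, x @ y) \<in> braid_equiv n" using equiv_braid_equiv[of n] by (meson equivE transD)
    thus ?thesis using braid_class_eq_iff[of "u @ v" n "x @ y"] w by (simp add: braid_class_def)
  qed
  moreover have "u \<in> braid_class n u" "v \<in> braid_class n v"
    using equiv_class_self[OF equiv_braid_equiv] u v by (simp_all add: braid_class_def)
  ultimately show ?thesis by (auto simp: braid_group_def)
qed

lemma monoid_braid_group: "Group.monoid (braid_group n)"
proof (rule monoidI)
  show "\<one>\<^bsub>braid_group n\<^esub> \<in> carrier (braid_group n)"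
    by (simp add: one_braid_group carrier_braid_group)
qed (auto simp: one_braid_group carrier_braid_group mult_braid_group)

lemma inv_braid_gen:
  assumes "1 \<le> i" "i < n"
  shows "inv\<^bsub>braid_group n\<^esub> (braid_gen n i) = braid_class n [(i, False)]"
proof -
  interpret Group.monoid "braid_group n" by (rule monoid_braid_group)
  have gen: "braid_gen n i = braid_class n [(i, True)]" by (simp add: braid_gen_def braid_class_def)
  have "braid_class n [(i, s), (i, \<not> s)] = braid_class n []" for s
  proof -
    have ww: "[(i, s), (i, \<not> s)] \<in> braid_words n" using assms by simp
    have "braid_step n [(i, s), (i, \<not> s)] []"
      unfolding braid_step_def using ww braid_relation.cancel[of i s]
      by (intro conjI exI[of _ "[]"] exI[of _ "[(i, s), (i, \<not> s)]"]) auto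
    hence "([(i, s), (i, \<not> s)], []) \<in> braid_equiv n" using ww by (auto simp: braid_equiv_def intro: r_into_equivclp)
    thus ?thesis using braid_class_eq_iff[of _ n "[]"] ww by simp
  qed
  from this[of True] this[of False] show ?thesis
    unfolding gen
    by (intro inv_char) (use assms in \<open>simp_all add: mult_braid_group carrier_braid_group one_braid_group\<close>)
qed

lemma on_class_eq:
  assumes w: "w \<in> braid_words n"
    and f: "\<And>u v x y. \<lbrakk>braid_relation x y; u @ x @ v \<in> braid_words n; u @ y @ v \<in> braid_words n\<rbrakk>
      \<Longrightarrow> f (u @ x @ v) = f (u @ y @ v)"
  shows "on_class f (braid_class n w) = f w"
proof -
  have step: "f y = f z" if "braid_step n y z" for y z
    using that f by (auto simp: braid_step_def)
  have const: "f x = f w" if "x \<in> braid_class n w" for x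
  proof -
    have "equivclp (braid_step n) w x" using that by (simp add: braid_class_def braid_equiv_def)
    thus ?thesis by (induction rule: equivclp_induct) (auto dest: step)
  qed
  have self: "w \<in> braid_class n w" using equiv_class_self[OF equiv_braid_equiv w] by (simp add: braid_class_def)
  show ?thesis
    unfolding on_class_def
  proof (rule the_equality)
    show "\<forall>x\<in>braid_class n w. f x = f w" using const by blast
    show "y = f w" if "\<forall>x\<in>braid_class n w. f x = y" for y using that self by simp
  qed
qed

lemma rho_braid_class:
  assumes "gYB_operator d k m R" "w \<in> braid_words n"
  shows "rho d k m R n (braid_class n w) = rho_word d k m R n w"
  unfolding rho_def by (rule on_class_eq[OF assms(2)]) (rule rho_word_relation_context[OF assms(1)])

section \<open>The enhancement\<close>

text \<open>
  The partial trace sums entries of \<open>eighth_turn Z\<close> between vectors with the same last bit, and the last bit of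
  the numbers \<open>i\<close>, \<open>j\<close> is the middle bit of these vectors.  If it is the same for both numbers,
  \<open>Z\<close> does not contribute, and the identity contributes \<open>2 / sqrt 2\<close> on the diagonal, which is
  subtracted.
\<close>

lemma Sp_eighth_turn:
  assumes Z: "Z \<in> carrier_mat 8 8" "changes_label next_bit Z"
  shows "changes_label last_bit (Sp 2 3 1 (eighth_turn Z) - complex_of_real (sqrt 2) \<cdot>\<^sub>m tensor_id 2 2)"
  unfolding changes_label_def
proof (intro allI impI notI)
  let ?D = "Sp 2 3 1 (eighth_turn Z) - complex_of_real (sqrt 2) \<cdot>\<^sub>m tensor_id 2 2"
  fix i j assume "i < dim_row ?D" "j < dim_col ?D" and nz: "?D $$ (i, j) \<noteq> 0" and eq: "last_bit i = last_bit j"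
  hence ij: "i < 4" "j < 4" by (simp_all add: Sp_def tensor_id_def)
  have h: "eighth_turn Z $$ (i * 2 + l, j * 2 + l) = (if i = j then 1 / complex_of_real (sqrt 2) else 0)" if l: "l < 2" for l
  proof -
    have "next_bit (i * 2 + l) = next_bit (j * 2 + l)" using eq l by simp
    moreover have "\<forall>a<8. \<forall>b<8. Z $$ (a, b) \<noteq> 0 \<longrightarrow> next_bit a \<noteq> next_bit b"
      using Z(2) carrier_matD[OF Z(1)] by (simp only: changes_label_def)
    moreover have "i * 2 + l < 8" "j * 2 + l < 8" using ij l by simp_all
    ultimately have "Z $$ (i * 2 + l, j * 2 + l) = 0" by blast
    thus ?thesis using Z ij l by (auto simp: eighth_turn_def)
  qed
  have "?D $$ (i, j) = 0"
    using ij h[of 0] h[of 1] by (auto simp: Sp_def tensor_id_def lessThan_nat_numeral lessThan_Suc numeral_2_eq_2 field_simps simp flip: of_real_mult)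
  thus False using nz by simp
qed

text \<open>
  The representation preserves the last bit, which the partial trace minus \<open>sqrt 2\<close> changes.
\<close>

lemma eighth_turn_perp:
  assumes q: "q \<noteq> 0" and n: "1 \<le> n" and Z: "Z \<in> carrier_mat 8 8" "changes_label next_bit Z"
  defines "R \<equiv> eighth_turn (flip_mat q)"
  shows "tensor_id 2 (n - 1) \<otimes>\<^sub>m (Sp 2 3 1 (eighth_turn Z) - complex_of_real (sqrt 2) \<cdot>\<^sub>m tensor_id 2 2)
    \<in> perp (2 ^ factors 3 1 n) (im_rho 2 3 1 R n)"
proof -
  let ?D = "Sp 2 3 1 (eighth_turn Z) - complex_of_real (sqrt 2) \<cdot>\<^sub>m tensor_id 2 2"
  let ?g = "tensor_id 2 (n - 1) \<otimes>\<^sub>m ?D" and ?N = "2 ^ factors 3 1 n :: nat"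
  note R = gYB_eighth_turn_flip_mat[OF q, folded R_def]
  have D: "?D \<in> carrier_mat 4 4" by (rule carrier_matI) (simp_all add: Sp_def tensor_id_def)
  have N: "2 ^ (n - 1) * 4 = ?N" using n by (cases n) (simp_all add: factors_def)
  have g: "?g \<in> carrier_mat ?N ?N" using tensor_mat_carrier[OF tensor_id_carrier D, of 2 "n - 1"] unfolding N .
  have "changes_label (\<lambda>x. last_bit (x mod 4)) ?g"
    by (rule changes_label_tensor_right[OF Sp_eighth_turn[OF Z] D])
  hence lg: "changes_label last_bit ?g" by (simp add: mod_mod_cancel)
  have "mat_trace (mat_adjoint f * ?g) = 0" if "f \<in> im_rho 2 3 1 R n" for f
  proof -
    obtain w where w: "w \<in> braid_words n" "f = rho 2 3 1 R n (braid_class n w)"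
      using \<open>f \<in> im_rho 2 3 1 R n\<close> unfolding im_rho_def carrier_braid_group by blast
    note w(2)[unfolded rho_braid_class[OF R w(1)]]
    with w(1) have w: "w \<in> braid_words n" "f = rho_word 2 3 1 R n w" by simp_all
    have f: "f \<in> carrier_mat ?N ?N" using rho_word_carrier[OF R w(1)] w(2) by simp
    have "preserves_label last_bit (mat_adjoint f)"
      using rho_word_last_bit[OF q w(1)] w(2) by (simp add: R_def preserves_label_adjoint)
    hence "changes_label last_bit (mat_adjoint f * ?g)"
      by (intro changes_label_mult) (use lg f carrier_matD[OF g] in \<open>auto simp: dim_mat_adjoint\<close>)
    thus ?thesis by (rule mat_trace_changes_label) (use f carrier_matD[OF g] in \<open>auto simp: dim_mat_adjoint\<close>)
  qed
  thus ?thesis using g by (simp add: perp_def)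
qed

lemma EgYB_eighth_turn_flip_mat:
  assumes q: "q \<noteq> 0"
  shows "EgYB_operator 2 3 1 (eighth_turn (flip_mat q), 1\<^sub>m 2, 1, complex_of_real (sqrt 2))"
proof -
  let ?R = "eighth_turn (flip_mat q)"
  have R: "?R \<in> carrier_mat (2 ^ 3) (2 ^ 3)" "mat_inv ?R \<in> carrier_mat (2 ^ 3) (2 ^ 3)"
    using gYB_operatorD[OF gYB_eighth_turn_flip_mat[OF q]] by simp_all
  have id: "?R * tensor_id 2 3 = ?R" "tensor_id 2 3 * ?R = ?R" "mat_inv ?R * tensor_id 2 3 = mat_inv ?R"
    unfolding tensor_id_def using right_mult_one_mat[OF R(1)] left_mult_one_mat[OF R(1)] right_mult_one_mat[OF R(2)] by blast+
  have minus: "changes_label next_bit (- flip_mat q)"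
    using flip_mat_labels(2)[of q] by (auto simp: changes_label_def)
  have perp: "tensor_id 2 (1 * (n - 1)) \<otimes>\<^sub>m (Sp 2 3 1 ?R - (1 * complex_of_real (sqrt 2)) \<cdot>\<^sub>m tensor_id 2 (3 - 1))
      \<in> perp (2 ^ factors 3 1 n) (im_rho 2 3 1 ?R n)"
    "tensor_id 2 (1 * (n - 1)) \<otimes>\<^sub>m (Sp 2 3 1 (mat_inv ?R) - (inverse 1 * complex_of_real (sqrt 2)) \<cdot>\<^sub>m tensor_id 2 (3 - 1))
      \<in> perp (2 ^ factors 3 1 n) (im_rho 2 3 1 ?R n)" if "1 \<le> n" for n
    using eighth_turn_perp[OF q that flip_mat_carrier flip_mat_labels(2)[of q]] eighth_turn_perp[OF q that _ minus]
    by (simp_all add: mat_inv_eighth_turn[OF q])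
  show ?thesis
    unfolding EgYB_operator.simps tensor_pow_one id
    using gYB_eighth_turn_flip_mat[OF q] perp by (intro conjI allI impI) (simp_all only: one_carrier_mat, simp_all)
qed

section \<open>The link invariant\<close>

text \<open>
  One may take \<open>A = exp (3 \<pi> \<i> / 8)\<close>.
\<close>

lemma jones_parameter: "\<exists>A::complex. A \<noteq> 0 \<and> A ^ 2 + inverse A ^ 2 = - complex_of_real (sqrt 2)"
proof -
  let ?A = "cis (3 * pi / 8)"
  have "?A ^ 2 + inverse ?A ^ 2 = cis (3 * pi / 4) + cis (- (3 * pi / 4))"
    by (simp add: DeMoivre cis_inverse)
  also have "\<dots> = - complex_of_real (sqrt 2)"
  proof -
    have "cos (3 * pi / 4) = - (sqrt 2 / 2)"
      using cos_pi_minus[of "pi / 4"] by (simp add: cos_45 field_simps)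
    thus ?thesis by (simp add: complex_eq_iff)
  qed
  finally show ?thesis by (intro exI[of _ ?A]) simp
qed

lemma closure_isotopic_cong: "isotopic L L' \<Longrightarrow> closure_isotopic n \<xi> L \<longleftrightarrow> closure_isotopic n \<xi> L'"
  unfolding closure_isotopic_def by (meson isotopic_sym isotopic_trans)

lemma skein_trace_scale: "skein_trace z p q F \<Longrightarrow> skein_trace z p q (\<lambda>n w. c * F n w)"
  unfolding skein_trace_def by (simp add: algebra_simps) (metis distrib_left mult.left_commute)

text \<open>
  The factor \<open>2\<close> comes from the trivial braid on one strand.  It acts on two bits, with normalized trace
  \<open>4 / sqrt 2\<close>, while a circle has value \<open>sqrt 2\<close>.
\<close>

lemma normalized_trace_eq_jones_value:
  assumes A: "A \<noteq> 0" "A ^ 2 + inverse A ^ 2 = - complex_of_real (sqrt 2)" and q: "q \<noteq> 0"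
    and n: "1 \<le> n" and w: "w \<in> braid_words n"
  shows "normalized_trace (eighth_turn (flip_mat q)) n w = 2 * jones_value A (word_closure n w)"
proof (rule skein_trace_unique[OF skein_trace_normalized_trace[OF q] _ _ n w])
  let ?r = "complex_of_real (sqrt 2)"
  have r2: "?r ^ 2 = 2" by (simp flip: of_real_power)
  show "skein_trace ?r 1 ?r (\<lambda>n w. 2 * jones_value A (word_closure n w))"
    by (rule skein_trace_scale[OF skein_trace_jones_value[OF A r2]])
  have J0: "jones_value A (word_closure 0 []) = 1"
    by (simp add: jones_value_def kauffman_weight_def word_closure_def)
  have d: "- (A ^ 2) - inverse A ^ 2 = ?r" using A(2) by (metis add_uminus_conv_diff minus_add_distrib minus_minus)
  have "jones_value A (word_closure 1 []) = ?r"
    using jones_value_extra_strand[OF A(1), of "[]" 0] by (simp add: J0 d)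
  thus "normalized_trace (eighth_turn (flip_mat q)) 1 [] = 2 * jones_value A (word_closure 1 [])"
    using r2 by (simp add: normalized_trace_def rho_word_Nil factors_def mat_trace_one power2_eq_square field_simps)
qed

lemma T_braid_eq_normalized_trace:
  assumes q: "q \<noteq> 0" and n: "1 \<le> n" and w: "w \<in> braid_words n"
  defines "R \<equiv> eighth_turn (flip_mat q)"
  shows "T_braid 2 3 1 (R, 1\<^sub>m 2, 1, complex_of_real (sqrt 2)) n (braid_class n w) = normalized_trace R n w"
proof -
  note R = gYB_eighth_turn_flip_mat[OF q, folded R_def]
  have "rho_word 2 3 1 R n w * tensor_id 2 (factors 3 1 n) = rho_word 2 3 1 R n w"
    unfolding tensor_id_def using right_mult_one_mat[OF rho_word_carrier[OF R w]] .
  moreover have "complex_of_real (sqrt 2) powi (- int n) = inverse (complex_of_real (sqrt 2)) ^ n"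
    by (simp add: power_int_minus power_inverse)
  ultimately show ?thesis
    by (simp only: T_braid.simps tensor_pow_one rho_braid_class[OF R w] normalized_trace_def power_int_1_left mult_1)
qed

theorem theorem4p1p4:
  fixes \<theta> :: real and S :: enhanced_operator
  assumes "0 \<le> \<theta>" and "\<theta> \<le> pi"
    and S: "S = (R_III \<theta>, 1\<^sub>m 2, 1, complex_of_real (sqrt 2))"
  shows "EgYB_operator 2 3 1 S \<and>
    (\<forall>n\<ge>1. \<forall>\<xi>\<in>carrier (braid_group n). \<forall>L.
       closure_isotopic n \<xi> L \<longrightarrow> T_link 2 3 1 S L = T_braid 2 3 1 S n \<xi>) \<and>
    (\<forall>L L'. isotopic L L' \<longrightarrow> T_link 2 3 1 S L = T_link 2 3 1 S L') \<and>
    (\<forall>Lminus Lzero Lplus. skein_triple Lminus Lzero Lplus \<longrightarrow>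
       T_link 2 3 1 S Lplus + T_link 2 3 1 S Lminus = complex_of_real (sqrt 2) * T_link 2 3 1 S Lzero) \<and>
    (\<forall>n\<ge>1. T_link 2 3 1 S (trivial_link n) = complex_of_real (sqrt 2) powi (- int n) * 2 ^ (n + 1))"
proof -
  define q where "q = exp (\<i> * complex_of_real \<theta>)"
  have q: "q \<noteq> 0" by (simp add: q_def)
  let ?R = "eighth_turn (flip_mat q)" and ?r = "complex_of_real (sqrt 2)"
  have S: "S = (?R, 1\<^sub>m 2, 1, ?r)" by (simp only: S R_III_eighth_turn q_def)
  obtain A :: complex where A: "A \<noteq> 0" "A ^ 2 + inverse A ^ 2 = - ?r" using jones_parameter by blast
  have T: "T_braid 2 3 1 S n (braid_class n w) = normalized_trace ?R n w" if "1 \<le> n" "w \<in> braid_words n" for n w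
    unfolding S by (rule T_braid_eq_normalized_trace[OF q that])
  have J: "T_braid 2 3 1 S n \<xi> = 2 * jones_value A L"
    if n: "1 \<le> n" and \<xi>: "\<xi> \<in> carrier (braid_group n)" and L: "closure_isotopic n \<xi> L" for n \<xi> L
  proof -
    obtain v where v: "v \<in> braid_words n" "\<xi> = braid_class n v" using \<xi> by (auto simp: carrier_braid_group)
    obtain w where w: "w \<in> \<xi>" "isotopic (word_closure n w) L" using L by (auto simp: closure_isotopic_def)
    have vw: "(v, w) \<in> braid_equiv n" using w v by (simp add: braid_class_def)
    hence wn: "w \<in> braid_words n" using braid_equiv_in_words by blast
    have "\<xi> = braid_class n w" using braid_class_eq_iff[OF v(1) wn] vw v(2) by simp
    thus ?thesis
      using T[OF n wn] normalized_trace_eq_jones_value[OF A q n wn] jones_value_isotopic[OF A(1) w(2)] by simp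
  qed
  have link: "T_link 2 3 1 S L = T_braid 2 3 1 S n \<xi>"
    if "1 \<le> n" "\<xi> \<in> carrier (braid_group n)" "closure_isotopic n \<xi> L" for n \<xi> L
    unfolding T_link_def
  proof (rule the_equality)
    show "\<exists>n'\<ge>1. \<exists>\<xi>'\<in>carrier (braid_group n'). closure_isotopic n' \<xi>' L \<and>
        T_braid 2 3 1 S n \<xi> = T_braid 2 3 1 S n' \<xi>'"
      using that by blast
    fix t assume "\<exists>n\<ge>1. \<exists>\<xi>\<in>carrier (braid_group n). closure_isotopic n \<xi> L \<and> t = T_braid 2 3 1 S n \<xi>"
    thus "t = T_braid 2 3 1 S n \<xi>" using J that by auto
  qed
  show ?thesis
  proof (intro conjI allI impI ballI)
    show "EgYB_operator 2 3 1 S" unfolding S by (rule EgYB_eighth_turn_flip_mat[OF q])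
  next
    fix n \<xi> L assume "1 \<le> n" "\<xi> \<in> carrier (braid_group n)" "closure_isotopic n \<xi> L"
    thus "T_link 2 3 1 S L = T_braid 2 3 1 S n \<xi>" by (rule link)
  next
    fix L L' assume "isotopic L L'"
    thus "T_link 2 3 1 S L = T_link 2 3 1 S L'" unfolding T_link_def by (simp only: closure_isotopic_cong)
  next
    fix Lminus Lzero Lplus assume "skein_triple Lminus Lzero Lplus"
    then obtain n \<xi> where n: "2 \<le> n" and \<xi>: "\<xi> \<in> carrier (braid_group n)"
      and L: "closure_isotopic n \<xi> Lzero"
        "closure_isotopic n (braid_gen n 1 \<otimes>\<^bsub>braid_group n\<^esub> \<xi>) Lplus"
        "closure_isotopic n (inv\<^bsub>braid_group n\<^esub> (braid_gen n 1) \<otimes>\<^bsub>braid_group n\<^esub> \<xi>) Lminus"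
      unfolding skein_triple_def by blast
    obtain w where w: "w \<in> braid_words n" "\<xi> = braid_class n w" using \<xi> by (auto simp: carrier_braid_group)
    have n1: "1 \<le> n" "1 < n" using n by simp_all
    have gens: "[(1, s)] \<in> braid_words n" for s using n by simp
    have plus: "braid_gen n 1 \<otimes>\<^bsub>braid_group n\<^esub> \<xi> = braid_class n ([(1, True)] @ w)"
      using mult_braid_group[OF gens w(1)] by (simp add: braid_gen_def braid_class_def w(2))
    have minus: "inv\<^bsub>braid_group n\<^esub> (braid_gen n 1) \<otimes>\<^bsub>braid_group n\<^esub> \<xi> = braid_class n ([(1, False)] @ w)"
      unfolding inv_braid_gen[OF order_refl n1(2)] w(2) by (rule mult_braid_group[OF gens w(1)])
    have words: "[(1, s)] @ w \<in> braid_words n" for s using w(1) n by simp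
    have carr: "braid_class n u \<in> carrier (braid_group n)" if "u \<in> braid_words n" for u
      using that by (simp add: carrier_braid_group)
    have "T_link 2 3 1 S Lplus = normalized_trace ?R n ([(1, True)] @ w)"
      by (simp only: link[OF n1(1) carr[OF words] L(2)[unfolded plus]] T[OF n1(1) words])
    moreover have "T_link 2 3 1 S Lminus = normalized_trace ?R n ([(1, False)] @ w)"
      by (simp only: link[OF n1(1) carr[OF words] L(3)[unfolded minus]] T[OF n1(1) words])
    moreover have "T_link 2 3 1 S Lzero = normalized_trace ?R n w"
      by (simp only: link[OF n1(1) \<xi> L(1)] w(2) T[OF n1(1) w(1)])
    moreover have "normalized_trace ?R n ([(1, True)] @ w) + normalized_trace ?R n ([(1, False)] @ w) = ?r * normalized_trace ?R n w"
      using skein_traceD(1)[OF skein_trace_normalized_trace[OF q] n1(1) _ w(1), of "[]" 1] n by simp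
    ultimately show "T_link 2 3 1 S Lplus + T_link 2 3 1 S Lminus = ?r * T_link 2 3 1 S Lzero" by simp
  next
    fix n :: nat assume n: "1 \<le> n"
    have e: "[] \<in> braid_words n" by simp
    have "isotopic (word_closure n []) (trivial_link n)" using isotopic_trivial_link[of "[]" n] by simp
    moreover have "[] \<in> braid_class n []"
      using equiv_class_self[OF equiv_braid_equiv e] by (simp add: braid_class_def)
    ultimately have c: "closure_isotopic n (braid_class n []) (trivial_link n)" by (auto simp: closure_isotopic_def)
    have "braid_class n [] \<in> carrier (braid_group n)" by (simp add: carrier_braid_group)
    hence "T_link 2 3 1 S (trivial_link n) = normalized_trace ?R n []"
      by (simp only: link[OF n _ c] T[OF n e])
    also have "\<dots> = ?r powi (- int n) * 2 ^ (n + 1)"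
      using factors_3_1[OF n] by (simp add: normalized_trace_def rho_word_Nil mat_trace_one power_int_minus power_inverse)
    finally show "T_link 2 3 1 S (trivial_link n) = ?r powi (- int n) * 2 ^ (n + 1)" .
  qed
qed

end
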